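(* Let $F$ be a Fréchet space and let $A=(a_{i,k})_{i,k\in\mathbb{N}}$, $B=(b_{j,k})_{j,k\in\mathbb{N}}$ be Köthe matrices. The following statements are equivalent. (1) $(\lambda(A),\lambda(B),F)\in\mathfrak{TF}$. (2) $(\lambda^\infty_0(A),\lambda(B),F)\in\mathfrak{TF}$. (3) There exists a nondecreasing function $S:\mathbb{N}\to\mathbb{N}$ such that for every nondecreasing $\phi:\mathbb{N}\to\mathbb{N}$ the following holds: there exists $k_0\in\mathbb{N}$ such that for every $k\ge k_0$ there exist $q_k\in\mathbb{N}$ and $C_k>0$ with $$\frac{\|z\|_k}{a_{i,S(k)}}\le C_k\max_{1\le q\le q_k}\Bigl\{\frac{b_{j,q}}{a_{i,\phi(q)}}\Bigr\}\max_{1\le q\le q_k}\Bigl\{\frac{\|z\|_q}{b_{j,\phi(q)}}\Bigr\}$$ for every $z\in F$ and $i,j\in\mathbb{N}$.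
   Context: $\mathbb{N}=\{1,2,3,\dots\}$. Every Fréchet space is equipped with a fixed grading, i.e. an increasing sequence of seminorms $(\|\cdot\|_k)_{k\in\mathbb{N}}$ defining its topology. A Köthe matrix is a matrix $(a_{n,k})_{n,k\in\mathbb{N}}$ of non-negative scalars with $a_{n,k}\le a_{n,k+1}$ for all $n,k$, such that for every $n$ there is $k$ with $a_{n,k}>0$. With $\mathbb{K}=\mathbb{R}$ or $\mathbb{C}$: $\lambda(A)=\{x\in\mathbb{K}^{\mathbb{N}}:\|x\|_k=\sum_j|x_j|a_{j,k}<\infty\ \forall k\}$; $\lambda^\infty(A)=\{x\in\mathbb{K}^{\mathbb{N}}:\|x\|_k=\sup_j|x_j|a_{j,k}<\infty\ \forall k\}$; $\lambda^\infty_0(A)=\{x\in\lambda^\infty(A):\lim_{j\to\infty}x_ja_{j,k}=0\ \forall k\}$, each graded by the indicated seminorms. $L(E,F)$ is the space of continuous linear operators $E\to F$. For $T\in L(E,F)$ put $\|T\|_{k,r}=\sup_{\|x\|_r\le1}\|Tx\|_k\in[0,\infty]$ and $\pi_T(k)=\inf\{r\in\mathbb{N}:\|T\|_{k,r}<\infty\}$. $L^G(E,F)$ is the set of $T\in L(E,F)$ of the form $T=RQ$ with $Q\in L(E,G)$, $R\in L(G,F)$. $(E,G,F)\in\mathfrak{TF}$ (tame factorization property) means: there is a nondecreasing $S:\mathbb{N}\to\mathbb{N}$ such that for every $T\in L^G(E,F)$ there is $k_0$ with $\pi_T(k)\le S(k)$ for all $k\ge k_0$. Conventions: quantities are computed in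 $[0,\infty]$ with $1/0=\infty$ and, inside a single term, $0\cdot\infty=0$ (so $0/0=0$); a product of two maxima is $\infty$ as soon as one of the maxima is $\infty$. *)

theory Defs
  imports "HOL-Analysis.Analysis" "HOL-Library.Function_Algebras"
begin

(* The paper's index set {1,2,3,...} is replaced throughout by the order-isomorphic type nat
   (so k = 1,2,... becomes k = 0,1,...): only the order of the indices is ever used.

   The scalar field is a type 'k of sort {real_normed_field, banach}. By the Gelfand-Mazur theorem
   real and complex are, up to isometric isomorphism, the only types of this sort. *)

section \<open>Graded Frechet spaces\<close>

(* Spaces are linear subspaces gcarrier E of an ambient vector space on the type 'e; the values of
   the seminorms and of operators outside the carrier are irrelevant. *)
record ('k, 'e) graded_space =
  gcarrier :: "'e set"
  gscale :: "'k \<Rightarrow> 'e \<Rightarrow> 'e"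
  gseminorm :: "nat \<Rightarrow> 'e \<Rightarrow> real"

definition grading_topology :: "('k, 'e::ab_group_add) graded_space \<Rightarrow> 'e topology" where
  "grading_topology E = topology_generated_by
     {{y \<in> gcarrier E. gseminorm E k (y - x) < e} | x k e. x \<in> gcarrier E \<and> 0 < e}"

locale graded_frechet_space = vector_space "gscale E"
  for E :: "('k::{real_normed_field,banach}, 'e::ab_group_add) graded_space" +
  assumes subspace_gcarrier: "subspace (gcarrier E)"
    and gseminorm_nonneg: "x \<in> gcarrier E \<Longrightarrow> 0 \<le> gseminorm E k x"
    and gseminorm_scale:
      "x \<in> gcarrier E \<Longrightarrow> gseminorm E k (gscale E c x) = norm c * gseminorm E k x"
    and gseminorm_triangle:
      "x \<in> gcarrier E \<Longrightarrow> y \<in> gcarrier E \<Longrightarrow>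
         gseminorm E k (x + y) \<le> gseminorm E k x + gseminorm E k y"
    and gseminorm_increasing:
      "x \<in> gcarrier E \<Longrightarrow> gseminorm E k x \<le> gseminorm E (Suc k) x"
    and Hausdorff: "Hausdorff_space (grading_topology E)"
    and complete:
      "(\<And>n. s n \<in> gcarrier E) \<Longrightarrow>
       (\<And>k e. 0 < e \<Longrightarrow> \<exists>N. \<forall>m\<ge>N. \<forall>n\<ge>N. gseminorm E k (s m - s n) < e) \<Longrightarrow>
       \<exists>l. limitin (grading_topology E) s l sequentially"

section \<open>Operators and the tame factorization property\<close>

definition continuous_operators ::
  "('k, 'e::ab_group_add) graded_space \<Rightarrow> ('k, 'f::ab_group_add) graded_space \<Rightarrow> ('e \<Rightarrow> 'f) set" where
  "continuous_operators E F = {T.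
     T ` gcarrier E \<subseteq> gcarrier F \<and>
     (\<forall>x\<in>gcarrier E. \<forall>y\<in>gcarrier E. T (x + y) = T x + T y) \<and>
     (\<forall>c. \<forall>x\<in>gcarrier E. T (gscale E c x) = gscale F c (T x)) \<and>
     continuous_map (grading_topology E) (grading_topology F) T}"

definition operator_norm ::
  "('k, 'e) graded_space \<Rightarrow> ('k, 'f) graded_space \<Rightarrow> ('e \<Rightarrow> 'f) \<Rightarrow> nat \<Rightarrow> nat \<Rightarrow> ennreal" where
  "operator_norm E F T k r =
     (SUP x\<in>{x \<in> gcarrier E. gseminorm E r x \<le> 1}. ennreal (gseminorm F k (T x)))"

(* Values in enat, so that the infimum of the empty set is infinity. *)
definition continuity_characteristic ::
  "('k, 'e) graded_space \<Rightarrow> ('k, 'f) graded_space \<Rightarrow> ('e \<Rightarrow> 'f) \<Rightarrow> nat \<Rightarrow> enat" where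
  "continuity_characteristic E F T k = (INF r\<in>{r. operator_norm E F T k r < \<infinity>}. enat r)"

definition factorable_operators ::
  "('k, 'e::ab_group_add) graded_space \<Rightarrow> ('k, 'g::ab_group_add) graded_space \<Rightarrow>
   ('k, 'f::ab_group_add) graded_space \<Rightarrow> ('e \<Rightarrow> 'f) set" where
  "factorable_operators E G F = {T \<in> continuous_operators E F.
     \<exists>Q\<in>continuous_operators E G. \<exists>R\<in>continuous_operators G F. \<forall>x\<in>gcarrier E. T x = R (Q x)}"

definition tame_factorization ::
  "('k, 'e::ab_group_add) graded_space \<Rightarrow> ('k, 'g::ab_group_add) graded_space \<Rightarrow>
   ('k, 'f::ab_group_add) graded_space \<Rightarrow> bool" where
  "tame_factorization E G F \<longleftrightarrow>
     (\<exists>S::nat \<Rightarrow> nat. mono S \<and>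
        (\<forall>T\<in>factorable_operators E G F. \<exists>k0. \<forall>k\<ge>k0.
           continuity_characteristic E F T k \<le> enat (S k)))"

section \<open>Koethe spaces\<close>

definition koethe_matrix :: "(nat \<Rightarrow> nat \<Rightarrow> real) \<Rightarrow> bool" where
  "koethe_matrix a \<longleftrightarrow>
     (\<forall>n k. 0 \<le> a n k) \<and> (\<forall>n k. a n k \<le> a n (Suc k)) \<and> (\<forall>n. \<exists>k. 0 < a n k)"

definition koethe_l1 ::
  "(nat \<Rightarrow> nat \<Rightarrow> real) \<Rightarrow> ('k::{real_normed_field,banach}, nat \<Rightarrow> 'k) graded_space" where
  "koethe_l1 a =
     \<lparr>gcarrier = {x. \<forall>k. summable (\<lambda>j. norm (x j) * a j k)},
      gscale = (\<lambda>c x j. c * x j),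
      gseminorm = (\<lambda>k x. \<Sum>j. norm (x j) * a j k)\<rparr>"

definition koethe_linf ::
  "(nat \<Rightarrow> nat \<Rightarrow> real) \<Rightarrow> ('k::{real_normed_field,banach}, nat \<Rightarrow> 'k) graded_space" where
  "koethe_linf a =
     \<lparr>gcarrier = {x. \<forall>k. bdd_above (range (\<lambda>j. norm (x j) * a j k))},
      gscale = (\<lambda>c x j. c * x j),
      gseminorm = (\<lambda>k x. SUP j. norm (x j) * a j k)\<rparr>"

definition koethe_c0 ::
  "(nat \<Rightarrow> nat \<Rightarrow> real) \<Rightarrow> ('k::{real_normed_field,banach}, nat \<Rightarrow> 'k) graded_space" where
  "koethe_c0 a = koethe_linf a
     \<lparr>gcarrier := {x \<in> gcarrier (koethe_linf a). \<forall>k. (\<lambda>j. x j * of_real (a j k)) \<longlonglongrightarrow> 0}\<rparr>"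

section \<open>Arithmetic in the extended half-line\<close>

(* Division on ennreal already satisfies 1 / 0 = \<infinity> and 0 / 0 = 0. Its multiplication has
   0 * \<infinity> = 0, whereas the product of two maxima has to be \<infinity> as soon as one factor is. *)
definition max_product :: "ennreal \<Rightarrow> ennreal \<Rightarrow> ennreal" where
  "max_product u v = (if u = \<infinity> \<or> v = \<infinity> then \<infinity> else u * v)"

end

theory Submission
  imports Defs
begin

text \<open>
  From the estimate to tameness: let \<open>T = R Q\<close>, and let \<open>z\<^sub>j\<close> be the image of the \<open>j\<close>-th
  unit vector under \<open>R\<close>. Then \<open>\<parallel>T x\<parallel>\<^sub>k \<le> \<Sum>\<^sub>j \<bar>(Q x)\<^sub>j\<bar> \<parallel>z\<^sub>j\<parallel>\<^sub>k\<close>, and the estimate says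
  that the ratio of \<open>\<parallel>z\<^sub>j\<parallel>\<^sub>k\<close> and the \<open>i\<close>-th weight at level \<open>S(k)\<close> is, up to a constant, at most the
  maximum over finitely many \<open>q\<close> of the ratios of the weights for which \<open>Q\<close> is bounded. For domains graded by weighted suprema the matrix of
  \<open>Q\<close> need not be absolutely summable, so one has to interpolate the bounds on \<open>Q\<close>. In logarithmic
  coordinates, rounded to integers, every pair \<open>(i, j)\<close> has \<open>d\<^sub>q = p\<^sub>q(i) - n\<^sub>q(j) \<ge> 0\<close> for some
  \<open>q\<close>. By inclusion-exclusion it suffices to treat the parts of the matrix where \<open>d\<^sub>q \<ge> 0\<close> for all
  \<open>q \<in> A\<close>. Those split into pieces with prescribed values \<open>d\<^sub>q = c\<^sub>q\<close>; each piece is block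
  diagonal, so that cutting it out does not increase the norm, and gains a factor \<open>2\<close> to the
  power \<open>- max\<^sub>q c\<^sub>q\<close>, which is summable over all \<open>c\<close>.

  From tameness to the estimate: if the estimate fails for infinitely many \<open>k\<close>, it provides rank one
  operators \<open>Q\<^sub>n\<close> and \<open>R\<^sub>n\<close>, rapidly decreasing for the grading \<open>\<phi>\<close>, whose products
  \<open>R\<^sub>n Q\<^sub>n\<close> are large at the bad levels \<open>k\<close>. By a Baire category argument on the 0/1-sequences
  \<open>s, t\<close> some operator \<open>(\<Sum>\<^sub>n t\<^sub>n R\<^sub>n) (\<Sum>\<^sub>n s\<^sub>n Q\<^sub>n)\<close> is unbounded at all bad levels.
\<close>

section \<open>Continuity and tameness in graded seminormed spaces\<close>

text \<open>The Frechet axioms except separation and completeness: continuity and norm estimates can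
  then be treated uniformly for spaces whose completeness is proved only later, or, as for
  \<open>koethe_c0\<close>, not at all.\<close>

locale graded_seminormed_space = vector_space "gscale E"
  for E :: "('k::{real_normed_field,banach}, 'e::ab_group_add) graded_space" +
  assumes subspace_gcarrier: "subspace (gcarrier E)"
    and gseminorm_nonneg: "x \<in> gcarrier E \<Longrightarrow> 0 \<le> gseminorm E k x"
    and gseminorm_scale:
      "x \<in> gcarrier E \<Longrightarrow> gseminorm E k (gscale E c x) = norm c * gseminorm E k x"
    and gseminorm_triangle:
      "x \<in> gcarrier E \<Longrightarrow> y \<in> gcarrier E \<Longrightarrow>
         gseminorm E k (x + y) \<le> gseminorm E k x + gseminorm E k y"
    and gseminorm_increasing:
      "x \<in> gcarrier E \<Longrightarrow> gseminorm E k x \<le> gseminorm E (Suc k) x"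
begin

lemmas gcarrier_closed =
  subspace_0[OF subspace_gcarrier] subspace_add[OF subspace_gcarrier]
  subspace_diff[OF subspace_gcarrier] subspace_neg[OF subspace_gcarrier]
  subspace_scale[OF subspace_gcarrier] subspace_sum[OF subspace_gcarrier]

lemma gseminorm_zero: "gseminorm E k 0 = 0"
  using gseminorm_scale[of 0 k 0] gcarrier_closed(1) by simp

lemma gseminorm_minus: "x \<in> gcarrier E \<Longrightarrow> gseminorm E k (- x) = gseminorm E k x"
  using gseminorm_scale[of x k "-1"] by (simp add: scale_minus_left)

lemma gseminorm_minus_commute:
  "x \<in> gcarrier E \<Longrightarrow> y \<in> gcarrier E \<Longrightarrow> gseminorm E k (x - y) = gseminorm E k (y - x)"
  using gseminorm_minus[of "x - y" k] gcarrier_closed by simp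

lemma gseminorm_diff_triangle:
  "x \<in> gcarrier E \<Longrightarrow> y \<in> gcarrier E \<Longrightarrow>
     gseminorm E k (x - y) \<le> gseminorm E k x + gseminorm E k y"
  using gseminorm_triangle[of x "- y" k] gseminorm_minus[of y k] gcarrier_closed by simp

lemma gseminorm_le_add_diff:
  assumes "x \<in> gcarrier E" "y \<in> gcarrier E"
  shows "gseminorm E k x \<le> gseminorm E k y + gseminorm E k (x - y)"
  using gseminorm_triangle[OF assms(2) gcarrier_closed(3)[OF assms], of k] by simp

lemma gseminorm_mono: "x \<in> gcarrier E \<Longrightarrow> k \<le> l \<Longrightarrow> gseminorm E k x \<le> gseminorm E l x"
  using lift_Suc_mono_le[of "\<lambda>k. gseminorm E k x"] gseminorm_increasing by blast

lemma gseminorm_sum: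
  "(\<And>i. i \<in> I \<Longrightarrow> f i \<in> gcarrier E) \<Longrightarrow>
     gseminorm E k (\<Sum>i\<in>I. f i) \<le> (\<Sum>i\<in>I. gseminorm E k (f i))"
proof (induction I rule: infinite_finite_induct)
  case (insert i I)
  then show ?case
    using gseminorm_triangle[of "f i" "\<Sum>i\<in>I. f i" k] gcarrier_closed(6)[of I f] by auto
qed (auto simp: gseminorm_zero)

text \<open>By definition the balls are only a subbasis. Since the seminorms increase, balls at
  levels \<open>k\<close> and \<open>l\<close> around a point contain a ball at level
  \<open>max k l\<close>, so the balls around a point form a neighbourhood base.\<close>

lemma openin_grading_topology:
  "openin (grading_topology E) U \<longleftrightarrow> U \<subseteq> gcarrier E \<and>
     (\<forall>x\<in>U. \<exists>k e. 0 < e \<and> {y \<in> gcarrier E. gseminorm E k (y - x) < e} \<subseteq> U)"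
  (is "?L \<longleftrightarrow> ?R U")
proof
  let ?S = "{{y \<in> gcarrier E. gseminorm E k (y - x) < e} | x k e. x \<in> gcarrier E \<and> 0 < e}"
  assume ?L
  then have "generate_topology_on ?S U"
    by (simp add: grading_topology_def openin_topology_generated_by_iff)
  then show "?R U"
  proof induction
    case Empty
    then show ?case by simp
  next
    case (Int U V)
    show ?case
    proof (intro conjI ballI)
      show "U \<inter> V \<subseteq> gcarrier E" using Int by blast
      fix x assume x: "x \<in> U \<inter> V"
      then obtain k e l d where *: "0 < e" "{y \<in> gcarrier E. gseminorm E k (y - x) < e} \<subseteq> U"
          "0 < d" "{y \<in> gcarrier E. gseminorm E l (y - x) < d} \<subseteq> V"
        using Int.IH by blast
      have "{y \<in> gcarrier E. gseminorm E (max k l) (y - x) < min e d} \<subseteq> U \<inter> V"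
      proof
        fix y assume y: "y \<in> {y \<in> gcarrier E. gseminorm E (max k l) (y - x) < min e d}"
        then have "y - x \<in> gcarrier E" using x Int gcarrier_closed by blast
        then have "gseminorm E k (y - x) < e" "gseminorm E l (y - x) < d"
          using y gseminorm_mono[of "y - x" k "max k l"] gseminorm_mono[of "y - x" l "max k l"]
          by auto
        then show "y \<in> U \<inter> V" using * y by blast
      qed
      then show "\<exists>k e. 0 < e \<and> {y \<in> gcarrier E. gseminorm E k (y - x) < e} \<subseteq> U \<inter> V"
        using * by (intro exI[of _ "max k l"] exI[of _ "min e d"]) simp
    qed
  next
    case (UN K)
    show ?case
    proof (intro conjI ballI)
      show "\<Union> K \<subseteq> gcarrier E" using UN by blast
      fix x assume "x \<in> \<Union> K"
      then obtain V where "V \<in> K" "x \<in> V" by blast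
      then show "\<exists>k e. 0 < e \<and> {y \<in> gcarrier E. gseminorm E k (y - x) < e} \<subseteq> \<Union> K"
        using UN.IH[of V] by blast
    qed
  next
    case (Basis V)
    then obtain x k e where V: "V = {y \<in> gcarrier E. gseminorm E k (y - x) < e}"
      and x: "x \<in> gcarrier E" and "0 < e" by blast
    show ?case
    proof (intro conjI ballI)
      show "V \<subseteq> gcarrier E" using V by blast
      fix u assume u: "u \<in> V"
      have "{y \<in> gcarrier E. gseminorm E k (y - u) < e - gseminorm E k (u - x)} \<subseteq> V"
      proof
        fix y assume y: "y \<in> {y \<in> gcarrier E. gseminorm E k (y - u) < e - gseminorm E k (u - x)}"
        have "gseminorm E k (y - x) \<le> gseminorm E k (y - u) + gseminorm E k (u - x)"
          using gseminorm_triangle[of "y - u" "u - x" k] x u y V gcarrier_closed by simp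
        then show "y \<in> V" using y V by auto
      qed
      then show "\<exists>k e. 0 < e \<and> {y \<in> gcarrier E. gseminorm E k (y - u) < e} \<subseteq> V"
        using u V by (intro exI[of _ k] exI[of _ "e - gseminorm E k (u - x)"]) simp
    qed
  qed
next
  assume R: "?R U"
  have "\<exists>V. openin (grading_topology E) V \<and> x \<in> V \<and> V \<subseteq> U" if x: "x \<in> U" for x
  proof -
    obtain k e where e: "0 < e" "{y \<in> gcarrier E. gseminorm E k (y - x) < e} \<subseteq> U"
      using R x by blast
    have "openin (grading_topology E) {y \<in> gcarrier E. gseminorm E k (y - x) < e}"
      unfolding grading_topology_def using e(1) x R
      by (intro topology_generated_by_Basis) blast
    moreover have "x \<in> {y \<in> gcarrier E. gseminorm E k (y - x) < e}"
      using x R e by (auto simp: gseminorm_zero)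
    ultimately show ?thesis using e by blast
  qed
  then show ?L using openin_subopen by blast
qed

lemma topspace_grading_topology: "topspace (grading_topology E) = gcarrier E"
proof -
  have "openin (grading_topology E) (gcarrier E)"
    unfolding openin_grading_topology by (auto intro: exI[of _ 1])
  then have "gcarrier E \<subseteq> topspace (grading_topology E)" by (rule openin_subset)
  moreover have "topspace (grading_topology E) \<subseteq> gcarrier E"
    using openin_topspace[of "grading_topology E"] by (simp only: openin_grading_topology)
  ultimately show ?thesis by blast
qed

lemma openin_gball:
  assumes "x \<in> gcarrier E" "0 < e"
  shows "openin (grading_topology E) {y \<in> gcarrier E. gseminorm E k (y - x) < e}"
  unfolding grading_topology_def using assms by (intro topology_generated_by_Basis) blast

lemma limitin_grading_topology:
  assumes s: "\<And>n. s n \<in> gcarrier E"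
  shows "limitin (grading_topology E) s l sequentially \<longleftrightarrow>
    l \<in> gcarrier E \<and> (\<forall>k. (\<lambda>n. gseminorm E k (s n - l)) \<longlonglongrightarrow> 0)"
  (is "?L \<longleftrightarrow> ?R")
proof
  assume L: ?L
  then have l: "l \<in> gcarrier E" by (simp add: limitin_def topspace_grading_topology)
  have "(\<lambda>n. gseminorm E k (s n - l)) \<longlonglongrightarrow> 0" for k
  proof (rule LIMSEQ_I)
    fix e :: real assume e: "0 < e"
    have "\<forall>\<^sub>F n in sequentially. s n \<in> {y \<in> gcarrier E. gseminorm E k (y - l) < e}"
    proof (rule L[unfolded limitin_def, THEN conjunct2, rule_format], intro conjI)
      show "l \<in> {y \<in> gcarrier E. gseminorm E k (y - l) < e}"
        using l e gseminorm_zero by simp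
    qed (rule openin_gball[OF l e])
    then show "\<exists>N. \<forall>n\<ge>N. norm (gseminorm E k (s n - l) - 0) < e"
      using gseminorm_nonneg[of "s _ - l" k] s l gcarrier_closed
      by (auto simp: eventually_sequentially)
  qed
  then show ?R using l by blast
next
  assume R: ?R
  show ?L unfolding limitin_def topspace_grading_topology
  proof (intro conjI allI impI)
    show "l \<in> gcarrier E" using R by blast
    fix U assume "openin (grading_topology E) U \<and> l \<in> U"
    then obtain k e where ke: "0 < e" "{y \<in> gcarrier E. gseminorm E k (y - l) < e} \<subseteq> U"
      unfolding openin_grading_topology by blast
    have "(\<lambda>n. gseminorm E k (s n - l)) \<longlonglongrightarrow> 0" using R by blast
    then have "\<forall>\<^sub>F n in sequentially. gseminorm E k (s n - l) < e"
      using ke order_tendstoD(2) by blast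
    then show "\<forall>\<^sub>F n in sequentially. s n \<in> U"
      by eventually_elim (use ke s in blast)
  qed
qed

end

text \<open>Homogeneity: \<open>x\<close> is scaled into the ball of radius \<open>e\<close>. Adding
  \<open>d > 0\<close> to its seminorm covers the case that this seminorm vanishes; at the end
  \<open>d\<close> becomes arbitrarily small.\<close>

lemma bound_from_ball:
  assumes "graded_seminormed_space E" "graded_seminormed_space F"
    and maps: "T ` gcarrier E \<subseteq> gcarrier F"
    and hom: "\<And>c x. x \<in> gcarrier E \<Longrightarrow> T (gscale E c x) = gscale F c (T x)"
    and e: "0 < e"
    and M: "\<And>x. x \<in> gcarrier E \<Longrightarrow> gseminorm E r x < e \<Longrightarrow> gseminorm F k (T x) \<le> M"
    and x: "x \<in> gcarrier E"
  shows "gseminorm F k (T x) \<le> M / e * gseminorm E r x"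
proof -
  interpret E: graded_seminormed_space E by fact
  interpret F: graded_seminormed_space F by fact
  have M0: "0 \<le> M"
    using M[of 0] e F.gseminorm_nonneg[of "T 0" k] maps E.gcarrier_closed(1) E.gseminorm_zero[of r]
    by (simp add: image_subset_iff)
  have Tx: "T x \<in> gcarrier F" using maps x by blast
  have main: "gseminorm F k (T x) \<le> M / e * (gseminorm E r x + d)" if d: "0 < d" for d
  proof -
    let ?c = "e / (gseminorm E r x + d)"
    have nn: "0 \<le> gseminorm E r x" using E.gseminorm_nonneg x by blast
    then have c: "0 < ?c" using d e by simp
    have "gseminorm E r (gscale E (of_real ?c) x) = ?c * gseminorm E r x"
      using E.gseminorm_scale[OF x] c by (simp del: of_real_divide abs_divide)
    also have "\<dots> < e" using nn d e by (simp add: field_simps)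
    finally have "gseminorm F k (T (gscale E (of_real ?c) x)) \<le> M"
      by (rule M[OF E.gcarrier_closed(5)[OF x]])
    moreover have "gseminorm F k (T (gscale E (of_real ?c) x)) = ?c * gseminorm F k (T x)"
      using F.gseminorm_scale[OF Tx, of k "of_real ?c"] c hom[OF x, of "of_real ?c"]
      by (simp del: of_real_divide abs_divide)
    ultimately have "gseminorm F k (T x) * ?c \<le> M" by (simp add: mult.commute)
    then have "gseminorm F k (T x) \<le> M / ?c" using c by (simp only: pos_le_divide_eq)
    then show ?thesis by simp
  qed
  show ?thesis
  proof (rule field_le_epsilon)
    fix d :: real assume d: "0 < d"
    \<comment> \<open>The increment is chosen so that its product with \<open>M / e\<close> is at
      most \<open>d\<close>, also when \<open>M = 0\<close>.\<close>
    have "gseminorm F k (T x) \<le> M / e * (gseminorm E r x + d / (M / e + 1))"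
      using M0 e d by (intro main) (auto intro!: divide_pos_pos add_nonneg_pos)
    also have "\<dots> = M / e * gseminorm E r x + (M / e) / (M / e + 1) * d"
      by (simp only: distrib_left times_divide_eq_left times_divide_eq_right)
    also have "\<dots> \<le> M / e * gseminorm E r x + 1 * d"
      using divide_nonneg_pos[OF M0 e] d
      by (intro add_left_mono mult_right_mono) (auto simp only: divide_le_eq_1)
    finally show "gseminorm F k (T x) \<le> M / e * gseminorm E r x + d" by simp
  qed
qed

lemma additive_on_diff:
  assumes "graded_seminormed_space E" 
    and add: "\<And>x y. x \<in> gcarrier E \<Longrightarrow> y \<in> gcarrier E \<Longrightarrow> T (x + y) = T x + (T y :: 'f :: ab_group_add)"
    and x: "x \<in> gcarrier E" "y \<in> gcarrier E"
  shows "T (x - y) = T x - T y"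
proof -
  interpret E: graded_seminormed_space E by fact
  have "T (x - y + y) = T (x - y) + T y" using x E.gcarrier_closed by (intro add) auto
  then show ?thesis by simp
qed

text \<open>Continuity at 0 gives a ball that is mapped into a unit ball, which homogeneity turns
  into a bound; conversely additivity carries a bound on differences to every point.\<close>

lemma continuous_operators_iff:
  assumes "graded_seminormed_space E" "graded_seminormed_space F"
  shows "T \<in> continuous_operators E F \<longleftrightarrow>
     T ` gcarrier E \<subseteq> gcarrier F \<and>
     (\<forall>x\<in>gcarrier E. \<forall>y\<in>gcarrier E. T (x + y) = T x + T y) \<and>
     (\<forall>c. \<forall>x\<in>gcarrier E. T (gscale E c x) = gscale F c (T x)) \<and>
     (\<forall>k. \<exists>r C. \<forall>x\<in>gcarrier E. gseminorm F k (T x) \<le> C * gseminorm E r x)"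
proof -
  interpret E: graded_seminormed_space E by fact
  interpret F: graded_seminormed_space F by fact
  have "continuous_map (grading_topology E) (grading_topology F) T \<longleftrightarrow>
    (\<forall>k. \<exists>r C. \<forall>x\<in>gcarrier E. gseminorm F k (T x) \<le> C * gseminorm E r x)" (is "?L \<longleftrightarrow> ?R")
    if maps: "T ` gcarrier E \<subseteq> gcarrier F"
      and add: "\<And>x y. x\<in>gcarrier E \<Longrightarrow> y\<in>gcarrier E \<Longrightarrow> T (x + y) = T x + T y"
      and hom: "\<And>c x. x\<in>gcarrier E \<Longrightarrow> T (gscale E c x) = gscale F c (T x)"
  proof
    assume L: ?L
    have T0: "T 0 = 0" using add[of 0 0] E.gcarrier_closed(1) by simp
    show ?R
    proof
      fix k
      have "openin (grading_topology E) {x \<in> gcarrier E. T x \<in> {y \<in> gcarrier F. gseminorm F k (y - 0) < 1}}"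
        using F.openin_gball[OF F.gcarrier_closed(1) zero_less_one]
        by (rule L[unfolded continuous_map_def E.topspace_grading_topology, THEN conjunct2, rule_format])
      moreover have "0 \<in> {x \<in> gcarrier E. T x \<in> {y \<in> gcarrier F. gseminorm F k (y - 0) < 1}}"
        using T0 F.gseminorm_zero E.gcarrier_closed(1) F.gcarrier_closed(1) by simp
      ultimately obtain r e where e: "0 < e" 
        and sub: "{x \<in> gcarrier E. gseminorm E r (x - 0) < e} \<subseteq> {x \<in> gcarrier E. T x \<in> {y \<in> gcarrier F. gseminorm F k (y - 0) < 1}}"
        unfolding E.openin_grading_topology by blast
      have "gseminorm F k (T x) \<le> 1 / e * gseminorm E r x" if "x \<in> gcarrier E" for x
        using sub by (intro bound_from_ball[OF assms maps hom e _ that]) auto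
      then show "\<exists>r C. \<forall>x\<in>gcarrier E. gseminorm F k (T x) \<le> C * gseminorm E r x" by blast
    qed
  next
    assume R: ?R
    show ?L unfolding continuous_map_def E.topspace_grading_topology F.topspace_grading_topology
    proof (intro conjI allI impI)
      show "T \<in> gcarrier E \<rightarrow> gcarrier F" using maps by blast
      fix U assume U: "openin (grading_topology F) U"
      show "openin (grading_topology E) {x \<in> gcarrier E. T x \<in> U}"
        unfolding E.openin_grading_topology
      proof (intro conjI ballI)
        fix x assume x: "x \<in> {x \<in> gcarrier E. T x \<in> U}"
        then obtain k e where e: "0 < e" "{y \<in> gcarrier F. gseminorm F k (y - T x) < e} \<subseteq> U"
          using U unfolding F.openin_grading_topology by blast
        obtain r C where C: "\<And>x. x\<in>gcarrier E \<Longrightarrow> gseminorm F k (T x) \<le> C * gseminorm E r x"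
          using R by blast
        \<comment> \<open>\<open>C\<close> is an arbitrary real, possibly 0 or negative, hence the
          denominator |C| + 1.\<close>
        have "{y \<in> gcarrier E. gseminorm E r (y - x) < e / (\<bar>C\<bar> + 1)} \<subseteq> {x \<in> gcarrier E. T x \<in> U}"
        proof
          fix y assume y: "y \<in> {y \<in> gcarrier E. gseminorm E r (y - x) < e / (\<bar>C\<bar> + 1)}"
          then have yx: "y - x \<in> gcarrier E" using x E.gcarrier_closed by blast
          have "gseminorm F k (T y - T x) \<le> C * gseminorm E r (y - x)"
            using C[OF yx] additive_on_diff[OF assms(1) add, of y x] x y by simp
          also have "\<dots> \<le> (\<bar>C\<bar> + 1) * gseminorm E r (y - x)"
            using E.gseminorm_nonneg[OF yx] by (intro mult_right_mono) auto
          also have "\<dots> < e" using y by (simp add: field_simps add_pos_nonneg)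
          finally show "y \<in> {x \<in> gcarrier E. T x \<in> U}" using e y maps by auto
        qed
        then show "\<exists>r d. 0 < d \<and> {y \<in> gcarrier E. gseminorm E r (y - x) < d} \<subseteq> {x \<in> gcarrier E. T x \<in> U}"
          using e by (intro exI[of _ r] exI[of _ "e / (\<bar>C\<bar> + 1)"]) (auto intro!: divide_pos_pos)
      qed auto
    qed
  qed
  then show ?thesis unfolding continuous_operators_def by blast
qed

text \<open>A finite infimum of natural numbers is attained, so some \<open>p \<le> r\<close> has
  finite operator norm, and the increasing seminorms carry the bound from \<open>p\<close> to
  \<open>r\<close>.\<close>

lemma continuity_characteristic_le_iff:
  assumes "graded_seminormed_space E" "graded_seminormed_space F"
    and T: "T \<in> continuous_operators E F"
  shows "continuity_characteristic E F T k \<le> enat r \<longleftrightarrow>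
     (\<exists>C. \<forall>x\<in>gcarrier E. gseminorm F k (T x) \<le> C * gseminorm E r x)"
proof
  interpret E: graded_seminormed_space E by fact
  interpret F: graded_seminormed_space F by fact
  have maps: "T ` gcarrier E \<subseteq> gcarrier F"
    and hom: "\<And>c x. x\<in>gcarrier E \<Longrightarrow> T (gscale E c x) = gscale F c (T x)"
    using T unfolding continuous_operators_def by blast+
  {
    assume "continuity_characteristic E F T k \<le> enat r"
    \<comment> \<open>Strict comparison with \<open>Suc r\<close> extracts an index
      \<open>p \<le> r\<close> from the infimum, without treating the empty set separately.\<close>
    then have "(INF r\<in>{r. operator_norm E F T k r < \<infinity>}. enat r) < enat (Suc r)"
      unfolding continuity_characteristic_def by (rule order_le_less_trans) simp
    then obtain p where p: "operator_norm E F T k p < \<infinity>" "p \<le> r"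
      by (auto simp: INF_less_iff)
    then obtain M where M: "operator_norm E F T k p = ennreal M" "0 \<le> M"
      using less_top_ennreal by auto
    have bd: "gseminorm F k (T x) \<le> M" if "x \<in> gcarrier E" "gseminorm E p x < 1" for x
    proof -
      have "ennreal (gseminorm F k (T x)) \<le> operator_norm E F T k p"
        unfolding operator_norm_def using that by (intro SUP_upper) auto
      then show ?thesis using M by (simp add: ennreal_le_iff)
    qed
    have "gseminorm F k (T x) \<le> M * gseminorm E r x" if x: "x \<in> gcarrier E" for x
    proof -
      have "gseminorm F k (T x) \<le> M / 1 * gseminorm E p x"
        by (rule bound_from_ball[OF assms(1,2) maps hom _ bd x]) auto
      also have "\<dots> \<le> M * gseminorm E r x"
        using E.gseminorm_mono[OF x p(2)] M(2) by (simp add: mult_left_mono)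
      finally show ?thesis .
    qed
    then show "\<exists>C. \<forall>x\<in>gcarrier E. gseminorm F k (T x) \<le> C * gseminorm E r x" by blast
  }
  assume "\<exists>C. \<forall>x\<in>gcarrier E. gseminorm F k (T x) \<le> C * gseminorm E r x"
  then obtain C where C: "\<And>x. x\<in>gcarrier E \<Longrightarrow> gseminorm F k (T x) \<le> C * gseminorm E r x" by blast
  have "operator_norm E F T k r \<le> ennreal \<bar>C\<bar>" unfolding operator_norm_def
  proof (rule SUP_least)
    fix x assume x: "x \<in> {x \<in> gcarrier E. gseminorm E r x \<le> 1}"
    have "gseminorm F k (T x) \<le> C * gseminorm E r x" using C x by blast
    also have "\<dots> \<le> \<bar>C\<bar> * 1"
      using x E.gseminorm_nonneg[of x r] by (intro mult_mono) auto
    finally show "ennreal (gseminorm F k (T x)) \<le> ennreal \<bar>C\<bar>" by (simp add: ennreal_leI)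
  qed
  then have "operator_norm E F T k r < \<infinity>"
    by (metis ennreal_less_top infinity_ennreal_def order_le_less_trans)
  then show "continuity_characteristic E F T k \<le> enat r"
    unfolding continuity_characteristic_def by (intro INF_lower) simp
qed

section \<open>Koethe sequence spaces\<close>

definition coordinate_vector :: "nat \<Rightarrow> 'k \<Rightarrow> nat \<Rightarrow> 'k::zero" where
  "coordinate_vector i c = (\<lambda>j. if j = i then c else 0)"

definition truncation :: "nat \<Rightarrow> (nat \<Rightarrow> 'k) \<Rightarrow> nat \<Rightarrow> 'k::zero" where
  "truncation n x = (\<lambda>j. if j < n then x j else 0)"

lemma sum_fun_apply: "(\<Sum>i\<in>I. f i) j = (\<Sum>i\<in>I. f i j)"
  for f :: "'i \<Rightarrow> 'j \<Rightarrow> 'k::comm_monoid_add"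
  by (induction I rule: infinite_finite_induct) auto

lemma sum_coordinate_vectors:
  "finite I \<Longrightarrow> (\<Sum>i\<in>I. coordinate_vector i (x i)) =
     (\<lambda>j. if j \<in> I then x j else (0::'k::comm_monoid_add))"
  unfolding coordinate_vector_def by (rule ext) (simp add: sum_fun_apply)

lemma truncation_eq_sum:
  "truncation n x = (\<Sum>j<n. coordinate_vector j (x j :: 'k::comm_monoid_add))"
  by (simp add: sum_coordinate_vectors truncation_def)

lemma vector_space_sequences:
  "vector_space (\<lambda>(c::'k::field) (x::nat \<Rightarrow> 'k) j. c * x j)"
  by unfold_locales (auto simp: fun_eq_iff algebra_simps)

text \<open>What \<open>koethe_l1\<close> and \<open>koethe_c0\<close> share. The density of
  finitely supported sequences, \<open>truncation_tendsto\<close>, fails in general for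
  \<open>koethe_linf\<close>; it is what determines an operator by its values on coordinate
  vectors.\<close>

locale koethe_sequence_space = graded_seminormed_space E
  for E :: "('k::{real_normed_field,banach}, nat \<Rightarrow> 'k) graded_space"
    and a :: "nat \<Rightarrow> nat \<Rightarrow> real" +
  assumes koethe: "koethe_matrix a"
    and gscale_eq: "gscale E = (\<lambda>c x j. c * x j)"
    and coordinate_le: "x \<in> gcarrier E \<Longrightarrow> norm (x i) * a i k \<le> gseminorm E k x"
    and coordinate_vector_in: "coordinate_vector i c \<in> gcarrier E"
    and gseminorm_coordinate_vector: "gseminorm E k (coordinate_vector i c) = norm c * a i k"
    and truncation_tendsto:
      "x \<in> gcarrier E \<Longrightarrow> (\<lambda>n. gseminorm E k (x - truncation n x)) \<longlonglongrightarrow> 0"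
begin

lemma truncation_in: "truncation n x \<in> gcarrier E"
  unfolding truncation_eq_sum by (intro gcarrier_closed(6) coordinate_vector_in)

end

lemma koethe_matrix_nonneg: "koethe_matrix a \<Longrightarrow> 0 \<le> a n k"
  by (simp add: koethe_matrix_def)

lemma koethe_matrix_mono: "koethe_matrix a \<Longrightarrow> k \<le> l \<Longrightarrow> a n k \<le> a n l"
  using lift_Suc_mono_le[of "a n"] by (auto simp: koethe_matrix_def)

lemma koethe_matrix_pos: "koethe_matrix a \<Longrightarrow> \<exists>k. 0 < a n k"
  by (simp add: koethe_matrix_def)

section \<open>Weighted l1 spaces\<close>

lemma summable_koethe_l1:
  "x \<in> gcarrier (koethe_l1 a) \<Longrightarrow> summable (\<lambda>j. norm (x j) * a j k)"
  by (simp add: koethe_l1_def)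

lemma gseminorm_koethe_l1: "gseminorm (koethe_l1 a) k x = (\<Sum>j. norm (x j) * a j k)"
  by (simp add: koethe_l1_def)

lemma gscale_koethe_l1: "gscale (koethe_l1 a) = (\<lambda>c x j. c * x j)"
  by (simp add: koethe_l1_def)

lemma graded_seminormed_space_koethe_l1:
  assumes "koethe_matrix a"
  shows "graded_seminormed_space
    (koethe_l1 a :: ('k::{real_normed_field,banach}, nat \<Rightarrow> 'k) graded_space)"
proof (intro graded_seminormed_space.intro graded_seminormed_space_axioms.intro)
  let ?E = "koethe_l1 a :: ('k, nat \<Rightarrow> 'k) graded_space"
  note a0 = koethe_matrix_nonneg[OF assms]
  show "vector_space (gscale ?E)"
    unfolding gscale_koethe_l1 by (rule vector_space_sequences)
  then interpret vector_space "gscale ?E" .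
  have add: "summable (\<lambda>j. norm (x j + y j) * a j k)"
    if "x \<in> gcarrier ?E" "y \<in> gcarrier ?E" for x y k
  proof (rule summable_comparison_test)
    show "\<exists>N. \<forall>n\<ge>N. norm (norm (x n + y n) * a n k) \<le> norm (x n) * a n k + norm (y n) * a n k"
      using a0 by (auto simp: abs_mult distrib_right[symmetric] norm_triangle_ineq mult_right_mono)
    show "summable (\<lambda>n. norm (x n) * a n k + norm (y n) * a n k)"
      using that by (intro summable_add summable_koethe_l1)
  qed
  show "subspace (gcarrier ?E)"
    unfolding subspace_def using add summable_koethe_l1
    by (auto simp: koethe_l1_def norm_mult mult.assoc intro: summable_mult)
  fix x k
  assume x: "x \<in> gcarrier ?E"
  show "0 \<le> gseminorm ?E k x"
    unfolding gseminorm_koethe_l1 using x a0 by (intro suminf_nonneg summable_koethe_l1) auto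
  show "gseminorm ?E k (gscale ?E c x) = norm c * gseminorm ?E k x" for c
    unfolding gseminorm_koethe_l1 gscale_koethe_l1 norm_mult mult.assoc
    using x by (intro suminf_mult summable_koethe_l1)
  show "gseminorm ?E k x \<le> gseminorm ?E (Suc k) x"
    unfolding gseminorm_koethe_l1 using x koethe_matrix_mono[OF assms, of k "Suc k"]
    by (intro suminf_le summable_koethe_l1 mult_left_mono) auto
  fix y
  assume y: "y \<in> gcarrier ?E"
  have "(\<lambda>j. x j + y j) \<in> gcarrier ?E" using add[OF x y] by (simp add: koethe_l1_def)
  then have "gseminorm ?E k (x + y) \<le> (\<Sum>j. norm (x j) * a j k + norm (y j) * a j k)"
    unfolding gseminorm_koethe_l1 using x y a0
    by (intro suminf_le summable_add summable_koethe_l1)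
      (auto simp: distrib_right[symmetric] norm_triangle_ineq mult_right_mono)
  then show "gseminorm ?E k (x + y) \<le> gseminorm ?E k x + gseminorm ?E k y"
    unfolding gseminorm_koethe_l1 using x y by (simp add: suminf_add summable_koethe_l1)
qed

lemma sum_le_gseminorm_koethe_l1:
  assumes "koethe_matrix a" "x \<in> gcarrier (koethe_l1 a)" "finite J"
  shows "(\<Sum>j\<in>J. norm (x j) * a j k) \<le> gseminorm (koethe_l1 a) k x"
  unfolding gseminorm_koethe_l1 using assms koethe_matrix_nonneg[OF assms(1)]
  by (intro sum_le_suminf summable_koethe_l1) auto

lemma koethe_sequence_space_l1:
  assumes "koethe_matrix a"
  shows "koethe_sequence_space
    (koethe_l1 a :: ('k::{real_normed_field,banach}, nat \<Rightarrow> 'k) graded_space) a"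
proof (intro koethe_sequence_space.intro koethe_sequence_space_axioms.intro)
  let ?E = "koethe_l1 a :: ('k, nat \<Rightarrow> 'k) graded_space"
  show "graded_seminormed_space ?E" by (rule graded_seminormed_space_koethe_l1[OF assms])
  show "koethe_matrix a" by fact
  show "gscale ?E = (\<lambda>c x j. c * x j)" by (rule gscale_koethe_l1)
  fix x k
  have single: "norm (coordinate_vector i c j) * a j k = (if j = i then norm c * a i k else 0)"
    for i j k and c :: 'k
    by (simp add: coordinate_vector_def)
  show "coordinate_vector i c \<in> gcarrier ?E" for i c
    using sums_summable[OF sums_single[of i "\<lambda>i. norm c * a i _"]]
    by (simp add: koethe_l1_def single cong: if_cong)
  show "gseminorm ?E k (coordinate_vector i c) = norm c * a i k" for i c
    using sums_unique[OF sums_single[of i "\<lambda>j. norm c * a i k"]]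
    by (simp add: gseminorm_koethe_l1 single cong: if_cong)
  assume x: "x \<in> gcarrier ?E"
  show "norm (x i) * a i k \<le> gseminorm ?E k x" for i
    using sum_le_gseminorm_koethe_l1[OF assms x, of "{i}"] by simp
  have "gseminorm ?E k (x - truncation n x) =
      gseminorm ?E k x - (\<Sum>j<n. norm (x j) * a j k)" for n
  proof -
    have "(\<lambda>j. norm (x j) * a j k) sums gseminorm ?E k x"
      unfolding gseminorm_koethe_l1 using x by (intro summable_sums summable_koethe_l1)
    moreover have "(\<lambda>j. if j \<in> {..<n} then norm (x j) * a j k else 0) sums (\<Sum>j<n. norm (x j) * a j k)"
      by (rule sums_If_finite_set) simp
    ultimately have "(\<lambda>j. norm (x j) * a j k - (if j \<in> {..<n} then norm (x j) * a j k else 0)) sums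
        (gseminorm ?E k x - (\<Sum>j<n. norm (x j) * a j k))"
      by (rule sums_diff)
    also have "(\<lambda>j. norm (x j) * a j k - (if j \<in> {..<n} then norm (x j) * a j k else 0)) =
        (\<lambda>j. norm ((x - truncation n x) j) * a j k)"
      by (auto simp: truncation_def)
    finally show ?thesis unfolding gseminorm_koethe_l1 by (rule sums_unique[symmetric])
  qed
  moreover have "(\<lambda>n. gseminorm ?E k x - (\<Sum>j<n. norm (x j) * a j k)) \<longlonglongrightarrow>
      gseminorm ?E k x - gseminorm ?E k x"
    using summable_LIMSEQ[OF summable_koethe_l1[OF x, of k]]
    by (intro tendsto_diff) (auto simp: gseminorm_koethe_l1)
  ultimately show "(\<lambda>n. gseminorm ?E k (x - truncation n x)) \<longlonglongrightarrow> 0" by simp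
qed

section \<open>Weighted c0 spaces\<close>

lemma gcarrier_koethe_c0:
  fixes a :: "nat \<Rightarrow> nat \<Rightarrow> real"
  assumes "koethe_matrix a"
  shows "gcarrier (koethe_c0 a :: ('k::{real_normed_field,banach}, nat \<Rightarrow> 'k) graded_space) =
    {x. \<forall>k. (\<lambda>j. norm (x j) * a j k) \<longlonglongrightarrow> 0}"
proof -
  have lim: "(\<lambda>j. x j * of_real (a j k)) \<longlonglongrightarrow> 0 \<longleftrightarrow> (\<lambda>j. norm (x j) * a j k) \<longlonglongrightarrow> 0"
    for x :: "nat \<Rightarrow> 'k" and k
    using tendsto_norm_zero_iff[of "\<lambda>j. x j * of_real (a j k)" sequentially]
      koethe_matrix_nonneg[OF assms] by (simp add: norm_mult)
  have "bdd_above (range (\<lambda>j. norm (x j) * a j k))"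
    if "(\<lambda>j. norm (x j) * a j k) \<longlonglongrightarrow> 0" for x :: "nat \<Rightarrow> 'k" and k
    using convergent_imp_bounded[OF that] by (rule bounded_imp_bdd_above)
  then show ?thesis by (auto simp: koethe_c0_def koethe_linf_def lim)
qed

lemma bdd_above_koethe_c0:
  "x \<in> gcarrier (koethe_c0 a) \<Longrightarrow> bdd_above (range (\<lambda>j. norm (x j) * a j k))"
  by (simp add: koethe_c0_def koethe_linf_def)

lemma gseminorm_koethe_c0: "gseminorm (koethe_c0 a) k x = (SUP j. norm (x j) * a j k)"
  by (simp add: koethe_c0_def koethe_linf_def)

lemma gscale_koethe_c0: "gscale (koethe_c0 a) = (\<lambda>c x j. c * x j)"
  by (simp add: koethe_c0_def koethe_linf_def)

lemma coordinate_le_koethe_c0: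
  "x \<in> gcarrier (koethe_c0 a) \<Longrightarrow> norm (x j) * a j k \<le> gseminorm (koethe_c0 a) k x"
  unfolding gseminorm_koethe_c0 by (intro cSUP_upper bdd_above_koethe_c0) auto

lemma gseminorm_koethe_c0_le:
  "(\<And>j. norm (x j) * a j k \<le> M) \<Longrightarrow> gseminorm (koethe_c0 a) k x \<le> M"
  unfolding gseminorm_koethe_c0 by (intro cSUP_least) auto

lemma graded_seminormed_space_koethe_c0:
  assumes "koethe_matrix a"
  shows "graded_seminormed_space
    (koethe_c0 a :: ('k::{real_normed_field,banach}, nat \<Rightarrow> 'k) graded_space)"
proof (intro graded_seminormed_space.intro graded_seminormed_space_axioms.intro)
  let ?E = "koethe_c0 a :: ('k, nat \<Rightarrow> 'k) graded_space"
  note a0 = koethe_matrix_nonneg[OF assms]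
  show "vector_space (gscale ?E)"
    unfolding gscale_koethe_c0 by (rule vector_space_sequences)
  then interpret vector_space "gscale ?E" .
  have lim: "(\<lambda>j. norm (x j) * a j k) \<longlonglongrightarrow> 0" if "x \<in> gcarrier ?E" for x k
    using that by (simp add: gcarrier_koethe_c0[OF assms])
  have add_le: "norm (x j + y j) * a j k \<le> norm (x j) * a j k + norm (y j) * a j k"
    for x y :: "nat \<Rightarrow> 'k" and j k
    using a0 by (simp add: distrib_right[symmetric] norm_triangle_ineq mult_right_mono)
  have add: "x + y \<in> gcarrier ?E" if "x \<in> gcarrier ?E" "y \<in> gcarrier ?E" for x y
    unfolding gcarrier_koethe_c0[OF assms]
  proof (intro CollectI allI)
    fix k
    show "(\<lambda>j. norm ((x + y) j) * a j k) \<longlonglongrightarrow> 0"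
    proof (rule tendsto_sandwich[where f = "\<lambda>_. 0"])
      show "(\<lambda>j. norm (x j) * a j k + norm (y j) * a j k) \<longlonglongrightarrow> 0"
        using tendsto_add[OF lim lim] that by fastforce
    qed (use a0 add_le in auto)
  qed
  have scale: "gscale ?E c x \<in> gcarrier ?E" if "x \<in> gcarrier ?E" for c x
    unfolding gcarrier_koethe_c0[OF assms] gscale_koethe_c0
    using tendsto_mult_left[OF lim[OF that], of "norm c"]
    by (auto simp: norm_mult mult.assoc)
  show "subspace (gcarrier ?E)"
    unfolding subspace_def using add scale by (auto simp: gcarrier_koethe_c0[OF assms])
  fix x k
  assume x: "x \<in> gcarrier ?E"
  show nonneg: "0 \<le> gseminorm ?E k x" 
    by (rule order_trans[OF _ coordinate_le_koethe_c0[OF x, of 0]]) (use a0 in simp)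
  show "gseminorm ?E k (gscale ?E c x) = norm c * gseminorm ?E k x" for c
  proof (rule antisym)
    show "gseminorm ?E k (gscale ?E c x) \<le> norm c * gseminorm ?E k x"
      using coordinate_le_koethe_c0[OF x]
      by (intro gseminorm_koethe_c0_le)
        (auto simp: gscale_koethe_c0 norm_mult mult.assoc mult_left_mono)
    show "norm c * gseminorm ?E k x \<le> gseminorm ?E k (gscale ?E c x)"
    proof (cases "c = 0")
      case True
      then show ?thesis
        by (simp add: gseminorm_koethe_c0 gscale_koethe_c0)
    next
      case False
      have "gseminorm ?E k x \<le> gseminorm ?E k (gscale ?E c x) / norm c"
      proof (rule gseminorm_koethe_c0_le)
        fix j
        show "norm (x j) * a j k \<le> gseminorm ?E k (gscale ?E c x) / norm c"
          using coordinate_le_koethe_c0[OF scale[OF x], of c j k] False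
          by (simp add: gscale_koethe_c0 norm_mult pos_le_divide_eq mult_ac)
      qed
      then show ?thesis using False by (simp add: pos_le_divide_eq mult.commute)
    qed
  qed
  show "gseminorm ?E k x \<le> gseminorm ?E (Suc k) x"
  proof (rule gseminorm_koethe_c0_le)
    fix j
    have "norm (x j) * a j k \<le> norm (x j) * a j (Suc k)"
      using koethe_matrix_mono[OF assms, of k "Suc k"] by (intro mult_left_mono) auto
    then show "norm (x j) * a j k \<le> gseminorm ?E (Suc k) x"
      using coordinate_le_koethe_c0[OF x, of j "Suc k"] by linarith
  qed
  fix y
  assume y: "y \<in> gcarrier ?E"
  show "gseminorm ?E k (x + y) \<le> gseminorm ?E k x + gseminorm ?E k y"
  proof (rule gseminorm_koethe_c0_le)
    fix j
    show "norm ((x + y) j) * a j k \<le> gseminorm ?E k x + gseminorm ?E k y"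
      using add_le[of x j y k] coordinate_le_koethe_c0[OF x, of j k] 
        coordinate_le_koethe_c0[OF y, of j k] by simp
  qed
qed

lemma koethe_sequence_space_c0:
  assumes "koethe_matrix a"
  shows "koethe_sequence_space
    (koethe_c0 a :: ('k::{real_normed_field,banach}, nat \<Rightarrow> 'k) graded_space) a"
proof (intro koethe_sequence_space.intro koethe_sequence_space_axioms.intro)
  let ?E = "koethe_c0 a :: ('k, nat \<Rightarrow> 'k) graded_space"
  show "graded_seminormed_space ?E" by (rule graded_seminormed_space_koethe_c0[OF assms])
  then interpret graded_seminormed_space ?E .
  show "koethe_matrix a" by fact
  show "gscale ?E = (\<lambda>c x j. c * x j)" by (rule gscale_koethe_c0)
  note a0 = koethe_matrix_nonneg[OF assms]
  fix x k
  show single: "coordinate_vector i c \<in> gcarrier ?E" for i c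
    unfolding gcarrier_koethe_c0[OF assms] coordinate_vector_def
    by (auto intro!: tendsto_eventually eventually_sequentiallyI[of "Suc i"])
  show "gseminorm ?E k (coordinate_vector i c) = norm c * a i k" for i c
  proof (rule antisym)
    show "gseminorm ?E k (coordinate_vector i c) \<le> norm c * a i k"
      using a0 by (intro gseminorm_koethe_c0_le) (auto simp: coordinate_vector_def)
    show "norm c * a i k \<le> gseminorm ?E k (coordinate_vector i c)"
      using coordinate_le_koethe_c0[OF single[of i c], of i k] by (simp add: coordinate_vector_def)
  qed
  assume x: "x \<in> gcarrier ?E"
  show "norm (x i) * a i k \<le> gseminorm ?E k x" for i
    by (rule coordinate_le_koethe_c0[OF x])
  show "(\<lambda>n. gseminorm ?E k (x - truncation n x)) \<longlonglongrightarrow> 0"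
  proof (rule LIMSEQ_I)
    fix e :: real assume e: "0 < e"
    have "(\<lambda>j. norm (x j) * a j k) \<longlonglongrightarrow> 0" using x by (simp add: gcarrier_koethe_c0[OF assms])
    from LIMSEQ_D[OF this, of "e/2"] e obtain N
      where N: "\<And>j. j \<ge> N \<Longrightarrow> norm (x j) * a j k < e / 2"
      using a0 by auto
    have "norm (gseminorm ?E k (x - truncation n x) - 0) < e" if "n \<ge> N" for n
    proof -
      have "truncation n x \<in> gcarrier ?E"
        unfolding truncation_eq_sum by (intro gcarrier_closed(6) single)
      then have "0 \<le> gseminorm ?E k (x - truncation n x)"
        by (intro gseminorm_nonneg gcarrier_closed(3) x)
      moreover have "gseminorm ?E k (x - truncation n x) \<le> e / 2"
        using N that e by (intro gseminorm_koethe_c0_le) (auto simp: truncation_def intro: less_imp_le)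
      ultimately show ?thesis using e by simp
    qed
    then show "\<exists>N. \<forall>n\<ge>N. norm (gseminorm ?E k (x - truncation n x) - 0) < e" by blast
  qed
qed

section \<open>Interpolation of operators from weighted suprema to weighted sums\<close>

lemma norm_le_add_diff_average:
  fixes u v :: "'a::real_normed_vector"
  shows "2 * norm u \<le> norm (u + v) + norm (u - v)"
  using norm_triangle_ineq[of "u + v" "u - v"] by (simp flip: scaleR_2)

text \<open>Jensen's inequality: \<open>u\<close> is the mean of the vectors on the right. The
  induction pairs each \<open>S\<close> with \<open>insert d S\<close>, that is, the two signs of
  \<open>v d\<close>.\<close>

lemma norm_le_sum_signs:
  fixes v :: "'c \<Rightarrow> 'a::real_normed_vector"
  assumes "finite C"
  shows "2 ^ card C * norm u \<le> (\<Sum>S\<in>Pow C. norm (u + (\<Sum>c\<in>C. if c \<in> S then v c else - v c)))"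
  using assms
proof induction
  case empty
  then show ?case by simp
next
  case (insert d C)
  let ?X = "\<lambda>S. \<Sum>c\<in>C. if c \<in> S then v c else - v c"
  have X: "(\<Sum>c\<in>insert d C. if c \<in> S then v c else - v c) = ?X S - v d"
    "(\<Sum>c\<in>insert d C. if c \<in> insert d S then v c else - v c) = ?X S + v d" if "S \<in> Pow C" for S
    using insert that by (auto intro!: sum.cong)
  have inj: "inj_on (insert d) (Pow C)" "Pow C \<inter> insert d ` Pow C = {}"
    using insert by (auto simp: inj_on_def insert_ident)
  have "2 ^ card (insert d C) * norm u = 2 * (2 ^ card C * norm u)"
    using insert by simp
  also have "\<dots> \<le> 2 * (\<Sum>S\<in>Pow C. norm (u + ?X S))"
    using insert.IH by simp
  also have "\<dots> \<le> (\<Sum>S\<in>Pow C. norm (u + ?X S + v d) + norm (u + ?X S - v d))"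
    unfolding sum_distrib_left by (intro sum_mono norm_le_add_diff_average)
  also have "\<dots> = (\<Sum>S\<in>Pow C. norm (u + (\<Sum>c\<in>insert d C. if c \<in> S then v c else - v c))) +
     (\<Sum>S\<in>Pow C. norm (u + (\<Sum>c\<in>insert d C. if c \<in> insert d S then v c else - v c)))"
    unfolding sum.distrib[symmetric] by (intro sum.cong refl) (simp only: X add_diff_eq add.assoc)
  also have "\<dots> = (\<Sum>S\<in>Pow (insert d C). norm (u + (\<Sum>c\<in>insert d C. if c \<in> S then v c else - v c)))"
    unfolding Pow_insert using inj insert
    by (subst sum.union_disjoint) (auto simp: sum.reindex)
  finally show ?case .
qed

text \<open>For each fixed sign of \<open>v d\<close> the other signs average out by the preceding
  bound; the two signs of \<open>v d\<close> together exhaust \<open>Pow C\<close>.\<close>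

lemma norm_component_le_sum_signs:
  fixes v :: "'c \<Rightarrow> 'a::real_normed_vector"
  assumes "finite C" "d \<in> C"
  shows "2 ^ card C * norm (v d) \<le> (\<Sum>S\<in>Pow C. norm (\<Sum>c\<in>C. if c \<in> S then v c else - v c))"
proof -
  define B where "B = C - {d}"
  then have B: "finite B" "d \<notin> B" and C: "C = insert d B" using assms by auto
  let ?Y = "\<lambda>S. \<Sum>c\<in>C. if c \<in> S then v c else - v c"
  let ?X = "\<lambda>S. \<Sum>c\<in>B. if c \<in> S then v c else - v c"
  have Y: "?Y S = - v d + ?X S" "?Y (insert d S) = v d + ?X S" if "S \<in> Pow B" for S
    using B that unfolding C by (auto intro!: sum.cong)
  have inj: "inj_on (insert d) (Pow B)" "Pow B \<inter> insert d ` Pow B = {}"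
    using B by (auto simp: inj_on_def insert_ident)
  have "2 ^ card C * norm (v d) = 2 ^ card B * norm (- v d) + 2 ^ card B * norm (v d)"
    using B unfolding C by simp
  also have "\<dots> \<le> (\<Sum>S\<in>Pow B. norm (- v d + ?X S)) + (\<Sum>S\<in>Pow B. norm (v d + ?X S))"
    by (intro add_mono norm_le_sum_signs B)
  also have "\<dots> = (\<Sum>S\<in>Pow B. norm (?Y S)) + (\<Sum>S\<in>Pow B. norm (?Y (insert d S)))"
    by (intro arg_cong2[of _ _ _ _ "(+)"] sum.cong refl) (simp_all only: Y)
  also have "\<dots> = (\<Sum>S\<in>Pow C. norm (?Y S))"
    unfolding C Pow_insert using inj B
    by (subst sum.union_disjoint) (auto simp: sum.reindex)
  finally show ?thesis .
qed


text \<open>Averaging over all choices of signs on the labels keeps exactly the entries whose row and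
  column have equal labels.\<close>

lemma block_diagonal_bound:
  fixes Q :: "'i \<Rightarrow> 'j \<Rightarrow> 'k::real_normed_field"
  assumes fin: "finite I" and b0: "\<And>j. j \<in> J \<Longrightarrow> 0 \<le> b j"
    and bound: "\<And>x. (\<And>i. i \<in> I \<Longrightarrow> norm (x i) * a i \<le> 1) \<Longrightarrow>
      (\<Sum>j\<in>J. b j * norm (\<Sum>i\<in>I. x i * Q i j)) \<le> K"
    and x: "\<And>i. i \<in> I \<Longrightarrow> norm (x i) * a i \<le> 1"
  shows "(\<Sum>j\<in>J. b j * norm (\<Sum>i\<in>I. if l i = m j then x i * Q i j else 0)) \<le> K"
proof -
  define C where "C = l ` I"
  have C: "finite C" using fin by (simp add: C_def)
  define v where "v j c = (\<Sum>i\<in>I. if l i = c then x i * Q i j else 0)" for j c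
  \<comment> \<open>Sign changes by label leave every \<open>norm (x i)\<close> unchanged, so each
    \<open>y S\<close> is admissible in \<open>bound\<close>; \<open>v j c\<close> collects the
    contributions of label \<open>c\<close>.\<close>
  define y where "y S i = (if l i \<in> S then x i else - x i)" for S i
  have sum_v: "(\<Sum>c\<in>C. if c \<in> S then v j c else - v j c) = (\<Sum>i\<in>I. y S i * Q i j)" for S j
  proof -
    have "(\<Sum>c\<in>C. if c \<in> S then v j c else - v j c) =
        (\<Sum>c\<in>C. \<Sum>i\<in>I. if l i = c then y S i * Q i j else 0)"
      unfolding v_def y_def by (auto simp: sum_negf[symmetric] intro!: sum.cong)
    also have "\<dots> = (\<Sum>i\<in>I. \<Sum>c\<in>C. if l i = c then y S i * Q i j else 0)"
      by (rule sum.swap)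
    also have "\<dots> = (\<Sum>i\<in>I. y S i * Q i j)"
      using C by (intro sum.cong) (auto simp: C_def)
    finally show ?thesis .
  qed
  have le: "2 ^ card C * norm (v j (m j)) \<le> (\<Sum>S\<in>Pow C. norm (\<Sum>i\<in>I. y S i * Q i j))" for j
  proof (cases "m j \<in> C")
    case True
    then show ?thesis using norm_component_le_sum_signs[OF C, of "m j" "v j"] by (simp add: sum_v)
  next
    case False
    then have "v j (m j) = 0" unfolding v_def C_def by (intro sum.neutral ballI) (metis imageI)
    then show ?thesis by (simp add: sum_nonneg)
  qed
  have "2 ^ card C * (\<Sum>j\<in>J. b j * norm (v j (m j))) = (\<Sum>j\<in>J. b j * (2 ^ card C * norm (v j (m j))))"
    by (simp add: sum_distrib_left mult_ac)
  also have "\<dots> \<le> (\<Sum>j\<in>J. b j * (\<Sum>S\<in>Pow C. norm (\<Sum>i\<in>I. y S i * Q i j)))"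
    by (intro sum_mono mult_left_mono le b0)
  also have "\<dots> = (\<Sum>S\<in>Pow C. \<Sum>j\<in>J. b j * norm (\<Sum>i\<in>I. y S i * Q i j))"
    unfolding sum_distrib_left by (rule sum.swap)
  also have "\<dots> \<le> (\<Sum>S\<in>Pow C. K)"
    by (intro sum_mono bound) (auto simp: y_def x)
  also have "\<dots> = 2 ^ card C * K" using C by (simp add: card_Pow)
  finally show ?thesis by (simp add: v_def)
qed

text \<open>On the retained entries the labels \<open>p q i - c q\<close> and \<open>n q j\<close>
  agree for all \<open>q \<in> A\<close>, so they form a block diagonal part, cut out at no cost. At
  \<open>q0\<close> the row factor 2 to the power \<open>p q0 i\<close> exceeds the column factor 2
  to the power \<open>n q0 j\<close> by exactly 2 to the power \<open>c q0\<close>: this is the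
  gain.\<close>

lemma labelled_block_bound:
  fixes Q :: "'i \<Rightarrow> 'j \<Rightarrow> 'k::real_normed_field" and p :: "'q \<Rightarrow> 'i \<Rightarrow> int" and n :: "'q \<Rightarrow> 'j \<Rightarrow> int"
  assumes fin: "finite I" "finite J" and A: "q0 \<in> A"
    and b0: "\<And>j. j \<in> J \<Longrightarrow> 0 \<le> b j" and u0: "\<And>j. j \<in> J \<Longrightarrow> 0 \<le> u j" and C: "0 < C"
    and bound: "\<And>x. (\<And>i. i \<in> I \<Longrightarrow> norm (x i) * a i \<le> 1) \<Longrightarrow>
      (\<Sum>j\<in>J. b j * norm (\<Sum>i\<in>I. x i * Q i j)) \<le> K"
    and x: "\<And>i. i \<in> I \<Longrightarrow> P i \<Longrightarrow> norm (x i) * (2 powr p q0 i * a i) \<le> C"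
    and u: "\<And>j. j \<in> J \<Longrightarrow> R j \<Longrightarrow> u j \<le> D * 2 powr n q0 j * b j"
    and D: "0 < D"
  shows "(\<Sum>j\<in>J. u j * norm (\<Sum>i\<in>I. if P i \<and> R j \<and> (\<forall>q\<in>A. p q i = n q j + int (c q))
            then x i * Q i j else 0)) \<le> C * D * K * (1/2) ^ c q0"
proof -
  \<comment> \<open>The default 0 outside \<open>A\<close> makes equality of these functions mean
    equality on \<open>A\<close>.\<close>
  define l where "l i = (\<lambda>q. if q \<in> A then p q i - int (c q) else 0)" for i
  define m where "m j = (\<lambda>q. if q \<in> A then n q j else 0)" for j
  have lm: "l i = m j \<longleftrightarrow> (\<forall>q\<in>A. p q i = n q j + int (c q))" for i j
    by (auto simp: l_def m_def fun_eq_iff)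
  \<comment> \<open>\<open>x\<close> is rescaled into the unit ball of the weight \<open>a\<close>
    and set to 0 off \<open>P\<close>, where the hypothesis on \<open>x\<close> says
    nothing.\<close>
  define y where "y i = (if P i then of_real (2 powr p q0 i / C) * x i else 0)" for i
  have y: "norm (y i) * a i \<le> 1" if "i \<in> I" for i
    using x[OF that] C by (auto simp: y_def norm_mult norm_divide field_simps)
  have "u j * norm (\<Sum>i\<in>I. if P i \<and> R j \<and> (\<forall>q\<in>A. p q i = n q j + int (c q)) then x i * Q i j else 0)
      \<le> (C * D * (1/2) ^ c q0) * (b j * norm (\<Sum>i\<in>I. if l i = m j then y i * Q i j else 0))"
    (is "u j * norm (?S j) \<le> _ * (b j * norm (?T j))")
    if j: "j \<in> J" for j
  proof (cases "R j")
    case True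
    have eq: "of_real (2 powr n q0 j) * (if P i \<and> R j \<and> (\<forall>q\<in>A. p q i = n q j + int (c q)) then x i * Q i j else 0)
        = of_real (C * (1/2) ^ c q0) * (if l i = m j then y i * Q i j else 0)" for i
    proof (cases "P i \<and> l i = m j")
      case t: True
      then have "real_of_int (p q0 i) = real_of_int (n q0 j) + real (c q0)" using A lm by auto
      then have "2 powr p q0 i = 2 powr n q0 j * 2 ^ c q0"
        by (simp add: powr_add powr_realpow)
      then have "2 powr n q0 j = C * (1/2) ^ c q0 * (2 powr p q0 i / C)"
        using C by (simp add: field_simps power_divide)
      then have "of_real (2 powr n q0 j) = (of_real (C * (1/2) ^ c q0) * of_real (2 powr p q0 i / C) :: 'k)"
        by (simp only: of_real_mult)
      then show ?thesis using t True by (simp add: y_def lm[symmetric] mult.assoc del: of_real_mult of_real_divide of_real_power)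
    qed (auto simp: lm y_def)
    have "2 powr n q0 j * norm (?S j) = norm (of_real (2 powr n q0 j) * ?S j)"
      by (simp add: norm_mult)
    also have "of_real (2 powr n q0 j) * ?S j = of_real (C * (1/2) ^ c q0) * ?T j"
      unfolding sum_distrib_left by (intro sum.cong refl eq)
    also have "norm \<dots> = C * (1/2) ^ c q0 * norm (?T j)"
      using C by (simp only: norm_mult norm_of_real) (simp add: abs_mult)
    finally have e: "2 powr n q0 j * norm (?S j) = C * (1/2) ^ c q0 * norm (?T j)" .
    have "u j * norm (?S j) \<le> D * 2 powr n q0 j * b j * norm (?S j)"
      using u[OF j True] by (intro mult_right_mono) auto
    also have "\<dots> = D * b j * (2 powr n q0 j * norm (?S j))" by simp
    finally show ?thesis unfolding e by (simp add: mult_ac)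
  next
    case False
    then show ?thesis using C D b0[OF j] by simp
  qed
  then have "(\<Sum>j\<in>J. u j * norm (?S j)) \<le>
      (C * D * (1/2) ^ c q0) * (\<Sum>j\<in>J. b j * norm (?T j))"
    unfolding sum_distrib_left by (intro sum_mono)
  also have "\<dots> \<le> (C * D * (1/2) ^ c q0) * K"
    using block_diagonal_bound[OF fin(1) b0 bound y, where l = l and m = m] C D by (intro mult_left_mono) auto
  finally show ?thesis by (simp add: mult_ac)
qed

section \<open>Decomposition of a matrix into labelled pieces\<close>

text \<open>The product over \<open>N\<close> of the factors 1 - [h q] vanishes because one
  \<open>h q\<close> holds; expanding it and isolating the empty subset gives the formula.\<close>

lemma inclusion_exclusion_indicator:
  fixes f :: "'k::comm_ring_1"
  assumes "finite N" "q \<in> N" "h q"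
  shows "f = (\<Sum>A\<in>Pow N - {{}}. (- 1) ^ Suc (card A) * (if \<forall>q\<in>A. h q then f else 0))"
proof -
  have "0 = (\<Prod>q\<in>N. 1 - of_bool (h q) :: 'k)"
    using assms by (intro prod_zero[symmetric]) auto
  also have "\<dots> = (\<Sum>A\<in>Pow N. (- 1) ^ card A * (\<Prod>q\<in>A. of_bool (h q)))"
    using assms by (subst prod_diff_conv_sum) auto
  also have "\<dots> = (\<Sum>A\<in>Pow N. (- 1) ^ card A * (if \<forall>q\<in>A. h q then 1 else 0))"
  proof (intro sum.cong refl arg_cong2[of _ _ _ _ "(*)"])
    fix A assume "A \<in> Pow N"
    then have "finite A" using assms finite_subset by auto
    then show "(\<Prod>q\<in>A. of_bool (h q)) = (if \<forall>q\<in>A. h q then 1 else 0 :: 'k)"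
      by (cases "\<forall>q\<in>A. h q") (auto intro!: prod_zero)
  qed
  also have "\<dots> = 1 + (\<Sum>A\<in>Pow N - {{}}. (- 1) ^ card A * (if \<forall>q\<in>A. h q then 1 else 0))"
    using assms by (subst sum.remove[of _ "{}"]) auto
  finally have "(1 :: 'k) = - (\<Sum>A\<in>Pow N - {{}}. (- 1) ^ card A * (if \<forall>q\<in>A. h q then 1 else 0))"
    by (rule eq_neg_iff_add_eq_0[THEN iffD2, OF sym])
  then have "f * 1 = f * (- (\<Sum>A\<in>Pow N - {{}}. (- 1) ^ card A * (if \<forall>q\<in>A. h q then 1 else 0)))"
    by (rule arg_cong)
  also have "\<dots> = (\<Sum>A\<in>Pow N - {{}}. (- 1) ^ Suc (card A) * (if \<forall>q\<in>A. h q then f else 0))"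
    unfolding sum_negf[symmetric] sum_distrib_left
    by (intro sum.cong refl) (simp add: mult.commute)
  finally show ?thesis by simp
qed

text \<open>Triangle inequality for a decomposition with unimodular coefficients, which are 1 for
  the labelled pieces and a sign for inclusion-exclusion. Columns with \<open>u j = 0\<close> are
  exempt from \<open>eq\<close>, as domination is known only where \<open>u j\<close> is
  positive.\<close>

lemma weighted_sum_norm_le_of_decomposition:
  fixes X :: "'s \<Rightarrow> 'i \<Rightarrow> 'j \<Rightarrow> 'k::real_normed_field"
  assumes u0: "\<And>j. j \<in> J \<Longrightarrow> 0 \<le> u j"
    and eq: "\<And>i j. i \<in> I \<Longrightarrow> j \<in> J \<Longrightarrow> u j \<noteq> 0 \<Longrightarrow> f i j = (\<Sum>s\<in>S. e s * X s i j)"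
    and e: "\<And>s. s \<in> S \<Longrightarrow> norm (e s) = 1"
    and b: "\<And>s. s \<in> S \<Longrightarrow> (\<Sum>j\<in>J. u j * norm (\<Sum>i\<in>I. X s i j)) \<le> B s"
  shows "(\<Sum>j\<in>J. u j * norm (\<Sum>i\<in>I. f i j)) \<le> (\<Sum>s\<in>S. B s)"
proof -
  have "u j * norm (\<Sum>i\<in>I. f i j) \<le> (\<Sum>s\<in>S. u j * norm (\<Sum>i\<in>I. X s i j))" if j: "j \<in> J" for j
  proof (cases "u j = 0")
    case False
    have "(\<Sum>i\<in>I. f i j) = (\<Sum>i\<in>I. \<Sum>s\<in>S. e s * X s i j)"
      by (intro sum.cong refl eq j False)
    also have "\<dots> = (\<Sum>s\<in>S. e s * (\<Sum>i\<in>I. X s i j))"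
      unfolding sum_distrib_left by (rule sum.swap)
    also have "norm \<dots> \<le> (\<Sum>s\<in>S. norm (\<Sum>i\<in>I. X s i j))"
      using e by (intro sum_norm_le) (simp add: norm_mult)
    finally show ?thesis using u0[OF j] unfolding sum_distrib_left[symmetric] by (rule mult_left_mono)
  qed simp
  then have "(\<Sum>j\<in>J. u j * norm (\<Sum>i\<in>I. f i j)) \<le> (\<Sum>j\<in>J. \<Sum>s\<in>S. u j * norm (\<Sum>i\<in>I. X s i j))"
    by (rule sum_mono)
  also have "\<dots> = (\<Sum>s\<in>S. \<Sum>j\<in>J. u j * norm (\<Sum>i\<in>I. X s i j))" by (rule sum.swap)
  also have "\<dots> \<le> (\<Sum>s\<in>S. B s)" by (intro sum_mono b)
  finally show ?thesis .
qed

text \<open>Since the values of \<open>c\<close> add up to at most \<open>card N\<close> times their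
  maximum, and \<open>r\<close> to the power \<open>card N\<close> is 1/2, each term is at most the
  product of the \<open>r ^ c q\<close>. The sum is thus dominated by a product of geometric series,
  uniformly in \<open>m\<close>.\<close>

lemma sum_max_powers_le:
  fixes A N :: "'q set"
  assumes A: "A \<subseteq> N" "A \<noteq> {}" and N: "finite N"
  defines "r \<equiv> (1/2) powr (1 / card N) :: real"
  shows "(\<Sum>c\<in>A \<rightarrow>\<^sub>E {..m}. (1/2) ^ Max (c ` A)) \<le> (1 / (1 - r)) ^ card N"
proof -
  have finA: "finite A" using A N finite_subset by blast
  have cN: "0 < card N" using A N by (auto simp: card_gt_0_iff)
  have "r < 1 powr (1 / card N)"
    unfolding r_def using cN by (intro powr_less_mono2) auto
  then have r: "0 < r" "r < 1" by (simp_all add: r_def)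
  have "r ^ card N = r powr card N" using r by (simp add: powr_realpow)
  then have rN: "r ^ card N = 1/2" using cN by (simp add: r_def powr_powr)
  have g: "1 \<le> 1 / (1 - r)" using r by simp
  have "(1/2) ^ Max (c ` A) \<le> (\<Prod>q\<in>A. r ^ c q)" for c :: "'q \<Rightarrow> nat"
  proof -
    have "(\<Sum>q\<in>A. c q) \<le> card A * Max (c ` A)"
      using finA by (intro sum_bounded_above[where K = "Max (c ` A)", simplified]) auto
    also have "\<dots> \<le> card N * Max (c ` A)" using A N by (intro mult_right_mono card_mono) auto
    finally have "r ^ (card N * Max (c ` A)) \<le> r ^ (\<Sum>q\<in>A. c q)"
      using r by (intro power_decreasing) auto
    then show ?thesis by (simp add: power_mult rN power_sum)
  qed
  then have "(\<Sum>c\<in>A \<rightarrow>\<^sub>E {..m}. (1/2) ^ Max (c ` A)) \<le> (\<Sum>c\<in>A \<rightarrow>\<^sub>E {..m}. \<Prod>q\<in>A. r ^ c q)"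
    by (intro sum_mono)
  also have "\<dots> = (\<Prod>q\<in>A. \<Sum>c\<le>m. r ^ c)"
    using finA by (subst prod_sum_PiE) auto
  also have "\<dots> \<le> (\<Prod>q\<in>A. 1 / (1 - r))"
  proof (intro prod_mono conjI)
    show "0 \<le> (\<Sum>c\<le>m. r ^ c)" using r by (intro sum_nonneg) auto
    have "(\<Sum>c\<le>m. r ^ c) \<le> (\<Sum>c. r ^ c)"
      using r by (intro sum_le_suminf summable_geometric) auto
    then show "(\<Sum>c\<le>m. r ^ c) \<le> 1 / (1 - r)" using r by (simp add: suminf_geometric)
  qed
  also have "\<dots> = (1 / (1 - r)) ^ card A" by simp
  also have "\<dots> \<le> (1 / (1 - r)) ^ card N"
    using g A N by (intro power_increasing card_mono) auto
  finally show ?thesis .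
qed

text \<open>The factor 4 pays for rounding two logarithms, \<open>2 ^ n\<close> counts the subsets
  in inclusion-exclusion, and the rest bounds the sum over the labels.\<close>

definition interpolation_constant :: "nat \<Rightarrow> real" where
  "interpolation_constant n = 4 * 2 ^ n * (1 / (1 - (1/2) powr (1 / n))) ^ n"

lemma interpolation_constant_nonneg: "0 \<le> interpolation_constant n"
  unfolding interpolation_constant_def
  by (intro mult_nonneg_nonneg zero_le_power divide_nonneg_nonneg) (auto simp: powr_le1)

text \<open>The constant depends on the number of levels, not on \<open>I\<close> and
  \<open>J\<close>; this uniformity permits passing from finite sections to infinite matrices. By
  \<open>dom\<close> each entry that matters is controlled at some level \<open>q\<close>, which may
  vary from entry to entry.\<close>

theorem sup_to_sum_interpolation:
  fixes Q :: "'i \<Rightarrow> 'j \<Rightarrow> 'k::real_normed_field"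
    and a :: "'q \<Rightarrow> 'i \<Rightarrow> real" and b :: "'q \<Rightarrow> 'j \<Rightarrow> real"
  assumes fin: "finite I" "finite J" "finite N"
    and b0: "\<And>q j. q \<in> N \<Longrightarrow> j \<in> J \<Longrightarrow> 0 \<le> b q j" and u0: "\<And>j. j \<in> J \<Longrightarrow> 0 \<le> u j"
    and C: "0 < C"
    and bound: "\<And>q x. q \<in> N \<Longrightarrow> (\<And>i. i \<in> I \<Longrightarrow> norm (x i) * a q i \<le> 1) \<Longrightarrow>
      (\<Sum>j\<in>J. b q j * norm (\<Sum>i\<in>I. x i * Q i j)) \<le> K"
    and dom: "\<And>i j. i \<in> I \<Longrightarrow> j \<in> J \<Longrightarrow> Q i j \<noteq> 0 \<Longrightarrow> 0 < u j \<Longrightarrow>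
      0 < w i \<and> (\<exists>q\<in>N. 0 < a q i \<and> 0 < b q j \<and> u j * a q i \<le> C * w i * b q j)"
    and x: "\<And>i. i \<in> I \<Longrightarrow> norm (x i) * w i \<le> 1"
    and K: "0 \<le> K"
  shows "(\<Sum>j\<in>J. u j * norm (\<Sum>i\<in>I. x i * Q i j)) \<le> interpolation_constant (card N) * C * K"
proof -
  \<comment> \<open>Rounding \<open>p\<close> up and \<open>n\<close> down gives integer labels and
    preserves \<open>n q j \<le> p q i\<close> wherever the unrounded logarithms satisfy it.\<close>
  define p where "p q i = \<lceil>log 2 (C * w i / a q i)\<rceil>" for q i
  define n where "n q j = \<lfloor>log 2 (u j / b q j)\<rfloor>" for q j
  define h where "h i j q \<longleftrightarrow> 0 < w i \<and> 0 < u j \<and> 0 < a q i \<and> 0 < b q j \<and> n q j \<le> p q i" for i j q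
  \<comment> \<open>A bound on all differences that occur, so that finitely many labels
    \<open>c\<close> suffice. It depends on \<open>I\<close> and \<open>J\<close>, but disappears
    from the final bound.\<close>
  define m where "m = Max (insert 0 ((\<lambda>(q,i,j). nat (p q i - n q j)) ` (N \<times> I \<times> J)))"
  have m: "nat (p q i - n q j) \<le> m" if "q \<in> N" "i \<in> I" "j \<in> J" for q i j
    unfolding m_def using that fin by (intro Max_ge) (auto intro!: image_eqI[of _ _ "(q,i,j)"])
  define P where "P A i \<longleftrightarrow> 0 < w i \<and> (\<forall>q\<in>A. 0 < a q i)" for A i
  define R where "R A j \<longleftrightarrow> 0 < u j \<and> (\<forall>q\<in>A. 0 < b q j)" for A j
  define X where "X A c i j = (if P A i \<and> R A j \<and> (\<forall>q\<in>A. p q i = n q j + int (c q))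
    then x i * Q i j else 0)" for A c i j
  let ?g = "(1 / (1 - (1/2) powr (1 / card N))) ^ card N :: real"
  have X: "(\<Sum>j\<in>J. u j * norm (\<Sum>i\<in>I. X A c i j)) \<le> 4 * C * K * (1/2) ^ Max (c ` A)"
    if A: "A \<in> Pow N - {{}}" for A and c :: "'q \<Rightarrow> nat"
  proof -
    have finA: "finite A" using A fin finite_subset by auto
    \<comment> \<open>Among the levels in \<open>A\<close> the one with the largest gain is
      used.\<close>
    then have "Max (c ` A) \<in> c ` A" using A by (intro Max_in) auto
    then obtain q0 where q0: "q0 \<in> A" "c q0 = Max (c ` A)" by auto
    have q0N: "q0 \<in> N" using A q0 by auto
    have "(\<Sum>j\<in>J. u j * norm (\<Sum>i\<in>I. X A c i j)) \<le> (2 * C) * 2 * K * (1/2) ^ c q0"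
      unfolding X_def
    proof (rule labelled_block_bound[OF fin(1,2) q0(1) b0[OF q0N] u0 _ bound[OF q0N]])
      fix i assume i: "i \<in> I" "P A i"
      then have pos: "0 < w i" "0 < a q0 i" using q0 by (auto simp: P_def)
      have "real_of_int (p q0 i) \<le> log 2 (C * w i / a q0 i) + 1" unfolding p_def by linarith
      then have "2 powr p q0 i \<le> 2 powr (log 2 (C * w i / a q0 i) + 1)" by simp
      also have "\<dots> = 2 * (C * w i / a q0 i)" using pos C by (simp add: powr_add)
      finally have "2 powr p q0 i * a q0 i \<le> 2 * C * w i"
        using pos by (simp add: field_simps)
      then have "norm (x i) * (2 powr p q0 i * a q0 i) \<le> norm (x i) * (2 * C * w i)"
        by (intro mult_left_mono) auto
      also have "\<dots> = 2 * C * (norm (x i) * w i)" by simp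
      also have "\<dots> \<le> 2 * C * 1" using x[OF i(1)] C by (intro mult_left_mono) auto
      finally show "norm (x i) * (2 powr p q0 i * a q0 i) \<le> 2 * C" by simp
    next
      fix j assume j: "j \<in> J" "R A j"
      then have pos: "0 < u j" "0 < b q0 j" using q0 by (auto simp: R_def)
      have "u j / b q0 j = 2 powr (log 2 (u j / b q0 j))" using pos by simp
      also have "\<dots> \<le> 2 powr (n q0 j + 1)" unfolding n_def by (intro powr_mono) linarith+
      also have "\<dots> = 2 * 2 powr n q0 j" by (simp add: powr_add)
      finally show "u j \<le> 2 * 2 powr n q0 j * b q0 j" using pos by (simp add: field_simps)
    qed (use C in auto)
    then show ?thesis using q0 by simp
  qed
  have exp1: "(if \<forall>q\<in>A. h i j q then x i * Q i j else 0) = (\<Sum>c\<in>A \<rightarrow>\<^sub>E {..m}. 1 * X A c i j)"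
    if A: "A \<in> Pow N - {{}}" and i: "i \<in> I" and j: "j \<in> J" for A i j
  proof -
    \<comment> \<open>The only label whose piece can contain the entry
      \<open>(i, j)\<close>.\<close>
    define c where "c = restrict (\<lambda>q. nat (p q i - n q j)) A"
    have finP: "finite (A \<rightarrow>\<^sub>E {..m})"
      using A fin finite_subset by (intro finite_PiE) auto
    have cP: "c \<in> A \<rightarrow>\<^sub>E {..m}" unfolding c_def using A i j m by auto
    have uniq: "d = c" if "d \<in> A \<rightarrow>\<^sub>E {..m}" "\<forall>q\<in>A. p q i = n q j + int (d q)" for d
      using that(1) cP
    proof (rule PiE_ext)
      fix q assume "q \<in> A"
      then show "d q = c q" using that(2) by (simp add: c_def)
    qed
    have "(\<Sum>d\<in>A \<rightarrow>\<^sub>E {..m}. 1 * X A d i j) = (\<Sum>d\<in>A \<rightarrow>\<^sub>E {..m}. if d = c then X A c i j else 0)"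
      by (intro sum.cong refl) (use uniq in \<open>auto simp: X_def\<close>)
    also have "\<dots> = X A c i j" using finP cP by simp
    \<comment> \<open>\<open>nat\<close> cuts negative differences to 0, so the equation in
      \<open>X\<close> for this \<open>c\<close> holds exactly when \<open>n q j \<le> p q i\<close>
      for all \<open>q \<in> A\<close>.\<close>
    also have "\<dots> = (if \<forall>q\<in>A. h i j q then x i * Q i j else 0)"
      using A by (auto simp: X_def c_def h_def P_def R_def)
    finally show ?thesis ..
  qed
  have A: "(\<Sum>j\<in>J. u j * norm (\<Sum>i\<in>I. if \<forall>q\<in>A. h i j q then x i * Q i j else 0)) \<le> 4 * C * K * ?g"
    if A: "A \<in> Pow N - {{}}" for A
  proof -
    have "(\<Sum>j\<in>J. u j * norm (\<Sum>i\<in>I. if \<forall>q\<in>A. h i j q then x i * Q i j else 0))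
      \<le> (\<Sum>c\<in>A \<rightarrow>\<^sub>E {..m}. 4 * C * K * (1/2) ^ Max (c ` A))"
      using X[OF A] u0 exp1[OF A] by (intro weighted_sum_norm_le_of_decomposition[where e = "\<lambda>_. 1"]) auto
    also have "\<dots> = 4 * C * K * (\<Sum>c\<in>A \<rightarrow>\<^sub>E {..m}. (1/2) ^ Max (c ` A))"
      by (simp add: sum_distrib_left)
    also have "\<dots> \<le> 4 * C * K * ?g"
      using A fin C K by (intro mult_left_mono sum_max_powers_le) auto
    finally show ?thesis .
  qed
  have exp2: "x i * Q i j = (\<Sum>A\<in>Pow N - {{}}. (- 1) ^ Suc (card A) *
      (if \<forall>q\<in>A. h i j q then x i * Q i j else 0))" if i: "i \<in> I" and j: "j \<in> J" and uj: "u j \<noteq> 0" for i j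
  proof (cases "Q i j = 0")
    case False
    have "0 < u j" using uj u0[OF j] by simp
    then obtain q where q: "q \<in> N" "0 < w i" "0 < a q i" "0 < b q j" "u j * a q i \<le> C * w i * b q j"
      using dom[OF i j False] by blast
    have "u j / b q j \<le> C * w i / a q i" using q by (simp add: field_simps)
    then have "log 2 (u j / b q j) \<le> log 2 (C * w i / a q i)"
      using q \<open>0 < u j\<close> C by (subst log_le_cancel_iff) auto
    then have "n q j \<le> p q i" unfolding n_def p_def by linarith
    then have "h i j q" using q \<open>0 < u j\<close> by (simp add: h_def)
    then show ?thesis using q fin by (intro inclusion_exclusion_indicator) auto
  next
    case True
    then show ?thesis by (simp cong: if_cong)
  qed
  have "(\<Sum>j\<in>J. u j * norm (\<Sum>i\<in>I. x i * Q i j)) \<le> (\<Sum>A\<in>Pow N - {{}}. 4 * C * K * ?g)"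
    by (rule weighted_sum_norm_le_of_decomposition[OF u0 exp2 _ A]) (auto simp: norm_power)
  also have "\<dots> \<le> (\<Sum>A\<in>Pow N. 4 * C * K * ?g)"
  proof (intro sum_mono2)
    have "(1/2) powr (1 / card N) \<le> (1::real)" by (simp add: powr_le1)
    then have "0 \<le> ?g" by simp
    then show "0 \<le> 4 * C * K * ?g" using C K by (intro mult_nonneg_nonneg) auto
  qed (use fin in auto)
  also have "\<dots> = interpolation_constant (card N) * C * K"
    using fin by (simp add: interpolation_constant_def card_Pow)
  finally show ?thesis .
qed

section \<open>From the estimate to tameness\<close>

lemma operator_sum:
  assumes E: "graded_seminormed_space E" and T: "T \<in> continuous_operators E F"
    and x: "\<And>i. i \<in> I \<Longrightarrow> x i \<in> gcarrier E"
  shows "T (\<Sum>i\<in>I. x i) = (\<Sum>i\<in>I. T (x i))"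
proof -
  interpret E: graded_seminormed_space E by fact
  have add: "T (u + v) = T u + T v" if "u \<in> gcarrier E" "v \<in> gcarrier E" for u v
    using T that unfolding continuous_operators_def by blast
  have T0: "T 0 = 0" using add[OF E.gcarrier_closed(1) E.gcarrier_closed(1)] by simp
  show ?thesis using x
  proof (induction I rule: infinite_finite_induct)
    case (insert i I)
    have "T (x i + (\<Sum>i\<in>I. x i)) = T (x i) + T (\<Sum>i\<in>I. x i)"
      using insert.prems by (intro add E.gcarrier_closed(6)) auto
    then show ?case using insert by simp
  qed (simp_all add: T0)
qed

context koethe_sequence_space
begin

lemma operator_coordinate_sum:
  assumes T: "T \<in> continuous_operators E F"
  shows "T (\<Sum>i\<in>I. coordinate_vector i (x i)) =
    (\<Sum>i\<in>I. gscale F (x i) (T (coordinate_vector i 1)))"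
proof -
  have "coordinate_vector i c = gscale E c (coordinate_vector i 1)" for i c
    by (auto simp: gscale_eq coordinate_vector_def fun_eq_iff)
  then have "T (coordinate_vector i c) = gscale F c (T (coordinate_vector i 1))" for i c
    using T coordinate_vector_in unfolding continuous_operators_def by (metis (mono_tags, lifting) mem_Collect_eq)
  then show ?thesis
    unfolding operator_sum[OF graded_seminormed_space_axioms T coordinate_vector_in]
    by (intro sum.cong refl)
qed

text \<open>Truncations converge to \<open>x\<close> at every level, in particular at the level
  \<open>r\<close> at which \<open>T\<close> is continuous; this level affects only the error term,
  which tends to 0.\<close>

lemma operator_bound_from_truncations:
  assumes F: "graded_seminormed_space F" and T: "T \<in> continuous_operators E F"
    and x: "x \<in> gcarrier E" and M: "\<And>n. gseminorm F k (T (truncation n x)) \<le> M"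
  shows "gseminorm F k (T x) \<le> M"
proof -
  interpret F: graded_seminormed_space F by fact
  note T' = T[unfolded continuous_operators_iff[OF graded_seminormed_space_axioms F]]
  obtain r C where C: "\<And>y. y \<in> gcarrier E \<Longrightarrow> gseminorm F k (T y) \<le> C * gseminorm E r y"
    using T' by blast
  have in_F: "T y \<in> gcarrier F" if "y \<in> gcarrier E" for y using T' that by blast
  have le: "gseminorm F k (T x) \<le> M + C * gseminorm E r (x - truncation n x)" for n
  proof -
    have "T (x - truncation n x) = T x - T (truncation n x)"
      using T' by (intro additive_on_diff[OF graded_seminormed_space_axioms _ x truncation_in]) blast
    then have "gseminorm F k (T x) \<le> gseminorm F k (T (truncation n x)) + gseminorm F k (T (x - truncation n x))"
      using F.gseminorm_le_add_diff[OF in_F[OF x] in_F[OF truncation_in], of k n x] by simp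
    also have "\<dots> \<le> M + C * gseminorm E r (x - truncation n x)"
      by (intro add_mono M C gcarrier_closed(3) x truncation_in)
    finally show ?thesis .
  qed
  have "(\<lambda>n. M + C * gseminorm E r (x - truncation n x)) \<longlonglongrightarrow> M + C * 0"
    by (intro tendsto_intros truncation_tendsto x)
  then show ?thesis using le by (intro LIMSEQ_le_const) auto
qed

end

text \<open>The inequality of the third statement at a single level \<open>k\<close>, spelled so
  that unfolding gives the statement literally.\<close>

definition uniform_estimate ::
  "('k, 'f) graded_space \<Rightarrow> (nat \<Rightarrow> nat \<Rightarrow> real) \<Rightarrow> (nat \<Rightarrow> nat \<Rightarrow> real) \<Rightarrow>
     (nat \<Rightarrow> nat) \<Rightarrow> (nat \<Rightarrow> nat) \<Rightarrow> nat \<Rightarrow> bool" where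
  "uniform_estimate F a b S \<phi> k \<longleftrightarrow> (\<exists>qk::nat. \<exists>Ck::real. Ck > 0 \<and>
            (\<forall>z\<in>gcarrier F. \<forall>i j.
              ennreal (gseminorm F k z) / ennreal (a i (S k))
              \<le> ennreal Ck *
                 max_product
                   (MAX q\<in>{..qk}. ennreal (b j q) / ennreal (a i (\<phi> q)))
                   (MAX q\<in>{..qk}. ennreal (gseminorm F q z) / ennreal (b j (\<phi> q)))))"

lemma ennreal_divide_ennreal:
  assumes "0 \<le> x" "0 \<le> y" "x \<noteq> 0 \<Longrightarrow> y \<noteq> 0"
  shows "ennreal x / ennreal y = ennreal (x / y)"
  using assms by (cases "x = 0") (auto simp: divide_ennreal)

text \<open>The second maximum is at most \<open>L\<close>, so one of the finitely many ratios in
  the first must be large. The condition \<open>fin\<close> keeps these ratios finite, and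
  \<open>t > 0\<close> excludes \<open>w = 0\<close> because the left side would then be
  infinite.\<close>

lemma estimate_dominates:
  fixes \<alpha> \<beta> \<gamma> \<delta> :: "nat \<Rightarrow> real"
  assumes le: "ennreal t / ennreal w \<le> ennreal C *
      max_product (MAX q\<in>{..n}. ennreal (\<beta> q) / ennreal (\<alpha> q)) (MAX q\<in>{..n}. ennreal (\<gamma> q) / ennreal (\<delta> q))"
    and nonneg: "\<And>q. 0 \<le> \<alpha> q" "\<And>q. 0 \<le> \<beta> q" "\<And>q. 0 \<le> \<gamma> q" "\<And>q. 0 \<le> \<delta> q" "0 \<le> w"
    and C: "0 < C" and t: "0 < t"
    and fin: "\<And>q. \<beta> q \<noteq> 0 \<Longrightarrow> \<alpha> q \<noteq> 0"
    and L: "\<And>q. q \<le> n \<Longrightarrow> \<gamma> q \<le> L * \<delta> q" and L0: "0 \<le> L"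
  shows "0 < w \<and> (\<exists>q\<le>n. 0 < \<alpha> q \<and> 0 < \<beta> q \<and> t * \<alpha> q \<le> C * L * w * \<beta> q)"
proof -
  have "(MAX q\<in>{..n}. ennreal (\<beta> q) / ennreal (\<alpha> q)) \<in> (\<lambda>q. ennreal (\<beta> q) / ennreal (\<alpha> q)) ` {..n}"
    by (intro Max_in) auto
  then obtain q where "q \<le> n"
      "(MAX q\<in>{..n}. ennreal (\<beta> q) / ennreal (\<alpha> q)) = ennreal (\<beta> q) / ennreal (\<alpha> q)"
    by blast
  then have q: "q \<le> n" "(MAX q\<in>{..n}. ennreal (\<beta> q) / ennreal (\<alpha> q)) = ennreal (\<beta> q / \<alpha> q)"
    by (simp_all add: ennreal_divide_ennreal[OF nonneg(2,1) fin])
  have gd: "ennreal (\<gamma> q) / ennreal (\<delta> q) \<le> ennreal L" if "q \<le> n" for q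
  proof (cases "\<gamma> q = 0")
    case False
    then have "\<delta> q \<noteq> 0" using L[OF that] nonneg(3)[of q] by auto
    then show ?thesis using nonneg(3,4)[of q] L[OF that]
      by (simp add: ennreal_divide_ennreal pos_divide_le_eq ennreal_leI)
  qed simp
  then have le_L: "(MAX q\<in>{..n}. ennreal (\<gamma> q) / ennreal (\<delta> q)) \<le> ennreal L" (is "?v \<le> _") by simp
  then have "?v \<noteq> \<infinity>" using neq_top_trans[of "ennreal L" ?v] by auto
  then have "max_product (ennreal (\<beta> q / \<alpha> q)) (MAX q\<in>{..n}. ennreal (\<gamma> q) / ennreal (\<delta> q))
      \<le> ennreal (\<beta> q / \<alpha> q) * ennreal L"
    unfolding max_product_def using mult_left_mono[OF le_L] by simp
  then have "ennreal t / ennreal w \<le> ennreal C * (ennreal (\<beta> q / \<alpha> q) * ennreal L)"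
    using le unfolding q(2) by (meson mult_left_mono order_trans zero_le)
  also have "\<dots> = ennreal (C * (\<beta> q / \<alpha> q * L))"
  proof -
    have g: "0 \<le> \<beta> q / \<alpha> q" using nonneg by simp
    show ?thesis
      by (simp only: ennreal_mult[OF less_imp_le[OF C] mult_nonneg_nonneg[OF g L0]] ennreal_mult[OF g L0])
  qed
  finally have main: "ennreal t / ennreal w \<le> ennreal (C * (\<beta> q / \<alpha> q * L))" .
  have w: "0 < w"
  proof (rule ccontr)
    assume "\<not> 0 < w"
    then have "w = 0" using nonneg(5) by simp
    then have "ennreal t / ennreal w = \<infinity>" using t by (simp add: ennreal_divide_zero)
    then show False using main by (simp add: top_unique)
  qed
  have "t / w \<le> C * (\<beta> q / \<alpha> q * L)"
    using main t w C L0 nonneg by (simp add: divide_ennreal ennreal_le_iff)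
  moreover have "0 < t / w" using t w by simp
  ultimately have "\<beta> q / \<alpha> q \<noteq> 0" by auto
  then have pos: "0 < \<beta> q" "0 < \<alpha> q" using nonneg(1,2)[of q] by auto
  have "t * \<alpha> q \<le> C * L * w * \<beta> q"
    using \<open>t / w \<le> C * (\<beta> q / \<alpha> q * L)\<close> pos w by (simp add: field_simps)
  then show ?thesis using w pos q by blast
qed

text \<open>The estimate has a single nondecreasing \<open>\<phi>\<close> for both factors. Summing
  the levels of \<open>Q\<close> and \<open>R\<close> over all \<open>p \<le> q\<close> dominates
  both and is monotone in \<open>q\<close>.\<close>

lemma common_mono_bound:
  assumes "graded_seminormed_space E" "graded_seminormed_space G" "graded_seminormed_space F"
    and Q: "Q \<in> continuous_operators E G" and R: "R \<in> continuous_operators G F"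
  obtains \<phi> K where "mono \<phi>" "\<And>q. 0 \<le> K q"
    "\<And>q x. x \<in> gcarrier E \<Longrightarrow> gseminorm G q (Q x) \<le> K q * gseminorm E (\<phi> q) x"
    "\<And>q y. y \<in> gcarrier G \<Longrightarrow> gseminorm F q (R y) \<le> K q * gseminorm G (\<phi> q) y"
proof -
  interpret E: graded_seminormed_space E by fact
  interpret G: graded_seminormed_space G by fact
  obtain r C where r: "\<And>q x. x \<in> gcarrier E \<Longrightarrow> gseminorm G q (Q x) \<le> C q * gseminorm E (r q) x"
    using Q unfolding continuous_operators_iff[OF assms(1,2)] by metis
  obtain s D where s: "\<And>q x. x \<in> gcarrier G \<Longrightarrow> gseminorm F q (R x) \<le> D q * gseminorm G (s q) x"
    using R unfolding continuous_operators_iff[OF assms(2,3)] by metis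
  let ?\<phi> = "\<lambda>q. \<Sum>p\<le>q. r p + s p" and ?K = "\<lambda>q. \<bar>C q\<bar> + \<bar>D q\<bar>"
  have \<phi>: "r q \<le> ?\<phi> q" "s q \<le> ?\<phi> q" for q
    using member_le_sum[of q "{..q}" "\<lambda>p. r p + s p"] by auto
  show ?thesis
  proof (rule that)
    show "mono ?\<phi>" by (intro monoI sum_mono2) auto
    show "0 \<le> ?K q" for q by simp
    show "gseminorm G q (Q x) \<le> ?K q * gseminorm E (?\<phi> q) x" if x: "x \<in> gcarrier E" for q x
    proof -
      have "C q * gseminorm E (r q) x \<le> ?K q * gseminorm E (?\<phi> q) x"
        using E.gseminorm_nonneg[OF x, of "r q"] E.gseminorm_mono[OF x \<phi>(1)]
        by (intro mult_mono) auto
      then show ?thesis using r[OF x, of q] by linarith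
    qed
    show "gseminorm F q (R x) \<le> ?K q * gseminorm G (?\<phi> q) x" if x: "x \<in> gcarrier G" for q x
    proof -
      have "D q * gseminorm G (s q) x \<le> ?K q * gseminorm G (?\<phi> q) x"
        using G.gseminorm_nonneg[OF x, of "s q"] G.gseminorm_mono[OF x \<phi>(2)]
        by (intro mult_mono) auto
      then show ?thesis using s[OF x, of q] by linarith
    qed
  qed
qed

text \<open>The condition that coefficients of weighted size at most 1 produce a sum in the unit
  ball holds for every finite \<open>I\<close> in \<open>koethe_c0\<close> and for singletons in
  \<open>koethe_l1\<close>. One bound thus serves both domains; \<open>M\<close> is independent of
  \<open>I\<close> and \<open>x\<close>.\<close>

lemma factorized_bound_on_unconditional_sums:
  fixes E :: "('k::{real_normed_field,banach}, nat \<Rightarrow> 'k) graded_space"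
    and F :: "('k, 'f::ab_group_add) graded_space"
  assumes E: "koethe_sequence_space E a" and b: "koethe_matrix b" and F: "graded_seminormed_space F"
    and Q: "Q \<in> continuous_operators E (koethe_l1 b)" and R: "R \<in> continuous_operators (koethe_l1 b) F"
    and K0: "\<And>q. 0 \<le> K q"
    and QK: "\<And>q x. x \<in> gcarrier E \<Longrightarrow> gseminorm (koethe_l1 b) q (Q x) \<le> K q * gseminorm E (\<phi> q) x"
    and RK: "\<And>q y. y \<in> gcarrier (koethe_l1 b) \<Longrightarrow> gseminorm F q (R y) \<le> K q * gseminorm (koethe_l1 b) (\<phi> q) y"
    and est: "uniform_estimate F a b S \<phi> k"
  obtains M where "0 \<le> M"
    "\<And>I x. finite I \<Longrightarrow>
      (\<And>r y. (\<And>i. i \<in> I \<Longrightarrow> norm (y i) * a i r \<le> 1) \<Longrightarrow>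
        gseminorm E r (\<Sum>i\<in>I. coordinate_vector i (y i)) \<le> 1) \<Longrightarrow>
      (\<And>i. i \<in> I \<Longrightarrow> norm (x i) * a i (S k) \<le> 1) \<Longrightarrow>
      gseminorm F k (R (Q (\<Sum>i\<in>I. coordinate_vector i (x i)))) \<le> M"
proof -
  let ?G = "koethe_l1 b :: ('k, nat \<Rightarrow> 'k) graded_space"
  interpret E: koethe_sequence_space E a by fact
  interpret G: koethe_sequence_space ?G b by (rule koethe_sequence_space_l1[OF b])
  interpret F: graded_seminormed_space F by fact
  note Q' = Q[unfolded continuous_operators_iff[OF E.graded_seminormed_space_axioms G.graded_seminormed_space_axioms]]
  note R' = R[unfolded continuous_operators_iff[OF G.graded_seminormed_space_axioms F]]
  obtain n C where C: "C > 0" and est': "\<And>z i j. z \<in> gcarrier F \<Longrightarrow>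
      ennreal (gseminorm F k z) / ennreal (a i (S k)) \<le> ennreal C * max_product
        (MAX q\<in>{..n}. ennreal (b j q) / ennreal (a i (\<phi> q)))
        (MAX q\<in>{..n}. ennreal (gseminorm F q z) / ennreal (b j (\<phi> q)))"
    using est unfolding uniform_estimate_def by blast
  \<comment> \<open>One constant for all levels up to \<open>n\<close>; the summand 1 keeps it
    positive.\<close>
  define L where "L = 1 + (\<Sum>q\<le>n. K q)"
  have KL: "K q \<le> L" if "q \<le> n" for q
    using member_le_sum[of q "{..n}" K] that K0 by (simp add: L_def)
  have L: "0 < L" using K0 by (simp add: L_def sum_nonneg add_pos_nonneg)
  note a0 = koethe_matrix_nonneg[OF E.koethe] and b0 = koethe_matrix_nonneg[OF b]
  \<comment> \<open>The matrix of \<open>Q\<close>, and the images under \<open>R\<close> of the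
    coordinate vectors.\<close>
  define m where "m i j = Q (coordinate_vector i 1) j" for i j
  define z where "z j = R (coordinate_vector j 1)" for j
  have z: "z j \<in> gcarrier F" for j using R' G.coordinate_vector_in by (auto simp: z_def)
  have dom: "0 < a i (S k) \<and> (\<exists>q\<in>{..n}. 0 < a i (\<phi> q) \<and> 0 < b j q \<and>
      gseminorm F k (z j) * a i (\<phi> q) \<le> (C * L) * a i (S k) * b j q)"
    if mij: "m i j \<noteq> 0" and zj: "0 < gseminorm F k (z j)" for i j
  proof -
    have "0 < a i (S k) \<and> (\<exists>q\<le>n. 0 < a i (\<phi> q) \<and> 0 < b j q \<and>
      gseminorm F k (z j) * a i (\<phi> q) \<le> C * L * a i (S k) * b j q)"
    proof (rule estimate_dominates[OF est'[OF z]])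
      fix q
      show "0 \<le> gseminorm F q (z j)" by (rule F.gseminorm_nonneg[OF z])
      \<comment> \<open>Continuity of \<open>Q\<close> bounds a nonzero matrix entry: if
        \<open>a i (\<phi> q)\<close> vanishes, so does \<open>b j q\<close>. This provides
        finiteness of the first ratios.\<close>
      have "norm (m i j) * b j q \<le> gseminorm ?G q (Q (coordinate_vector i 1))"
        unfolding m_def using Q' E.coordinate_vector_in by (intro G.coordinate_le) blast
      also have "\<dots> \<le> K q * a i (\<phi> q)"
        using QK[OF E.coordinate_vector_in, of q i 1] by (simp add: E.gseminorm_coordinate_vector)
      finally show "b j q \<noteq> 0 \<Longrightarrow> a i (\<phi> q) \<noteq> 0"
        using mij b0[of j q] by (auto simp: mult_le_0_iff)
      assume q: "q \<le> n"
      have "gseminorm F q (z j) \<le> K q * b j (\<phi> q)"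
        using RK[OF G.coordinate_vector_in, of q j 1] by (simp add: G.gseminorm_coordinate_vector z_def)
      also have "\<dots> \<le> L * b j (\<phi> q)" by (intro mult_right_mono KL q b0)
      finally show "gseminorm F q (z j) \<le> L * b j (\<phi> q)" .
    qed (use a0 b0 C L zj in auto)
    then show ?thesis by auto
  qed
  define M where "M = interpolation_constant (card {..n}) * (C * L) * L"
  have "gseminorm F k (R (Q (\<Sum>i\<in>I. coordinate_vector i (x i)))) \<le> M"
    if I: "finite I"
      and uncond: "\<And>r y. (\<And>i. i \<in> I \<Longrightarrow> norm (y i) * a i r \<le> 1) \<Longrightarrow>
        gseminorm E r (\<Sum>i\<in>I. coordinate_vector i (y i)) \<le> 1"
      and x: "\<And>i. i \<in> I \<Longrightarrow> norm (x i) * a i (S k) \<le> 1" for I and x :: "nat \<Rightarrow> 'k"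
  proof -
    have inE: "(\<Sum>i\<in>I. coordinate_vector i (y i)) \<in> gcarrier E" for y
      by (intro E.gcarrier_closed(6) E.coordinate_vector_in)
    then have inG: "Q (\<Sum>i\<in>I. coordinate_vector i (y i)) \<in> gcarrier ?G" for y
      using Q' by blast
    have Qsum: "Q (\<Sum>i\<in>I. coordinate_vector i (y i)) j = (\<Sum>i\<in>I. y i * m i j)" for y j
      by (simp add: E.operator_coordinate_sum[OF Q] gscale_koethe_l1 sum_fun_apply m_def)
    \<comment> \<open>Interpolation with column weight \<open>gseminorm F k (z j)\<close> and row
      weight \<open>a i (S k)\<close>; the levels \<open>q \<le> n\<close> supply the known bounds
      on \<open>Q\<close>.\<close>
    have fin: "(\<Sum>j\<in>J. gseminorm F k (z j) * norm (\<Sum>i\<in>I. x i * m i j)) \<le> M" if J: "finite J" for J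
      unfolding M_def
    proof (rule sup_to_sum_interpolation[where a = "\<lambda>q i. a i (\<phi> q)" and b = "\<lambda>q j. b j q" and w = "\<lambda>i. a i (S k)"])
      fix q and y :: "nat \<Rightarrow> 'k"
      assume q: "q \<in> {..n}" and y: "\<And>i. i \<in> I \<Longrightarrow> norm (y i) * a i (\<phi> q) \<le> 1"
      have "(\<Sum>j\<in>J. b j q * norm (\<Sum>i\<in>I. y i * m i j)) =
          (\<Sum>j\<in>J. norm (Q (\<Sum>i\<in>I. coordinate_vector i (y i)) j) * b j q)"
        unfolding Qsum by (simp add: mult.commute)
      also have "\<dots> \<le> gseminorm ?G q (Q (\<Sum>i\<in>I. coordinate_vector i (y i)))"
        by (intro sum_le_gseminorm_koethe_l1 b inG J)
      also have "\<dots> \<le> K q * gseminorm E (\<phi> q) (\<Sum>i\<in>I. coordinate_vector i (y i))"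
        by (rule QK[OF inE])
      also have "\<dots> \<le> K q * 1" by (intro mult_left_mono uncond y K0)
      also have "\<dots> \<le> L" using KL q by simp
      finally show "(\<Sum>j\<in>J. b j q * norm (\<Sum>i\<in>I. y i * m i j)) \<le> L" .
    next
      fix j
      show "0 \<le> gseminorm F k (z j)" by (rule F.gseminorm_nonneg[OF z])
    qed (use I J b0 C L dom x in auto)
    show ?thesis
    proof (rule G.operator_bound_from_truncations[OF F R inG])
      fix N
      let ?y = "Q (\<Sum>i\<in>I. coordinate_vector i (x i))"
      have "gseminorm F k (R (truncation N ?y)) = gseminorm F k (\<Sum>j<N. gscale F (?y j) (z j))"
        by (simp only: truncation_eq_sum G.operator_coordinate_sum[OF R] z_def)
      also have "\<dots> \<le> (\<Sum>j<N. gseminorm F k (gscale F (?y j) (z j)))"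
        by (intro F.gseminorm_sum F.gcarrier_closed(5) z)
      also have "\<dots> = (\<Sum>j<N. gseminorm F k (z j) * norm (\<Sum>i\<in>I. x i * m i j))"
        by (simp add: F.gseminorm_scale[OF z] Qsum mult.commute)
      also have "\<dots> \<le> M" by (rule fin) simp
      finally show "gseminorm F k (R (truncation N ?y)) \<le> M" .
    qed
  qed
  moreover have "0 \<le> M"
    unfolding M_def using C L by (intro mult_nonneg_nonneg interpolation_constant_nonneg) auto
  ultimately show ?thesis using that by blast
qed

text \<open>The l1 seminorm adds up over coordinates, so multiples of coordinate vectors in the unit
  ball decide about boundedness.\<close>

lemma koethe_l1_bound_from_units:
  fixes F :: "('k::{real_normed_field,banach}, 'f::ab_group_add) graded_space"
  assumes a: "koethe_matrix a" and F: "graded_seminormed_space F"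
    and T: "T \<in> continuous_operators (koethe_l1 a) F" and M0: "0 \<le> M"
    and M: "\<And>i c. norm c * a i r \<le> 1 \<Longrightarrow> gseminorm F k (T (coordinate_vector i c)) \<le> M"
    and x: "x \<in> gcarrier (koethe_l1 a)"
  shows "gseminorm F k (T x) \<le> M * gseminorm (koethe_l1 a) r x"
proof -
  let ?E = "koethe_l1 a :: ('k, nat \<Rightarrow> 'k) graded_space"
  interpret E: koethe_sequence_space ?E a by (rule koethe_sequence_space_l1[OF a])
  interpret F: graded_seminormed_space F by fact
  note T' = T[unfolded continuous_operators_iff[OF E.graded_seminormed_space_axioms F]]
  have in_F: "T (coordinate_vector i c) \<in> gcarrier F" for i c
    using T' E.coordinate_vector_in by blast
  have scale: "T (coordinate_vector i (c * d)) = gscale F c (T (coordinate_vector i d))" for i c d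
  proof -
    have "coordinate_vector i (c * d) = gscale ?E c (coordinate_vector i d)"
      by (auto simp: E.gscale_eq coordinate_vector_def fun_eq_iff)
    then show ?thesis using T' E.coordinate_vector_in by metis
  qed
  have unit: "gseminorm F k (T (coordinate_vector i c)) \<le> M * (norm c * a i r)" for i c
  proof -
    define G where "G = gseminorm F k (T (coordinate_vector i 1))"
    have c: "gseminorm F k (T (coordinate_vector i d)) = norm d * G" for d
      using scale[of i d 1] F.gseminorm_scale[OF in_F, of k d i 1] by (simp add: G_def)
    have "G \<le> M * a i r"
    proof (cases "a i r = 0")
      case False
      then have "0 < a i r" using koethe_matrix_nonneg[OF a, of i r] by simp
      moreover have "norm (of_real (1 / a i r) :: 'k) * a i r \<le> 1"
        using \<open>0 < a i r\<close> unfolding norm_of_real by simp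
      then have "\<bar>1 / a i r\<bar> * G \<le> M"
        using M[of "of_real (1 / a i r)" i] unfolding c norm_of_real by blast
      ultimately show ?thesis by (simp add: field_simps)
    next
      case True
      \<comment> \<open>With weight 0 every multiple of the coordinate vector lies in the unit ball,
        which forces \<open>G\<close> to be 0.\<close>
      have "d * G \<le> M" if "0 < d" for d
        using M[of "of_real d" i] that True unfolding c norm_of_real by simp
      from this[of "(M + 1) / G"] have "\<not> 0 < G"
        using M0 by auto
      then show ?thesis using True by simp
    qed
    then have "norm c * G \<le> norm c * (M * a i r)"
      by (rule mult_left_mono) simp
    then show ?thesis by (simp add: c mult_ac)
  qed
  show ?thesis
  proof (rule E.operator_bound_from_truncations[OF F T x])
    fix n
    have "T (truncation n x) = (\<Sum>j<n. T (coordinate_vector j (x j)))"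
      unfolding truncation_eq_sum
      by (rule operator_sum[OF E.graded_seminormed_space_axioms T E.coordinate_vector_in])
    then have "gseminorm F k (T (truncation n x)) \<le> (\<Sum>j<n. gseminorm F k (T (coordinate_vector j (x j))))"
      by (simp add: F.gseminorm_sum in_F)
    also have "\<dots> \<le> (\<Sum>j<n. M * (norm (x j) * a j r))" by (intro sum_mono unit)
    also have "\<dots> = M * (\<Sum>j<n. norm (x j) * a j r)" by (simp add: sum_distrib_left)
    also have "\<dots> \<le> M * gseminorm ?E r x"
      by (intro mult_left_mono sum_le_gseminorm_koethe_l1 a x M0) simp
    finally show "gseminorm F k (T (truncation n x)) \<le> M * gseminorm ?E r x" .
  qed
qed

text \<open>For a supremum seminorm the truncations of a vector in the unit ball are exactly of the
  form required in \<open>M\<close>; density and homogeneity do the rest.\<close>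

lemma koethe_c0_bound_from_sums:
  fixes F :: "('k::{real_normed_field,banach}, 'f::ab_group_add) graded_space"
  assumes a: "koethe_matrix a" and F: "graded_seminormed_space F"
    and T: "T \<in> continuous_operators (koethe_c0 a) F"
    and M: "\<And>I x. finite I \<Longrightarrow> (\<And>i. i \<in> I \<Longrightarrow> norm (x i) * a i r \<le> 1) \<Longrightarrow>
      gseminorm F k (T (\<Sum>i\<in>I. coordinate_vector i (x i))) \<le> M"
    and x: "x \<in> gcarrier (koethe_c0 a)"
  shows "gseminorm F k (T x) \<le> M * gseminorm (koethe_c0 a) r x"
proof -
  let ?E = "koethe_c0 a :: ('k, nat \<Rightarrow> 'k) graded_space"
  interpret E: koethe_sequence_space ?E a by (rule koethe_sequence_space_c0[OF a])
  note T' = T[unfolded continuous_operators_iff[OF E.graded_seminormed_space_axioms F]]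
  have "gseminorm F k (T x) \<le> M / 1 * gseminorm ?E r x"
  proof (rule bound_from_ball[OF E.graded_seminormed_space_axioms F _ _ _ _ x])
    fix x
    assume x: "x \<in> gcarrier ?E" and lt: "gseminorm ?E r x < 1"
    show "gseminorm F k (T x) \<le> M"
    proof (rule E.operator_bound_from_truncations[OF F T x])
      fix n
      show "gseminorm F k (T (truncation n x)) \<le> M"
        unfolding truncation_eq_sum
      proof (rule M)
        fix i
        show "norm (x i) * a i r \<le> 1" using E.coordinate_le[OF x, of i r] lt by linarith
      qed simp
    qed
  qed (use T' in auto)
  then show ?thesis by simp
qed

theorem estimate_imp_tame:
  fixes F :: "('k::{real_normed_field,banach}, 'f::ab_group_add) graded_space"
  assumes F: "graded_seminormed_space F" and a: "koethe_matrix a" and b: "koethe_matrix b"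
    and S: "mono S"
    and est: "\<And>\<phi>. mono \<phi> \<Longrightarrow> \<exists>k0. \<forall>k\<ge>k0. uniform_estimate F a b S \<phi> k"
  shows "tame_factorization (koethe_l1 a :: ('k, nat \<Rightarrow> 'k) graded_space) (koethe_l1 b) F" (is ?l1)
    and "tame_factorization (koethe_c0 a :: ('k, nat \<Rightarrow> 'k) graded_space) (koethe_l1 b) F" (is ?c0)
proof -
  let ?G = "koethe_l1 b :: ('k, nat \<Rightarrow> 'k) graded_space"
  \<comment> \<open>The two domains differ only in \<open>bound\<close>, the passage from finite
    sums of coordinate vectors to all of \<open>E\<close>.\<close>
  have tame: "tame_factorization E ?G F"
    if E: "koethe_sequence_space E a"
      and bound: "\<And>T k M. T \<in> continuous_operators E F \<Longrightarrow> 0 \<le> M \<Longrightarrow>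
        (\<And>I (x :: nat \<Rightarrow> 'k). finite I \<Longrightarrow>
          (\<And>r y. (\<And>i. i \<in> I \<Longrightarrow> norm (y i) * a i r \<le> 1) \<Longrightarrow>
            gseminorm E r (\<Sum>i\<in>I. coordinate_vector i (y i)) \<le> 1) \<Longrightarrow>
          (\<And>i. i \<in> I \<Longrightarrow> norm (x i) * a i (S k) \<le> 1) \<Longrightarrow>
          gseminorm F k (T (\<Sum>i\<in>I. coordinate_vector i (x i))) \<le> M) \<Longrightarrow>
        \<forall>x\<in>gcarrier E. gseminorm F k (T x) \<le> M * gseminorm E (S k) x"
    for E :: "('k, nat \<Rightarrow> 'k) graded_space"
  proof -
    interpret E: koethe_sequence_space E a by fact
    have G: "graded_seminormed_space ?G" by (rule graded_seminormed_space_koethe_l1[OF b])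
    have "\<exists>k0. \<forall>k\<ge>k0. continuity_characteristic E F T k \<le> enat (S k)"
      if T_factorable: "T \<in> factorable_operators E ?G F" for T
    proof -
      obtain Q R where T: "T \<in> continuous_operators E F"
        and Q: "Q \<in> continuous_operators E ?G" and R: "R \<in> continuous_operators ?G F"
        and TRQ: "\<And>x. x \<in> gcarrier E \<Longrightarrow> T x = R (Q x)"
        using T_factorable unfolding factorable_operators_def by blast
      obtain \<phi> K where \<phi>: "mono \<phi>" and K: "\<And>q. 0 \<le> K q"
        "\<And>q x. x \<in> gcarrier E \<Longrightarrow> gseminorm ?G q (Q x) \<le> K q * gseminorm E (\<phi> q) x"
        "\<And>q y. y \<in> gcarrier ?G \<Longrightarrow> gseminorm F q (R y) \<le> K q * gseminorm ?G (\<phi> q) y"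
        using common_mono_bound[OF E.graded_seminormed_space_axioms G F Q R] by blast
      obtain k0 where k0: "\<And>k. k0 \<le> k \<Longrightarrow> uniform_estimate F a b S \<phi> k" using est[OF \<phi>] by blast
      have "continuity_characteristic E F T k \<le> enat (S k)" if k: "k0 \<le> k" for k
        unfolding continuity_characteristic_le_iff[OF E.graded_seminormed_space_axioms F T]
      proof -
        obtain M where M: "0 \<le> M" "\<And>I (x :: nat \<Rightarrow> 'k). finite I \<Longrightarrow>
          (\<And>r y. (\<And>i. i \<in> I \<Longrightarrow> norm (y i) * a i r \<le> 1) \<Longrightarrow>
            gseminorm E r (\<Sum>i\<in>I. coordinate_vector i (y i)) \<le> 1) \<Longrightarrow>
          (\<And>i. i \<in> I \<Longrightarrow> norm (x i) * a i (S k) \<le> 1) \<Longrightarrow>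
          gseminorm F k (R (Q (\<Sum>i\<in>I. coordinate_vector i (x i)))) \<le> M"
          using factorized_bound_on_unconditional_sums[OF E b F Q R K k0[OF k]] by blast
        have "(\<Sum>i\<in>I. coordinate_vector i (x i)) \<in> gcarrier E" for I and x :: "nat \<Rightarrow> 'k"
          by (intro E.gcarrier_closed(6) E.coordinate_vector_in)
        then have "\<forall>x\<in>gcarrier E. gseminorm F k (T x) \<le> M * gseminorm E (S k) x"
          using M(2) by (intro bound[OF T M(1)]) (simp add: TRQ)
        then show "\<exists>C. \<forall>x\<in>gcarrier E. gseminorm F k (T x) \<le> C * gseminorm E (S k) x" by blast
      qed
      then show ?thesis by blast
    qed
    then show ?thesis unfolding tame_factorization_def using S by blast
  qed
  show ?l1
  proof (rule tame[OF koethe_sequence_space_l1[OF a]])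
    let ?E = "koethe_l1 a :: ('k, nat \<Rightarrow> 'k) graded_space"
    interpret E: koethe_sequence_space ?E a by (rule koethe_sequence_space_l1[OF a])
    fix T k M
    assume T: "T \<in> continuous_operators ?E F" and M0: "0 \<le> M"
      and M: "\<And>I (x :: nat \<Rightarrow> 'k). finite I \<Longrightarrow>
          (\<And>r y. (\<And>i. i \<in> I \<Longrightarrow> norm (y i) * a i r \<le> 1) \<Longrightarrow>
            gseminorm ?E r (\<Sum>i\<in>I. coordinate_vector i (y i)) \<le> 1) \<Longrightarrow>
          (\<And>i. i \<in> I \<Longrightarrow> norm (x i) * a i (S k) \<le> 1) \<Longrightarrow>
          gseminorm F k (T (\<Sum>i\<in>I. coordinate_vector i (x i))) \<le> M"
    have "gseminorm F k (T (coordinate_vector i c)) \<le> M" if "norm c * a i (S k) \<le> 1" for i c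
      using M[of "{i}" "\<lambda>_. c"] that by (simp add: E.gseminorm_coordinate_vector)
    then show "\<forall>x\<in>gcarrier ?E. gseminorm F k (T x) \<le> M * gseminorm ?E (S k) x"
      by (intro ballI koethe_l1_bound_from_units[OF a F T M0])
  qed
  show ?c0
  proof (rule tame[OF koethe_sequence_space_c0[OF a]])
    let ?E = "koethe_c0 a :: ('k, nat \<Rightarrow> 'k) graded_space"
    fix T k M
    assume T: "T \<in> continuous_operators ?E F"
      and M: "\<And>I (x :: nat \<Rightarrow> 'k). finite I \<Longrightarrow>
          (\<And>r y. (\<And>i. i \<in> I \<Longrightarrow> norm (y i) * a i r \<le> 1) \<Longrightarrow>
            gseminorm ?E r (\<Sum>i\<in>I. coordinate_vector i (y i)) \<le> 1) \<Longrightarrow>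
          (\<And>i. i \<in> I \<Longrightarrow> norm (x i) * a i (S k) \<le> 1) \<Longrightarrow>
          gseminorm F k (T (\<Sum>i\<in>I. coordinate_vector i (x i))) \<le> M"
    have uncond: "gseminorm ?E r (\<Sum>i\<in>I. coordinate_vector i (y i)) \<le> 1"
      if "finite I" "\<And>i. i \<in> I \<Longrightarrow> norm (y i) * a i r \<le> 1" for I r and y :: "nat \<Rightarrow> 'k"
      using that by (intro gseminorm_koethe_c0_le) (auto simp: sum_coordinate_vectors)
    show "\<forall>x\<in>gcarrier ?E. gseminorm F k (T x) \<le> M * gseminorm ?E (S k) x"
      by (intro ballI koethe_c0_bound_from_sums[OF a F T] M uncond)
  qed
qed

section \<open>Series in Frechet spaces\<close>

lemma graded_frechet_imp_seminormed:
  assumes "graded_frechet_space E"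
  shows "graded_seminormed_space E"
proof -
  interpret graded_frechet_space E by fact
  show ?thesis
    by (intro graded_seminormed_space.intro graded_seminormed_space_axioms.intro vector_space_axioms
        subspace_gcarrier gseminorm_nonneg gseminorm_scale gseminorm_triangle gseminorm_increasing)
qed

lemma (in graded_seminormed_space) Hausdorff_grading_topology:
  assumes sep: "\<And>x. x \<in> gcarrier E \<Longrightarrow> x \<noteq> 0 \<Longrightarrow> \<exists>k. gseminorm E k x \<noteq> 0"
  shows "Hausdorff_space (grading_topology E)"
  unfolding Hausdorff_space_def topspace_grading_topology
proof (intro allI impI)
  fix x y
  assume xy: "x \<in> gcarrier E \<and> y \<in> gcarrier E \<and> x \<noteq> y"
  then have in_E: "x \<in> gcarrier E" "y \<in> gcarrier E" "x - y \<in> gcarrier E"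
    using gcarrier_closed(3) by blast+
  obtain k where k: "gseminorm E k (x - y) \<noteq> 0" using sep[OF in_E(3)] xy by auto
  define e where "e = gseminorm E k (x - y) / 2"
  have e: "0 < e" using k gseminorm_nonneg[OF in_E(3), of k] by (simp add: e_def)
  let ?B = "\<lambda>x. {y \<in> gcarrier E. gseminorm E k (y - x) < e}"
  have "False" if u: "u \<in> ?B x \<inter> ?B y" for u
  proof -
    have "u - x \<in> gcarrier E" "u - y \<in> gcarrier E" using u in_E gcarrier_closed(3) by blast+
    then have "gseminorm E k ((u - y) - (u - x)) \<le> gseminorm E k (u - y) + gseminorm E k (u - x)"
      by (intro gseminorm_diff_triangle)
    also have "\<dots> < e + e" using u by (intro add_strict_mono) auto
    finally show False by (simp add: e_def)
  qed
  then have "disjnt (?B x) (?B y)" by (auto simp: disjnt_def)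
  moreover have "x \<in> ?B x" "y \<in> ?B y" using in_E e by (simp_all add: gseminorm_zero)
  ultimately show "\<exists>U V. openin (grading_topology E) U \<and> openin (grading_topology E) V \<and>
      x \<in> U \<and> y \<in> V \<and> disjnt U V"
    using openin_gball[OF in_E(1) e] openin_gball[OF in_E(2) e] by blast
qed

text \<open>Each coordinate has a level of positive weight, so the coordinates converge in the
  scalar field. The Cauchy bounds on finite partial sums survive this limit and give both membership
  of \<open>l\<close> and convergence at every level.\<close>

lemma koethe_l1_complete:
  fixes s :: "nat \<Rightarrow> nat \<Rightarrow> 'k::{real_normed_field,banach}"
  assumes a: "koethe_matrix a" and s: "\<And>n. s n \<in> gcarrier (koethe_l1 a)"
    and Cauchy: "\<And>k e. 0 < e \<Longrightarrow>
      \<exists>N. \<forall>m\<ge>N. \<forall>n\<ge>N. gseminorm (koethe_l1 a) k (s m - s n) < e"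
  shows "\<exists>l. limitin (grading_topology (koethe_l1 a)) s l sequentially"
proof -
  let ?E = "koethe_l1 a :: ('k, nat \<Rightarrow> 'k) graded_space"
  interpret E: koethe_sequence_space ?E a by (rule koethe_sequence_space_l1[OF a])
  note a0 = koethe_matrix_nonneg[OF a]
  have "\<exists>l. (\<lambda>n. s n j) \<longlonglongrightarrow> l" for j
  proof -
    obtain k where k: "0 < a j k" using koethe_matrix_pos[OF a] by blast
    have "Cauchy (\<lambda>n. s n j)"
    proof (rule CauchyI)
      fix e :: real assume "0 < e"
      then obtain N where N: "\<And>m n. m \<ge> N \<Longrightarrow> n \<ge> N \<Longrightarrow> gseminorm ?E k (s m - s n) < e * a j k"
        using Cauchy[OF mult_pos_pos[OF _ k], of e k] by blast
      have "norm (s m j - s n j) < e" if "m \<ge> N" "n \<ge> N" for m n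
      proof -
        have "norm (s m j - s n j) * a j k \<le> gseminorm ?E k (s m - s n)"
          using E.coordinate_le[OF E.gcarrier_closed(3)[OF s s]] by simp
        then have "norm (s m j - s n j) * a j k < e * a j k" using N[OF that] by linarith
        then show ?thesis using k by simp
      qed
      then show "\<exists>M. \<forall>m\<ge>M. \<forall>n\<ge>M. norm (s m j - s n j) < e" by blast
    qed
    then show ?thesis using Cauchy_convergent convergent_def by blast
  qed
  then obtain l where l: "\<And>j. (\<lambda>n. s n j) \<longlonglongrightarrow> l j" by metis
  have tail: "\<exists>N. \<forall>m\<ge>N. \<forall>n. (\<Sum>j<n. norm ((s m - l) j) * a j k) \<le> e" if e: "0 < e" for e k
  proof -
    obtain N where N: "\<And>m n. m \<ge> N \<Longrightarrow> n \<ge> N \<Longrightarrow> gseminorm ?E k (s m - s n) < e"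
      using Cauchy[OF e, of k] by blast
    have "(\<Sum>j<n. norm ((s m - l) j) * a j k) \<le> e" if m: "m \<ge> N" for m n
    proof (rule LIMSEQ_le_const2)
      show "(\<lambda>p. \<Sum>j<n. norm (s m j - s p j) * a j k) \<longlonglongrightarrow> (\<Sum>j<n. norm ((s m - l) j) * a j k)"
        unfolding minus_apply by (intro tendsto_intros l)
      have "(\<Sum>j<n. norm (s m j - s p j) * a j k) \<le> e" if "p \<ge> N" for p
        using sum_le_gseminorm_koethe_l1[OF a E.gcarrier_closed(3)[OF s s], of "{..<n}" m p k] N[OF m that]
        by simp
      then show "\<exists>N. \<forall>p\<ge>N. (\<Sum>j<n. norm (s m j - s p j) * a j k) \<le> e" by blast
    qed
    then show ?thesis by blast
  qed
  have sum: "summable (\<lambda>j. norm ((s m - l) j) * a j k)"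
    and le: "gseminorm ?E k (s m - l) \<le> e" if "\<forall>n. (\<Sum>j<n. norm ((s m - l) j) * a j k) \<le> e" for m k e
  proof -
    show *: "summable (\<lambda>j. norm ((s m - l) j) * a j k)"
      using that a0 by (intro summableI_nonneg_bounded[where x = e]) auto
    show "gseminorm ?E k (s m - l) \<le> e"
      unfolding gseminorm_koethe_l1 using that by (intro suminf_le_const[OF *]) simp
  qed
  have "summable (\<lambda>j. norm (l j) * a j k)" for k
  proof -
    obtain N where N: "\<forall>n. (\<Sum>j<n. norm ((s N - l) j) * a j k) \<le> 1"
      using tail[of 1 k] by auto
    show ?thesis
    proof (rule summable_comparison_test)
      show "summable (\<lambda>j. norm (s N j) * a j k + norm ((s N - l) j) * a j k)"
        by (intro summable_add summable_koethe_l1 s sum[OF N])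
      have "norm (l j) * a j k \<le> norm (s N j) * a j k + norm ((s N - l) j) * a j k" for j
        using norm_triangle_ineq4[of "s N j" "(s N - l) j"] a0[of j k]
        by (simp add: distrib_right[symmetric] mult_right_mono)
      then show "\<exists>M. \<forall>n\<ge>M. norm (norm (l n) * a n k) \<le> norm (s N n) * a n k + norm ((s N - l) n) * a n k"
        using a0 by simp
    qed
  qed
  then have l_in: "l \<in> gcarrier ?E" by (simp add: koethe_l1_def)
  have "(\<lambda>n. gseminorm ?E k (s n - l)) \<longlonglongrightarrow> 0" for k
  proof (rule LIMSEQ_I)
    fix e :: real assume e: "0 < e"
    then obtain N where N: "\<forall>m\<ge>N. \<forall>n. (\<Sum>j<n. norm ((s m - l) j) * a j k) \<le> e / 2"
      using tail[of "e / 2" k] by auto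
    have "norm (gseminorm ?E k (s m - l) - 0) < e" if "m \<ge> N" for m
      using le[of m k "e / 2"] N that e E.gseminorm_nonneg[OF E.gcarrier_closed(3)[OF s l_in], of k m]
      by simp
    then show "\<exists>N. \<forall>m\<ge>N. norm (gseminorm ?E k (s m - l) - 0) < e" by blast
  qed
  then show ?thesis using l_in by (auto simp: E.limitin_grading_topology[OF s])
qed

text \<open>Completeness is wanted for the middle space, where the series of rank one operators
  defining the first factor has to converge.\<close>

lemma graded_frechet_space_koethe_l1:
  assumes a: "koethe_matrix a"
  shows "graded_frechet_space (koethe_l1 a :: ('k::{real_normed_field,banach}, nat \<Rightarrow> 'k) graded_space)"
proof -
  let ?E = "koethe_l1 a :: ('k, nat \<Rightarrow> 'k) graded_space"
  interpret E: koethe_sequence_space ?E a by (rule koethe_sequence_space_l1[OF a])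
  have "\<exists>k. gseminorm ?E k x \<noteq> 0" if x: "x \<in> gcarrier ?E" "x \<noteq> 0" for x
  proof -
    obtain j where "x j \<noteq> 0" using x by (auto simp: fun_eq_iff)
    moreover obtain k where k: "0 < a j k" using koethe_matrix_pos[OF a] by blast
    ultimately have "0 < norm (x j) * a j k" by simp
    then show ?thesis using E.coordinate_le[OF x(1), of j k] by (intro exI[of _ k]) linarith
  qed
  then have Hausdorff: "Hausdorff_space (grading_topology ?E)" by (rule E.Hausdorff_grading_topology)
  show ?thesis
  proof (intro graded_frechet_space.intro graded_frechet_space_axioms.intro)
    fix s :: "nat \<Rightarrow> nat \<Rightarrow> 'k"
    assume "\<And>n. s n \<in> gcarrier ?E"
      and "\<And>k e. 0 < e \<Longrightarrow> \<exists>N. \<forall>m\<ge>N. \<forall>n\<ge>N. gseminorm ?E k (s m - s n) < e"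
    then show "\<exists>l. limitin (grading_topology ?E) s l sequentially" by (rule koethe_l1_complete[OF a])
  qed (rule E.vector_space_axioms E.subspace_gcarrier Hausdorff |
      (rule E.gseminorm_nonneg E.gseminorm_scale E.gseminorm_triangle E.gseminorm_increasing; assumption))+
qed

section \<open>Convergent series and rapidly decreasing sums of rank one operators\<close>

definition gsums :: "('k, 'f::ab_group_add) graded_space \<Rightarrow> (nat \<Rightarrow> 'f) \<Rightarrow> 'f \<Rightarrow> bool" where
  "gsums F f l \<longleftrightarrow> l \<in> gcarrier F \<and> (\<forall>k. (\<lambda>n. gseminorm F k ((\<Sum>m<n. f m) - l)) \<longlonglongrightarrow> 0)"

context
  fixes F :: "('k::{real_normed_field,banach}, 'f::ab_group_add) graded_space"
  assumes F: "graded_frechet_space F"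
begin

interpretation F: graded_seminormed_space F by (rule graded_frechet_imp_seminormed[OF F])

lemma gsums_imp_limitin:
  assumes "\<And>m. f m \<in> gcarrier F"
  shows "gsums F f l \<longleftrightarrow> limitin (grading_topology F) (\<lambda>n. \<Sum>m<n. f m) l sequentially"
  unfolding gsums_def
  by (rule F.limitin_grading_topology[symmetric]) (intro F.gcarrier_closed(6) assms)

lemma gsums_unique:
  assumes "\<And>m. f m \<in> gcarrier F" "gsums F f l" "gsums F f l'"
  shows "l = l'"
  using assms(2,3) unfolding gsums_imp_limitin[OF assms(1)]
  by (rule limitin_Hausdorff_unique[OF _ _ trivial_limit_sequentially graded_frechet_space.Hausdorff[OF F]])

text \<open>Absolute convergence in each seminorm makes the partial sums Cauchy, and
  \<open>F\<close> is complete.\<close>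

lemma gsums_exists:
  assumes f: "\<And>m. f m \<in> gcarrier F" and sum: "\<And>k. summable (\<lambda>m. gseminorm F k (f m))"
  shows "\<exists>l. gsums F f l"
  unfolding gsums_imp_limitin[OF f]
proof (rule graded_frechet_space.complete[OF F])
  show part: "(\<Sum>m<n. f m) \<in> gcarrier F" for n by (intro F.gcarrier_closed(6) f)
  fix k and e :: real assume e: "0 < e"
  obtain N where N: "\<And>m n. m \<ge> N \<Longrightarrow> norm (\<Sum>p\<in>{m..<n}. gseminorm F k (f p)) < e"
    using sum[of k] e unfolding summable_Cauchy by blast
  have le: "gseminorm F k ((\<Sum>p<n. f p) - (\<Sum>p<m. f p)) < e" if "m \<ge> N" "m \<le> n" for m n
  proof -
    have "(\<Sum>p<n. f p) - (\<Sum>p<m. f p) = (\<Sum>p\<in>{m..<n}. f p)"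
      using that by (simp add: lessThan_atLeast0 sum_diff_nat_ivl)
    then have "gseminorm F k ((\<Sum>p<n. f p) - (\<Sum>p<m. f p)) \<le> (\<Sum>p\<in>{m..<n}. gseminorm F k (f p))"
      by (simp add: F.gseminorm_sum f)
    then show ?thesis using N[OF that(1), of n] by simp
  qed
  have "gseminorm F k ((\<Sum>p<n. f p) - (\<Sum>p<m. f p)) < e" if "m \<ge> N" "n \<ge> N" for m n
  proof (cases "m \<le> n")
    case False
    then show ?thesis using le[of n m] that F.gseminorm_minus_commute[OF part[of n] part[of m], of k] by simp
  qed (rule le[OF that(1)])
  then show "\<exists>N. \<forall>n\<ge>N. \<forall>m\<ge>N. gseminorm F k ((\<Sum>p<n. f p) - (\<Sum>p<m. f p)) < e" by blast
qed

lemma gsums_gseminorm_le: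
  assumes f: "\<And>m. f m \<in> gcarrier F" and l: "gsums F f l"
    and B: "\<And>n. (\<Sum>m<n. gseminorm F k (f m)) \<le> B"
  shows "gseminorm F k l \<le> B"
proof (rule LIMSEQ_le_const)
  show "(\<lambda>n. B + gseminorm F k ((\<Sum>m<n. f m) - l)) \<longlonglongrightarrow> B"
    using tendsto_add[OF tendsto_const[of B], of "\<lambda>n. gseminorm F k ((\<Sum>m<n. f m) - l)" 0] l
    by (simp add: gsums_def)
  have "gseminorm F k l \<le> B + gseminorm F k ((\<Sum>m<n. f m) - l)" for n
  proof -
    have part: "(\<Sum>m<n. f m) \<in> gcarrier F" by (intro F.gcarrier_closed(6) f)
    have l_in: "l \<in> gcarrier F" using l by (simp add: gsums_def)
    have "gseminorm F k (\<Sum>m<n. f m) \<le> B"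
      using F.gseminorm_sum[of "{..<n}" f k] f B[of n] by simp
    then show ?thesis
      using F.gseminorm_le_add_diff[OF l_in part, of k] F.gseminorm_minus_commute[OF l_in part, of k]
      by simp
  qed
  then show "\<exists>N. \<forall>n\<ge>N. gseminorm F k l \<le> B + gseminorm F k ((\<Sum>m<n. f m) - l)" by blast
qed

lemma gsums_add:
  assumes f: "\<And>m. f m \<in> gcarrier F" "\<And>m. g m \<in> gcarrier F" and l: "gsums F f l" "gsums F g l'"
  shows "gsums F (\<lambda>m. f m + g m) (l + l')"
  unfolding gsums_def
proof (intro conjI allI)
  have l_in: "l \<in> gcarrier F" "l' \<in> gcarrier F" using l by (simp_all add: gsums_def)
  then show "l + l' \<in> gcarrier F" by (rule F.gcarrier_closed(2))
  fix k
  have in_F: "(\<Sum>m<n. f m) - l \<in> gcarrier F" "(\<Sum>m<n. g m) - l' \<in> gcarrier F" for n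
    by (intro F.gcarrier_closed(3) F.gcarrier_closed(6) f l_in)+
  have eq: "(\<Sum>m<n. f m + g m) - (l + l') = ((\<Sum>m<n. f m) - l) + ((\<Sum>m<n. g m) - l')" for n
    by (simp add: sum.distrib)
  show "(\<lambda>n. gseminorm F k ((\<Sum>m<n. f m + g m) - (l + l'))) \<longlonglongrightarrow> 0"
    unfolding eq
  proof (rule tendsto_sandwich[where f = "\<lambda>_. 0"])
    show "(\<lambda>n. gseminorm F k ((\<Sum>m<n. f m) - l) + gseminorm F k ((\<Sum>m<n. g m) - l')) \<longlonglongrightarrow> 0"
      using tendsto_add[of "\<lambda>n. gseminorm F k ((\<Sum>m<n. f m) - l)" 0 sequentially
          "\<lambda>n. gseminorm F k ((\<Sum>m<n. g m) - l')" 0] l by (simp add: gsums_def)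
  qed (intro tendsto_const always_eventually allI F.gseminorm_triangle in_F F.gseminorm_nonneg
      F.gcarrier_closed(2))+
qed

lemma gsums_scale:
  assumes f: "\<And>m. f m \<in> gcarrier F" and l: "gsums F f l"
  shows "gsums F (\<lambda>m. gscale F c (f m)) (gscale F c l)"
  unfolding gsums_def
proof (intro conjI allI)
  have l_in: "l \<in> gcarrier F" using l by (simp add: gsums_def)
  then show "gscale F c l \<in> gcarrier F" by (rule F.gcarrier_closed(5))
  fix k
  have "(\<Sum>m<n. gscale F c (f m)) - gscale F c l = gscale F c ((\<Sum>m<n. f m) - l)" for n
    by (simp add: F.scale_right_diff_distrib F.scale_sum_right)
  moreover have "(\<Sum>m<n. f m) - l \<in> gcarrier F" for n
    by (intro F.gcarrier_closed(3) F.gcarrier_closed(6) f l_in)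
  ultimately have eq: "gseminorm F k ((\<Sum>m<n. gscale F c (f m)) - gscale F c l)
      = norm c * gseminorm F k ((\<Sum>m<n. f m) - l)" for n
    by (simp add: F.gseminorm_scale)
  show "(\<lambda>n. gseminorm F k ((\<Sum>m<n. gscale F c (f m)) - gscale F c l)) \<longlonglongrightarrow> 0"
    unfolding eq using tendsto_mult_left[of "\<lambda>n. gseminorm F k ((\<Sum>m<n. f m) - l)" 0 sequentially "norm c"] l
    by (simp add: gsums_def)
qed

lemma gsums_finite:
  assumes f: "\<And>m. f m \<in> gcarrier F" and z: "\<And>m. m \<ge> n \<Longrightarrow> f m = 0"
  shows "gsums F f (\<Sum>m<n. f m)"
  unfolding gsums_def
proof (intro conjI allI)
  show "(\<Sum>m<n. f m) \<in> gcarrier F" by (intro F.gcarrier_closed(6) f)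
  fix k
  show "(\<lambda>p. gseminorm F k ((\<Sum>m<p. f m) - (\<Sum>m<n. f m))) \<longlonglongrightarrow> 0"
  proof (intro tendsto_eventually eventually_sequentiallyI)
    fix p assume "n \<le> p"
    then have "(\<Sum>m<p. f m) - (\<Sum>m<n. f m) = 0"
      unfolding right_minus_eq using z by (intro sum.mono_neutral_right) auto
    then show "gseminorm F k ((\<Sum>m<p. f m) - (\<Sum>m<n. f m)) = 0" by (simp only: F.gseminorm_zero)
  qed
qed

end

text \<open>The rank one operators send \<open>x\<close> to \<open>x (i l)\<close> times
  \<open>v l\<close>. The factor \<open>(1/2) ^ l\<close> in \<open>decay\<close> makes their sum
  with any coefficients bounded by 1 converge to an operator continuous from level
  \<open>\<rho> r\<close> to level \<open>r\<close>. The locale is used for both factors.\<close>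

locale rapid_series = E: koethe_sequence_space E a
  for E :: "('k::{real_normed_field,banach}, nat \<Rightarrow> 'k) graded_space" and a +
  fixes F :: "('k, 'f::ab_group_add) graded_space"
    and i :: "nat \<Rightarrow> nat" and v :: "nat \<Rightarrow> 'f" and D :: "nat \<Rightarrow> real" and \<rho> :: "nat \<Rightarrow> nat"
  assumes F: "graded_frechet_space F"
    and v: "v l \<in> gcarrier F"
    and D: "0 \<le> D r"
    and decay: "gseminorm F r (v l) \<le> (1/2) ^ l * D r * a (i l) (\<rho> r)"
begin

sublocale F: graded_seminormed_space F by (rule graded_frechet_imp_seminormed[OF F])

definition summand :: "(nat \<Rightarrow> 'k) \<Rightarrow> (nat \<Rightarrow> 'k) \<Rightarrow> nat \<Rightarrow> 'f" where
  "summand s x l = gscale F (s l * x (i l)) (v l)"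

text \<open>Meaningful only for bounded coefficients and \<open>x\<close> in the carrier; otherwise the value of
  \<open>SOME\<close> is arbitrary.\<close>

definition series :: "(nat \<Rightarrow> 'k) \<Rightarrow> (nat \<Rightarrow> 'k) \<Rightarrow> 'f" where
  "series s x = (SOME y. gsums F (summand s x) y)"

lemma summand_in: "summand s x l \<in> gcarrier F"
  unfolding summand_def by (intro F.gcarrier_closed(5) v)

lemma summand_le:
  assumes s: "norm (s l) \<le> 1" and x: "x \<in> gcarrier E"
  shows "gseminorm F r (summand s x l) \<le> (1/2) ^ l * (D r * gseminorm E (\<rho> r) x)"
proof -
  have "gseminorm F r (summand s x l) = norm (s l) * (norm (x (i l)) * gseminorm F r (v l))"
    by (simp add: summand_def F.gseminorm_scale[OF v] norm_mult mult.assoc)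
  also have "\<dots> \<le> 1 * (norm (x (i l)) * ((1/2) ^ l * D r * a (i l) (\<rho> r)))"
    using F.gseminorm_nonneg[OF v] by (intro mult_mono s decay mult_nonneg_nonneg) auto
  also have "\<dots> = (1/2) ^ l * D r * (norm (x (i l)) * a (i l) (\<rho> r))"
    by (simp add: mult_ac)
  also have "\<dots> \<le> (1/2) ^ l * D r * gseminorm E (\<rho> r) x"
    by (intro mult_left_mono E.coordinate_le x mult_nonneg_nonneg D) auto
  finally show ?thesis by (simp add: mult.assoc)
qed

lemma gsums_series:
  assumes s: "\<And>l. norm (s l) \<le> 1" and x: "x \<in> gcarrier E"
  shows "gsums F (summand s x) (series s x)"
proof -
  have "summable (\<lambda>l. gseminorm F r (summand s x l))" for r
  proof (rule summable_comparison_test)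
    show "summable (\<lambda>l. (1/2) ^ l * (D r * gseminorm E (\<rho> r) x))"
      by (intro summable_mult2 summable_geometric) simp
    show "\<exists>N. \<forall>l\<ge>N. norm (gseminorm F r (summand s x l)) \<le> (1/2) ^ l * (D r * gseminorm E (\<rho> r) x)"
      using summand_le[OF s x] F.gseminorm_nonneg[OF summand_in] by auto
  qed
  then have "\<exists>y. gsums F (summand s x) y" by (intro gsums_exists[OF F] summand_in)
  then show ?thesis unfolding series_def by (rule someI_ex)
qed

lemma series_in: "(\<And>l. norm (s l) \<le> 1) \<Longrightarrow> x \<in> gcarrier E \<Longrightarrow> series s x \<in> gcarrier F"
  using gsums_series by (simp add: gsums_def)

lemma series_eqI:
  "(\<And>l. norm (s l) \<le> 1) \<Longrightarrow> x \<in> gcarrier E \<Longrightarrow> gsums F (summand s x) y \<Longrightarrow> series s x = y"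
  using gsums_unique[OF F summand_in gsums_series] by blast

text \<open>A geometric tail. With \<open>n = 0\<close> it gives continuity of the series in
  \<open>x\<close>; with large \<open>n\<close> it gives continuity in the coefficients.\<close>

lemma series_tail_le:
  assumes s: "\<And>l. norm (s l) \<le> 1" and z: "\<And>l. l < n \<Longrightarrow> s l = 0" and x: "x \<in> gcarrier E"
  shows "gseminorm F r (series s x) \<le> (1/2) ^ n * (2 * D r * gseminorm E (\<rho> r) x)"
proof (rule gsums_gseminorm_le[OF F summand_in gsums_series[OF s x]])
  fix N
  let ?c = "D r * gseminorm E (\<rho> r) x"
  have c: "0 \<le> ?c" by (intro mult_nonneg_nonneg D E.gseminorm_nonneg x)
  have "(\<Sum>l<N. gseminorm F r (summand s x l)) = (\<Sum>l\<in>{n..<N}. gseminorm F r (summand s x l))"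
    by (rule sum.mono_neutral_right) (auto simp: summand_def z F.gseminorm_zero not_le)
  also have "\<dots> \<le> (\<Sum>l\<in>{n..<N}. (1/2) ^ l * ?c)"
    by (intro sum_mono summand_le s x)
  also have "\<dots> = (\<Sum>l\<in>{n..<N}. (1/2) ^ l) * ?c" by (simp add: sum_distrib_right)
  also have "\<dots> \<le> (2 * (1/2) ^ n) * ?c"
  proof (rule mult_right_mono[OF _ c])
    \<comment> \<open>The subtracted term is what lets the induction close; it is dropped
      afterwards.\<close>
    have "(\<Sum>l\<in>{n..<N}. (1/2::real) ^ l) \<le> 2 * (1/2) ^ n - 2 * (1/2) ^ N" if "n \<le> N"
      using that by (induction N rule: dec_induct) auto
    then show "(\<Sum>l\<in>{n..<N}. (1/2::real) ^ l) \<le> 2 * (1/2) ^ n"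
      by (cases "n \<le> N") (auto intro: order_trans)
  qed
  finally show "(\<Sum>l<N. gseminorm F r (summand s x l)) \<le> (1/2) ^ n * (2 * D r * gseminorm E (\<rho> r) x)"
    by (simp add: mult_ac)
qed

lemma series_add:
  assumes s: "\<And>l. norm (s l) \<le> 1" and x: "x \<in> gcarrier E" "y \<in> gcarrier E"
  shows "series s (x + y) = series s x + series s y"
proof (rule series_eqI[OF s E.gcarrier_closed(2)[OF x]])
  have "summand s (x + y) = (\<lambda>l. summand s x l + summand s y l)"
    by (auto simp: summand_def distrib_left F.scale_left_distrib)
  then show "gsums F (summand s (x + y)) (series s x + series s y)"
    using gsums_add[OF F summand_in summand_in gsums_series[OF s x(1)] gsums_series[OF s x(2)]] by simp
qed

lemma series_scale:
  assumes s: "\<And>l. norm (s l) \<le> 1" and x: "x \<in> gcarrier E"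
  shows "series s (gscale E c x) = gscale F c (series s x)"
proof (rule series_eqI[OF s E.gcarrier_closed(5)[OF x]])
  have "summand s (gscale E c x) = (\<lambda>l. gscale F c (summand s x l))"
    by (auto simp: summand_def E.gscale_eq mult_ac)
  then show "gsums F (summand s (gscale E c x)) (gscale F c (series s x))"
    using gsums_scale[OF F summand_in gsums_series[OF s x]] by simp
qed

lemma series_add_coefficients:
  assumes s: "\<And>l. norm (s l) \<le> 1" "\<And>l. norm (t l) \<le> 1" "\<And>l. norm (s l + t l) \<le> 1"
    and x: "x \<in> gcarrier E"
  shows "series (\<lambda>l. s l + t l) x = series s x + series t x"
proof (rule series_eqI[OF s(3) x])
  have "summand (\<lambda>l. s l + t l) x = (\<lambda>l. summand s x l + summand t x l)"
    by (auto simp: summand_def distrib_right F.scale_left_distrib)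
  then show "gsums F (summand (\<lambda>l. s l + t l) x) (series s x + series t x)"
    using gsums_add[OF F summand_in summand_in gsums_series[OF s(1) x] gsums_series[OF s(2) x]] by simp
qed

lemma series_unit:
  assumes x: "x \<in> gcarrier E"
  shows "series (\<lambda>l. if l = n then 1 else 0) x = gscale F (x (i n)) (v n)" (is "series ?s x = _")
proof (rule series_eqI[OF _ x])
  have "gsums F (summand ?s x) (\<Sum>l<Suc n. summand ?s x l)"
    by (rule gsums_finite[OF F summand_in]) (simp add: summand_def)
  moreover have "(\<Sum>l<Suc n. summand ?s x l) = gscale F (x (i n)) (v n)"
    by (subst sum.mono_neutral_right[of _ "{n}"]) (auto simp: summand_def)
  ultimately show "gsums F (summand ?s x) (gscale F (x (i n)) (v n))" by (simp only:)
qed simp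

lemma series_continuous:
  assumes s: "\<And>l. norm (s l) \<le> 1"
  shows "series s \<in> continuous_operators E F"
  unfolding continuous_operators_iff[OF E.graded_seminormed_space_axioms F.graded_seminormed_space_axioms]
proof (intro conjI ballI allI)
  show "series s ` gcarrier E \<subseteq> gcarrier F" using series_in[of s] s by blast
  show "\<exists>r C. \<forall>x\<in>gcarrier E. gseminorm F k (series s x) \<le> C * gseminorm E r x" for k
    using series_tail_le[of s 0, OF s]
    by (intro exI[of _ "\<rho> k"] exI[of _ "2 * D k"]) simp
qed (simp_all add: series_add[OF s] series_scale[OF s])

end

section \<open>Baire category for sequences\<close>

text \<open>The Baire theorem for sequences with discrete entries: each \<open>P m\<close> contains
  a dense open set. Finite prefixes are extended successively, the \<open>m\<close>-th extension
  forcing \<open>P m\<close>, and the common limit satisfies all of them.\<close>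

lemma baire_sequences:
  fixes P :: "nat \<Rightarrow> (nat \<Rightarrow> 'b) \<Rightarrow> bool"
  assumes dense: "\<And>m s n. \<exists>s' n'. (\<forall>l<n. s' l = s l) \<and> (\<forall>s''. (\<forall>l<n'. s'' l = s' l) \<longrightarrow> P m s'')"
  shows "\<exists>s. \<forall>m. P m s"
proof -
  define good where "good m = (\<lambda>(s, n) (s', n'). n < n' \<and> (\<forall>l<n. s' l = s l) \<and>
    (\<forall>s''. (\<forall>l<n'. s'' l = s' l) \<longrightarrow> P m s''))" for m :: nat and n n' :: nat and s s' :: "nat \<Rightarrow> 'b"
  have "\<exists>q. good m p q" for m p
  proof -
    obtain s n where p: "p = (s, n)" by fastforce
    obtain s' n' where "\<forall>l<n. s' l = s l" "\<forall>s''. (\<forall>l<n'. s'' l = s' l) \<longrightarrow> P m s''"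
      using dense[where m = m and s = s and n = n] by blast
    then have "good m p (s', max n' (Suc n))" by (auto simp: good_def p)
    then show ?thesis by blast
  qed
  then obtain f where f: "\<And>m. good m (f m) (f (Suc m))"
    using dependent_nat_choice[of "\<lambda>_ _. True" good] by auto
  define s n where "s m = fst (f m)" and "n m = snd (f m)" for m
  have n: "n m < n (Suc m)" and s: "\<And>l. l < n m \<Longrightarrow> s (Suc m) l = s m l"
    and P: "\<And>s''. (\<And>l. l < n (Suc m) \<Longrightarrow> s'' l = s (Suc m) l) \<Longrightarrow> P m s''" for m
    using f[of m] unfolding good_def s_def n_def by (auto simp: case_prod_unfold)
  have nm: "m \<le> n m" for m
    using n by (induction m) (auto intro: Suc_leI order_le_less_trans)
  have n_mono: "n m \<le> n p" if "m \<le> p" for m p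
    using lift_Suc_mono_le[of n m p] n that less_imp_le by blast
  have stable: "s p l = s m l" if "m \<le> p" "l < n m" for m p l
    using that(1)
  proof (induction p rule: dec_induct)
    case (step p)
    then show ?case using s[of l p] n_mono[of m p] that(2) by simp
  qed simp
  \<comment> \<open>Entry \<open>l\<close> is fixed from stage \<open>Suc l\<close> on, since the
    prefix there has length at least \<open>Suc l\<close>.\<close>
  define lim where "lim l = s (Suc l) l" for l
  have lim: "lim l = s m l" if "l < n m" for l m
  proof (cases "Suc l \<le> m")
    case True
    then show ?thesis using stable[of "Suc l" m l] nm[of "Suc l"] by (simp add: lim_def)
  next
    case False
    then show ?thesis using stable[of m "Suc l" l] that by (simp add: lim_def)
  qed
  have "P m lim" for m by (rule P) (rule lim)
  then show ?thesis by blast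
qed

section \<open>From tameness to the estimate\<close>

text \<open>With values 0 and 1 the difference of two coefficient sequences is again bounded by 1,
  hence admissible for \<open>series\<close>.\<close>

definition bits :: "(nat \<Rightarrow> bool) \<Rightarrow> nat \<Rightarrow> 'k::zero_neq_one" where
  "bits \<omega> l = of_bool (\<omega> l)"

lemma norm_bits: "norm (bits \<omega> l :: 'k::real_normed_field) \<le> 1"
  by (simp add: bits_def)

lemma norm_bits_diff: "norm (bits \<omega> l - bits \<omega>' l :: 'k::real_normed_field) \<le> 1"
  by (simp add: bits_def of_bool_def)

context rapid_series
begin

lemma series_bits_diff:
  assumes "x \<in> gcarrier E"
  shows "series (bits \<omega>) x = series (\<lambda>l. bits \<omega> l - bits \<omega>' l) x + series (bits \<omega>') x"
  using series_add_coefficients[of "\<lambda>l. bits \<omega> l - bits \<omega>' l" "bits \<omega>'" x] assms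
  by (simp add: norm_bits norm_bits_diff)

text \<open>The two series differ in a single coefficient, so flipping one bit isolates one rank one
  operator.\<close>

lemma series_bits_flip:
  assumes "x \<in> gcarrier E"
  shows "series (bits (fun_upd \<omega> n True)) x = gscale F (x (i n)) (v n) + series (bits (fun_upd \<omega> n False)) x"
proof -
  have "(\<lambda>l. bits (fun_upd \<omega> n True) l - bits (fun_upd \<omega> n False) l) = (\<lambda>l. if l = n then 1 else 0 :: 'k)"
    by (auto simp: bits_def)
  then show ?thesis
    using series_bits_diff[OF assms, of "fun_upd \<omega> n True" "fun_upd \<omega> n False"] series_unit[OF assms, of n] by simp
qed

lemma series_bits_agree_le:
  assumes "x \<in> gcarrier E" "\<And>l. l < n \<Longrightarrow> \<omega> l = \<omega>' l"
  shows "gseminorm F r (series (\<lambda>l. bits \<omega> l - bits \<omega>' l) x) \<le> (1/2) ^ n * (2 * D r * gseminorm E (\<rho> r) x)"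
  using assms by (intro series_tail_le norm_bits_diff) (auto simp: bits_def)

end

lemma composition_in_factorable_operators:
  assumes E: "graded_seminormed_space E" and G: "graded_seminormed_space G" and F: "graded_seminormed_space F"
    and Q: "Q \<in> continuous_operators E G" and R: "R \<in> continuous_operators G F"
  shows "(\<lambda>x. R (Q x)) \<in> factorable_operators E G F"
proof -
  note Q' = Q[unfolded continuous_operators_def, simplified]
  note R' = R[unfolded continuous_operators_def, simplified]
  have "continuous_map (grading_topology E) (grading_topology F) (R \<circ> Q)"
    using Q' R' by (intro continuous_map_compose) auto
  then have "(\<lambda>x. R (Q x)) \<in> continuous_operators E F"
    unfolding continuous_operators_def using Q' R' by (auto simp: o_def image_subset_iff)
  then show ?thesis unfolding factorable_operators_def using Q R by blast
qed

text \<open>Level \<open>r\<close> is controlled by \<open>\<phi> r\<close> only for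
  \<open>l \<ge> r\<close>. The finitely many earlier terms are absorbed by raising the level until
  their weights \<open>a (i l)\<close> are positive and by enlarging the constant.\<close>

lemma rapid_decay_parameters:
  fixes c :: "nat \<Rightarrow> nat \<Rightarrow> real"
  assumes a: "koethe_matrix a" and c0: "\<And>l r. 0 \<le> c l r"
    and c: "\<And>l r. r \<le> l \<Longrightarrow> c l r \<le> (1/2) ^ l * a (i l) (\<phi> r)"
  obtains D \<rho> where "\<And>r. 0 \<le> D r" "\<And>l r. c l r \<le> (1/2) ^ l * D r * a (i l) (\<rho> r)"
proof -
  note a0 = koethe_matrix_nonneg[OF a]
  have "\<forall>l. \<exists>k. 0 < a (i l) k" using koethe_matrix_pos[OF a] by blast
  then obtain h where h: "\<And>l. 0 < a (i l) (h l)" by metis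
  define \<rho> where "\<rho> r = \<phi> r + (\<Sum>l<r. h l)" for r
  define D where "D r = 1 + (\<Sum>l<r. c l r * 2 ^ l / a (i l) (\<rho> r))" for r
  have D1: "1 \<le> D r" for r
    unfolding D_def using a0 c0 by (simp add: sum_nonneg)
  have "c l r \<le> (1/2) ^ l * D r * a (i l) (\<rho> r)" for l r
  proof (cases "r \<le> l")
    case True
    have "c l r \<le> (1/2) ^ l * 1 * a (i l) (\<phi> r)" using c[OF True] by simp
    also have "\<dots> \<le> (1/2) ^ l * D r * a (i l) (\<rho> r)"
      using D1[of r] a0 koethe_matrix_mono[OF a, of "\<phi> r" "\<rho> r"]
      by (intro mult_mono) (auto simp: \<rho>_def)
    finally show ?thesis .
  next
    case False
    have "h l \<le> (\<Sum>l<r. h l)" using False by (intro member_le_sum) auto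
    then have "h l \<le> \<rho> r" by (simp add: \<rho>_def)
    then have pos: "0 < a (i l) (\<rho> r)" using h koethe_matrix_mono[OF a] by (meson less_le_trans)
    have "c l r * 2 ^ l / a (i l) (\<rho> r) \<le> (\<Sum>l<r. c l r * 2 ^ l / a (i l) (\<rho> r))"
      using False a0 c0 by (intro member_le_sum) auto
    then have "c l r * 2 ^ l / a (i l) (\<rho> r) \<le> D r" by (simp add: D_def)
    then show ?thesis using pos by (simp add: field_simps power_divide)
  qed
  then show ?thesis using that[of D \<rho>] D1 by (meson order_trans zero_le_one)
qed

text \<open>The maxima in the estimate may vanish; making them positive allows division by them.\<close>

lemma enlarge_factors:
  fixes \<beta> \<gamma> C t :: real
  assumes "0 \<le> \<beta>" "0 \<le> \<gamma>" "0 < C" "C * \<beta> * \<gamma> < t"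
  obtains \<beta>' \<gamma>' where "\<beta> \<le> \<beta>'" "\<gamma> \<le> \<gamma>'" "0 < \<beta>'" "0 < \<gamma>'" "C * \<beta>' * \<gamma>' \<le> t"
proof (cases "\<beta> = 0")
  case True
  \<comment> \<open>Here \<open>t\<close> is positive. A small positive first factor is balanced
    against \<open>\<gamma> + 1\<close>, which is positive even if \<open>\<gamma>\<close>
    vanishes.\<close>
  show ?thesis
  proof (rule that[of "t / (C * (\<gamma> + 1))" "\<gamma> + 1"])
    show "C * (t / (C * (\<gamma> + 1))) * (\<gamma> + 1) \<le> t" using assms by simp
  qed (use assms True in auto)
next
  case False
  show ?thesis
  proof (rule that[of \<beta> "t / (C * \<beta>)"])
    show "\<gamma> \<le> t / (C * \<beta>)" using assms False by (simp add: pos_le_divide_eq mult_ac)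
    have "0 \<le> C * \<beta> * \<gamma>" using assms by simp
    then have "0 < t" using assms by linarith
    then show "0 < t / (C * \<beta>)" using assms False by simp
  qed (use assms False in auto)
qed

text \<open>A finite maximum excludes a vanishing denominator under a nonzero numerator, so it can
  be used as a real multiplier; ratios 0/0 cause no harm.\<close>

lemma finite_max_of_ratios:
  assumes fin: "(MAX q\<in>{..n::nat}. ennreal (\<beta> q) / ennreal (\<alpha> q)) \<noteq> \<infinity>"
    and nonneg: "\<And>q. 0 \<le> \<alpha> q" "\<And>q. 0 \<le> \<beta> q"
  obtains m where "0 \<le> m" "(MAX q\<in>{..n}. ennreal (\<beta> q) / ennreal (\<alpha> q)) = ennreal m"
    "\<And>q. q \<le> n \<Longrightarrow> \<beta> q \<le> m * \<alpha> q"
proof -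
  obtain m where m: "0 \<le> m" "(MAX q\<in>{..n}. ennreal (\<beta> q) / ennreal (\<alpha> q)) = ennreal m"
    using fin by (cases "MAX q\<in>{..n}. ennreal (\<beta> q) / ennreal (\<alpha> q)") auto
  have "\<beta> q \<le> m * \<alpha> q" if "q \<le> n" for q
  proof -
    have "ennreal (\<beta> q) / ennreal (\<alpha> q) \<le> (MAX q\<in>{..n}. ennreal (\<beta> q) / ennreal (\<alpha> q))"
      using that by (intro Max_ge) auto
    then have le: "ennreal (\<beta> q) / ennreal (\<alpha> q) \<le> ennreal m" by (simp only: m(2))
    show ?thesis
    proof (cases "\<beta> q = 0")
      case True
      then show ?thesis using m nonneg by simp
    next
      case False
      then have "\<alpha> q \<noteq> 0"
        using le nonneg(2)[of q] by (auto simp: ennreal_divide_zero top_unique)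
      then have "\<beta> q / \<alpha> q \<le> m" "0 < \<alpha> q"
        using le nonneg(1,2)[of q] m(1) by (auto simp: ennreal_divide_ennreal ennreal_le_iff)
      then show ?thesis by (simp add: pos_divide_le_eq)
    qed
  qed
  then show ?thesis using that m by blast
qed

text \<open>Failure for one particular choice of \<open>qk\<close> and \<open>Ck\<close>, rescaled:
  both rank one operators become as small as \<open>(1/2) ^ n\<close> at the levels up to
  \<open>n\<close>, while their product still maps a vector of the unit ball at level
  \<open>S k\<close> to one of size at least \<open>n + 1\<close> at level \<open>k\<close>.\<close>

lemma not_uniform_estimateE:
  fixes F :: "('k::{real_normed_field,banach}, 'f::ab_group_add) graded_space" and n :: nat
  assumes F: "graded_seminormed_space F" and a: "koethe_matrix a" and b: "koethe_matrix b"
    and not: "\<not> uniform_estimate F a b S \<phi> k"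
  obtains z i j \<alpha> c where "z \<in> gcarrier F" "0 \<le> \<alpha>" "0 \<le> c"
    "\<And>q. q \<le> n \<Longrightarrow> \<alpha> * b j q \<le> (1/2) ^ n * a i (\<phi> q)"
    "\<And>q. q \<le> n \<Longrightarrow> gseminorm F q z \<le> (1/2) ^ n * b j (\<phi> q)"
    "c * a i (S k) \<le> 1" "real n + 1 \<le> c * \<alpha> * gseminorm F k z"
proof -
  interpret F: graded_seminormed_space F by fact
  note a0 = koethe_matrix_nonneg[OF a] and b0 = koethe_matrix_nonneg[OF b]
  \<comment> \<open>The factor \<open>4 ^ n\<close> compensates the two factors
    \<open>(1/2) ^ n\<close>, and \<open>n + 1\<close> is the size that remains.\<close>
  define C :: real where "C = (real n + 1) * 4 ^ n"
  have C: "0 < C" by (simp add: C_def)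
  obtain z i j where z: "z \<in> gcarrier F" and "\<not> (ennreal (gseminorm F k z) / ennreal (a i (S k))
      \<le> ennreal C * max_product
          (MAX q\<in>{..n}. ennreal (b j q) / ennreal (a i (\<phi> q)))
          (MAX q\<in>{..n}. ennreal (gseminorm F q z) / ennreal (b j (\<phi> q))))"
    using not C unfolding uniform_estimate_def by blast
  then have lt: "ennreal C * max_product
          (MAX q\<in>{..n}. ennreal (b j q) / ennreal (a i (\<phi> q)))
          (MAX q\<in>{..n}. ennreal (gseminorm F q z) / ennreal (b j (\<phi> q)))
      < ennreal (gseminorm F k z) / ennreal (a i (S k))" (is "_ * max_product ?u ?v < _")
    by (simp only: not_le)
  have "max_product ?u ?v \<noteq> \<infinity>"
  proof
    assume "max_product ?u ?v = \<infinity>"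
    then have "ennreal C * max_product ?u ?v = \<infinity>" using C by (simp add: ennreal_mult_top)
    then show False using lt by simp
  qed
  then have fin: "?u \<noteq> \<infinity>" "?v \<noteq> \<infinity>" by (auto simp: max_product_def split: if_splits)
  note t0 = F.gseminorm_nonneg[OF z]
  obtain \<beta> where \<beta>: "0 \<le> \<beta>" "?u = ennreal \<beta>" "\<And>q. q \<le> n \<Longrightarrow> b j q \<le> \<beta> * a i (\<phi> q)"
    by (rule finite_max_of_ratios[OF fin(1) a0 b0]) blast
  obtain \<gamma> where \<gamma>: "0 \<le> \<gamma>" "?v = ennreal \<gamma>" "\<And>q. q \<le> n \<Longrightarrow> gseminorm F q z \<le> \<gamma> * b j (\<phi> q)"
    by (rule finite_max_of_ratios[OF fin(2) b0 t0]) blast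
  have "ennreal C * (ennreal \<beta> * ennreal \<gamma>) < ennreal (gseminorm F k z) / ennreal (a i (S k))"
    using lt unfolding \<beta>(2) \<gamma>(2) max_product_def by simp
  also have "ennreal C * (ennreal \<beta> * ennreal \<gamma>) = ennreal (C * \<beta> * \<gamma>)"
    using C \<beta>(1) \<gamma>(1) by (simp add: ennreal_mult mult.assoc)
  finally have lt': "ennreal (C * \<beta> * \<gamma>) < ennreal (gseminorm F k z) / ennreal (a i (S k))" .
  have C\<beta>\<gamma>: "0 \<le> C * \<beta> * \<gamma>" using C \<beta>(1) \<gamma>(1) by simp
  \<comment> \<open>\<open>c\<close> is the reciprocal of \<open>a i (S k)\<close>; if that weight
    vanishes, any sufficiently large number does.\<close>
  obtain c where c: "0 \<le> c" "c * a i (S k) \<le> 1" "C * \<beta> * \<gamma> < c * gseminorm F k z"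
  proof (cases "a i (S k) = 0")
    case True
    have "gseminorm F k z \<noteq> 0" using lt' by (intro notI) simp
    then have "0 < gseminorm F k z" using t0[of k] by simp
    then show ?thesis using True C\<beta>\<gamma> by (intro that[of "(C * \<beta> * \<gamma> + 1) / gseminorm F k z"]) auto
  next
    case False
    then have "0 < a i (S k)" using a0[of i "S k"] by simp
    then have "C * \<beta> * \<gamma> < gseminorm F k z / a i (S k)"
      using lt' t0[of k] C\<beta>\<gamma> by (simp add: divide_ennreal ennreal_less_iff)
    then show ?thesis using \<open>0 < a i (S k)\<close> by (intro that[of "1 / a i (S k)"]) auto
  qed
  obtain \<beta>' \<gamma>' where e: "\<beta> \<le> \<beta>'" "\<gamma> \<le> \<gamma>'" "0 < \<beta>'" "0 < \<gamma>'" "C * \<beta>' * \<gamma>' \<le> c * gseminorm F k z"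
    using enlarge_factors[OF \<beta>(1) \<gamma>(1) C c(3)] by blast
  \<comment> \<open>The enlarged maxima are divided out, one from each factor.\<close>
  define \<alpha> where "\<alpha> = (1/2) ^ n / \<beta>'"
  define y where "y = gscale F (of_real ((1/2) ^ n / \<gamma>')) z"
  have y: "gseminorm F q y = (1/2) ^ n / \<gamma>' * gseminorm F q z" for q
    unfolding y_def F.gseminorm_scale[OF z] norm_of_real using e by simp
  show ?thesis
  proof (rule that)
    show "y \<in> gcarrier F" unfolding y_def by (intro F.gcarrier_closed(5) z)
    show "0 \<le> \<alpha>" using e by (simp add: \<alpha>_def)
    show "0 \<le> c" "c * a i (S k) \<le> 1" by fact+
    show "\<alpha> * b j q \<le> (1/2) ^ n * a i (\<phi> q)" if "q \<le> n" for q
    proof -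
      have "b j q \<le> \<beta>' * a i (\<phi> q)"
        using \<beta>(3)[OF that] mult_right_mono[OF e(1) a0[of i "\<phi> q"]] by linarith
      then have "(1/2) ^ n * (b j q / \<beta>') \<le> (1/2) ^ n * a i (\<phi> q)"
        using e(3) by (intro mult_left_mono) (simp_all add: pos_divide_le_eq mult.commute)
      then show ?thesis by (simp add: \<alpha>_def)
    qed
    show "gseminorm F q y \<le> (1/2) ^ n * b j (\<phi> q)" if "q \<le> n" for q
    proof -
      have "gseminorm F q z \<le> \<gamma>' * b j (\<phi> q)"
        using \<gamma>(3)[OF that] mult_right_mono[OF e(2) b0[of j "\<phi> q"]] by linarith
      then have "(1/2) ^ n * (gseminorm F q z / \<gamma>') \<le> (1/2) ^ n * b j (\<phi> q)"
        using e(4) by (intro mult_left_mono) (simp_all add: pos_divide_le_eq mult.commute)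
      then show ?thesis by (simp add: y)
    qed
    have "(1/2) ^ n * (1/2) ^ n * (4 ^ n :: real) = 1"
      by (simp flip: power_mult_distrib)
    then have "real n + 1 = (1/2) ^ n * (1/2) ^ n * C" by (simp add: C_def)
    also have "\<dots> \<le> (1/2) ^ n * (1/2) ^ n * (c * gseminorm F k z / (\<beta>' * \<gamma>'))"
      using e by (intro mult_left_mono) (auto simp: pos_le_divide_eq mult.assoc)
    also have "\<dots> = c * \<alpha> * gseminorm F k y" by (simp add: y \<alpha>_def)
    finally show "real n + 1 \<le> c * \<alpha> * gseminorm F k y" .
  qed
qed

text \<open>The same \<open>S\<close> serves in tameness and in the estimate; only
  \<open>\<phi>\<close> enters the construction of the operator that violates tameness.\<close>

theorem tame_imp_estimate:
  fixes E :: "('k::{real_normed_field,banach}, nat \<Rightarrow> 'k) graded_space"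
    and F :: "('k, 'f::ab_group_add) graded_space"
  assumes E: "koethe_sequence_space E a" and b: "koethe_matrix b" and F: "graded_frechet_space F"
    and tame: "\<And>T. T \<in> factorable_operators E (koethe_l1 b) F \<Longrightarrow>
      \<exists>k0. \<forall>k\<ge>k0. continuity_characteristic E F T k \<le> enat (S k)"
  shows "\<exists>k0. \<forall>k\<ge>k0. uniform_estimate F a b S \<phi> k"
proof (rule ccontr)
  assume "\<not> ?thesis"
  then have "\<forall>k0. \<exists>k\<ge>k0. \<not> uniform_estimate F a b S \<phi> k" by blast
  then obtain bad where bad: "\<And>m. m \<le> bad m" "\<And>m. \<not> uniform_estimate F a b S \<phi> (bad m)" by metis
  \<comment> \<open>An index codes a pair, so every bad level is used for infinitely many
    \<open>n\<close>.\<close>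
  define \<kappa> where "\<kappa> n = bad (fst (prod_decode n))" for n
  let ?G = "koethe_l1 b :: ('k, nat \<Rightarrow> 'k) graded_space"
  interpret E: koethe_sequence_space E a by fact
  interpret G: koethe_sequence_space ?G b by (rule koethe_sequence_space_l1[OF b])
  have F': "graded_seminormed_space F" by (rule graded_frechet_imp_seminormed[OF F])
  interpret F: graded_seminormed_space F by (rule F')
  note a0 = koethe_matrix_nonneg[OF E.koethe] and b0 = koethe_matrix_nonneg[OF b]
  have "\<forall>n. \<exists>z i j \<alpha> c. z \<in> gcarrier F \<and> 0 \<le> \<alpha> \<and> 0 \<le> c \<and>
    (\<forall>q\<le>n. \<alpha> * b j q \<le> (1/2) ^ n * a i (\<phi> q)) \<and>
    (\<forall>q\<le>n. gseminorm F q z \<le> (1/2) ^ n * b j (\<phi> q)) \<and>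
    c * a i (S (\<kappa> n)) \<le> 1 \<and> real n + 1 \<le> c * \<alpha> * gseminorm F (\<kappa> n) z"
  proof
    fix n
    show "\<exists>z i j \<alpha> c. z \<in> gcarrier F \<and> 0 \<le> \<alpha> \<and> 0 \<le> c \<and>
      (\<forall>q\<le>n. \<alpha> * b j q \<le> (1/2) ^ n * a i (\<phi> q)) \<and>
      (\<forall>q\<le>n. gseminorm F q z \<le> (1/2) ^ n * b j (\<phi> q)) \<and>
      c * a i (S (\<kappa> n)) \<le> 1 \<and> real n + 1 \<le> c * \<alpha> * gseminorm F (\<kappa> n) z"
      by (rule not_uniform_estimateE[OF F' E.koethe b bad(2)[of "fst (prod_decode n)", folded \<kappa>_def], of n]) blast
  qed
  then obtain z i j \<alpha> c where z: "\<And>n. z n \<in> gcarrier F" and \<alpha>: "\<And>n. 0 \<le> \<alpha> n" and c: "\<And>n. 0 \<le> c n"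
    and \<alpha>_le: "\<And>n q. q \<le> n \<Longrightarrow> \<alpha> n * b (j n) q \<le> (1/2) ^ n * a (i n) (\<phi> q)"
    and z_le: "\<And>n q. q \<le> n \<Longrightarrow> gseminorm F q (z n) \<le> (1/2) ^ n * b (j n) (\<phi> q)"
    and c_le: "\<And>n. c n * a (i n) (S (\<kappa> n)) \<le> 1"
    and large: "\<And>n. real n + 1 \<le> c n * \<alpha> n * gseminorm F (\<kappa> n) (z n)"
    by metis
  obtain D1 \<rho>1 where D1: "\<And>r. 0 \<le> D1 r" "\<And>l r. \<alpha> l * b (j l) r \<le> (1/2) ^ l * D1 r * a (i l) (\<rho>1 r)"
    using rapid_decay_parameters[OF E.koethe, of "\<lambda>l r. \<alpha> l * b (j l) r" i \<phi>] \<alpha> b0 \<alpha>_le by (metis mult_nonneg_nonneg)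
  obtain D2 \<rho>2 where D2: "\<And>r. 0 \<le> D2 r" "\<And>l r. gseminorm F r (z l) \<le> (1/2) ^ l * D2 r * b (j l) (\<rho>2 r)"
    using rapid_decay_parameters[OF b, of "\<lambda>l r. gseminorm F r (z l)" j \<phi>] F.gseminorm_nonneg[OF z] z_le by metis
  \<comment> \<open>The summands send \<open>x\<close> to \<open>\<alpha> l * x (i l)\<close> times
    the \<open>j l\<close>-th unit vector; those of \<open>R\<close> read off coordinate
    \<open>j l\<close> and multiply \<open>z l\<close> by it.\<close>
  interpret Q: rapid_series E a ?G i "\<lambda>l. coordinate_vector (j l) (of_real (\<alpha> l))" D1 \<rho>1
    using D1 \<alpha> by (intro rapid_series.intro rapid_series_axioms.intro E
        graded_frechet_space_koethe_l1[OF b] G.coordinate_vector_in)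
      (simp_all add: G.gseminorm_coordinate_vector)
  interpret R: rapid_series ?G b F j z D2 \<rho>2
    using D2 by (intro rapid_series.intro rapid_series_axioms.intro F z
        koethe_sequence_space_l1[OF b]) simp_all
  \<comment> \<open>One sequence of pairs of bits steers both factors, so a single Baire argument
    suffices although \<open>T\<close> is not additive in the bits.\<close>
  define T where "T \<omega> x = R.series (bits (snd \<circ> \<omega>)) (Q.series (bits (fst \<circ> \<omega>)) x)" for \<omega> x
  have Qin: "Q.series s x \<in> gcarrier ?G" if "\<And>l. norm (s l) \<le> 1" "x \<in> gcarrier E" for s x
    using that by (rule Q.series_in)
  have T_in: "T \<omega> x \<in> gcarrier F" if "x \<in> gcarrier E" for \<omega> x
    unfolding T_def using that by (intro R.series_in Qin norm_bits)
  \<comment> \<open>The second component coded in \<open>p\<close> is the size to be exceeded. All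
    \<open>P p\<close> together say that \<open>T \<omega>\<close> is unbounded at every bad level
    with respect to the level given by \<open>S\<close>.\<close>
  define P where "P p \<omega> \<longleftrightarrow> (\<exists>x\<in>gcarrier E. gseminorm E (S (\<kappa> p)) x \<le> 1 \<and>
    real (snd (prod_decode p)) < gseminorm F (\<kappa> p) (T \<omega> x))" for p \<omega>
  have "\<exists>\<omega>' n'. (\<forall>l<n. \<omega>' l = \<omega> l) \<and> (\<forall>\<omega>''. (\<forall>l<n'. \<omega>'' l = \<omega>' l) \<longrightarrow> P p \<omega>'')" for p n and \<omega> :: "nat \<Rightarrow> bool \<times> bool"
  proof -
    define k where "k = \<kappa> p"
    define M where "M = snd (prod_decode p)"
    \<comment> \<open>Same first component as \<open>p\<close>, hence the same bad level. The second
      component makes \<open>N\<close> at least \<open>n\<close>, so the prefix is untouched, and at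
      least \<open>4 * M\<close>, so the \<open>N\<close>-th product is large enough.\<close>
    define N where "N = prod_encode (fst (prod_decode p), max n (4 * M))"
    have N: "n \<le> N" "4 * M \<le> N" and \<kappa>N: "\<kappa> N = k"
      using le_prod_encode_2[of "max n (4 * M)" "fst (prod_decode p)"] by (auto simp: N_def \<kappa>_def k_def)
    define x where "x = coordinate_vector (i N) (of_real (c N) :: 'k)"
    have x: "x \<in> gcarrier E" unfolding x_def by (rule E.coordinate_vector_in)
    have x_le: "gseminorm E (S k) x \<le> 1"
      using c_le[of N] c[of N] by (simp add: x_def E.gseminorm_coordinate_vector \<kappa>N)
    define W where "W u w = fun_upd \<omega> N (u, w)" for u w :: bool
    define Qu where "Qu u = Q.series (bits (fun_upd (fst \<circ> \<omega>) N u)) x" for u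
    define Rw where "Rw w = R.series (bits (fun_upd (snd \<circ> \<omega>) N w))" for w
    define y where "y = gscale ?G (x (i N)) (coordinate_vector (j N) (of_real (\<alpha> N)))"
    have Qu_in: "Qu u \<in> gcarrier ?G" for u unfolding Qu_def by (intro Qin x norm_bits)
    have y_in: "y \<in> gcarrier ?G" unfolding y_def by (intro G.gcarrier_closed(5) G.coordinate_vector_in)
    have TW: "T (W u w) x = Rw w (Qu u)" for u w
    proof -
      have "fst \<circ> W u w = fun_upd (fst \<circ> \<omega>) N u" "snd \<circ> W u w = fun_upd (snd \<circ> \<omega>) N w"
        by (auto simp: W_def fun_eq_iff)
      then show ?thesis by (simp add: T_def Qu_def Rw_def)
    qed
    have Q_flip: "Qu True = y + Qu False"
      unfolding Qu_def y_def by (rule Q.series_bits_flip[OF x])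
    have R_add: "Rw w (y + Qu False) = Rw w y + Rw w (Qu False)" for w
      unfolding Rw_def by (rule R.series_add[OF norm_bits y_in Qu_in])
    have R_flip: "Rw True y = gscale F (y (j N)) (z N) + Rw False y"
      unfolding Rw_def by (rule R.series_bits_flip[OF y_in])
    have yj: "y (j N) = of_real (c N * \<alpha> N)"
      by (simp add: y_def x_def coordinate_vector_def gscale_koethe_l1)
    \<comment> \<open>The four products obtained from the two choices of the \<open>N\<close>-th bits combine to
      \<open>R\<^sub>N Q\<^sub>N\<close>, so one of them is large; the cross terms never have to be estimated.\<close>
    have id: "gscale F (y (j N)) (z N) =
        (T (W True True) x - T (W False True) x) - (T (W True False) x - T (W False False) x)"
      unfolding TW Q_flip R_add R_flip by simp
    have "real N + 1 \<le> gseminorm F k (gscale F (y (j N)) (z N))"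
      using large[of N] \<alpha>[of N] c[of N] unfolding yj F.gseminorm_scale[OF z] norm_of_real \<kappa>N
      by (simp add: abs_mult)
    also have "\<dots> \<le> gseminorm F k (T (W True True) x - T (W False True) x) +
        gseminorm F k (T (W True False) x - T (W False False) x)"
      unfolding id by (intro F.gseminorm_diff_triangle F.gcarrier_closed(3) T_in x)
    also have "\<dots> \<le> (gseminorm F k (T (W True True) x) + gseminorm F k (T (W False True) x)) +
        (gseminorm F k (T (W True False) x) + gseminorm F k (T (W False False) x))"
      by (intro add_mono F.gseminorm_diff_triangle T_in x)
    finally have sum4: "real N + 1 \<le> \<dots>" .
    have "\<exists>u w. real M < gseminorm F k (T (W u w) x)"
    proof (rule ccontr)
      assume "\<nexists>u w. real M < gseminorm F k (T (W u w) x)"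
      then have "gseminorm F k (T (W u w) x) \<le> real M" for u w by (meson not_le)
      from this[of True True] this[of True False] this[of False True] this[of False False]
      have "real N + 1 \<le> 4 * real M" using sum4 by linarith
      moreover have "4 * real M \<le> real N" using N(2) by linarith
      ultimately show False by linarith
    qed
    then obtain u w where uw: "real M < gseminorm F k (T (W u w) x)" by blast
    \<comment> \<open>The constants of the two series are multiplied along the levels
      \<open>\<rho>2 k\<close> and \<open>\<rho>1 (\<rho>2 k)\<close>. Changing bits from
      \<open>n'\<close> on in both factors alters the value at \<open>x\<close> by at most
      \<open>(1/2) ^ n' * (2 * B)\<close>, which is to stay below the margin
      \<open>g\<close>.\<close>
    define B where "B = 2 * D2 k * (2 * D1 (\<rho>2 k) * gseminorm E (\<rho>1 (\<rho>2 k)) x)"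
    define g where "g = gseminorm F k (T (W u w) x) - real M"
    have "0 < g" using uw by (simp add: g_def)
    have "(\<lambda>n. (1/2) ^ n * (2 * B)) \<longlonglongrightarrow> 0 * (2 * B)"
      by (intro tendsto_mult LIMSEQ_power_zero tendsto_const) simp
    then have "\<forall>\<^sub>F n in sequentially. (1/2) ^ n * (2 * B) < g"
      using \<open>0 < g\<close> by (intro order_tendstoD(2)[of _ "0 * (2 * B)"]) auto
    then obtain n' where n': "(1/2) ^ n' * (2 * B) < g"
      by (metis eventually_sequentially order_refl)
    have "P p \<omega>''" if agree: "\<forall>l<n'. \<omega>'' l = W u w l" for \<omega>''
    proof -
      let ?s = "bits (fst \<circ> W u w) :: nat \<Rightarrow> 'k" and ?s'' = "bits (fst \<circ> \<omega>'') :: nat \<Rightarrow> 'k"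
      let ?t = "bits (snd \<circ> W u w) :: nat \<Rightarrow> 'k" and ?t'' = "bits (snd \<circ> \<omega>'') :: nat \<Rightarrow> 'k"
      let ?ds = "\<lambda>l. ?s l - ?s'' l" and ?dt = "\<lambda>l. ?t l - ?t'' l"
      have in_G: "Q.series ?ds x \<in> gcarrier ?G" "Q.series ?s'' x \<in> gcarrier ?G"
        by (intro Qin x norm_bits norm_bits_diff)+
      \<comment> \<open>The bits are exchanged first in the inner factor and then in the outer one;
        each exchange leaves one small difference term.\<close>
      have "T (W u w) x = R.series ?t (Q.series ?ds x + Q.series ?s'' x)"
        unfolding T_def using Q.series_bits_diff[OF x] by simp
      also have "\<dots> = R.series ?t (Q.series ?ds x) + R.series ?t (Q.series ?s'' x)"
        by (rule R.series_add[OF norm_bits in_G])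
      also have "R.series ?t (Q.series ?s'' x) = R.series ?dt (Q.series ?s'' x) + T \<omega>'' x"
        unfolding T_def by (rule R.series_bits_diff[OF in_G(2)])
      finally have split: "T (W u w) x = R.series ?t (Q.series ?ds x) + (R.series ?dt (Q.series ?s'' x) + T \<omega>'' x)" .
      have mono: "2 * D2 k * gseminorm ?G (\<rho>2 k) v \<le> e * B"
        if "gseminorm ?G (\<rho>2 k) v \<le> e * (2 * D1 (\<rho>2 k) * gseminorm E (\<rho>1 (\<rho>2 k)) x)" for v e
        using mult_left_mono[OF that, of "2 * D2 k"] D2(1)[of k] by (simp add: B_def mult_ac)
      have 1: "gseminorm F k (R.series ?t (Q.series ?ds x)) \<le> (1/2) ^ n' * B"
      proof -
        have "gseminorm F k (R.series ?t (Q.series ?ds x)) \<le>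
            (1/2) ^ 0 * (2 * D2 k * gseminorm ?G (\<rho>2 k) (Q.series ?ds x))"
          by (rule R.series_tail_le) (auto simp: norm_bits in_G)
        moreover have "gseminorm ?G (\<rho>2 k) (Q.series ?ds x) \<le> (1/2) ^ n' *
            (2 * D1 (\<rho>2 k) * gseminorm E (\<rho>1 (\<rho>2 k)) x)"
          using agree by (intro Q.series_bits_agree_le x) simp
        ultimately show ?thesis using mono by fastforce
      qed
      have 2: "gseminorm F k (R.series ?dt (Q.series ?s'' x)) \<le> (1/2) ^ n' * B"
      proof -
        have "gseminorm F k (R.series ?dt (Q.series ?s'' x)) \<le>
            (1/2) ^ n' * (2 * D2 k * gseminorm ?G (\<rho>2 k) (Q.series ?s'' x))"
          using agree by (intro R.series_bits_agree_le in_G) simp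
        also have "\<dots> \<le> (1/2) ^ n' * (1 * B)"
        proof (intro mult_left_mono mono)
          show "gseminorm ?G (\<rho>2 k) (Q.series ?s'' x) \<le> 1 * (2 * D1 (\<rho>2 k) * gseminorm E (\<rho>1 (\<rho>2 k)) x)"
            using Q.series_tail_le[of ?s'' 0 x "\<rho>2 k"] x by (simp add: norm_bits)
        qed simp
        finally show ?thesis by simp
      qed
      have "gseminorm F k (T (W u w) x) \<le> gseminorm F k (R.series ?t (Q.series ?ds x)) +
          gseminorm F k (R.series ?dt (Q.series ?s'' x) + T \<omega>'' x)"
        unfolding split
        by (intro F.gseminorm_triangle F.gcarrier_closed(2) R.series_in in_G norm_bits norm_bits_diff T_in x)
      also have "gseminorm F k (R.series ?dt (Q.series ?s'' x) + T \<omega>'' x) \<le>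
          gseminorm F k (R.series ?dt (Q.series ?s'' x)) + gseminorm F k (T \<omega>'' x)"
        by (intro F.gseminorm_triangle R.series_in in_G norm_bits_diff T_in x)
      finally have "gseminorm F k (T (W u w) x) \<le> (1/2) ^ n' * (2 * B) + gseminorm F k (T \<omega>'' x)"
        using 1 2 by linarith
      then have "real M < gseminorm F k (T \<omega>'' x)" using n' by (simp add: g_def)
      then show ?thesis using x x_le unfolding P_def k_def M_def by blast
    qed
    moreover have "\<forall>l<n. W u w l = \<omega> l" using N(1) by (simp add: W_def)
    ultimately show ?thesis by blast
  qed
  then obtain \<omega> where \<omega>: "\<And>p. P p \<omega>" using baire_sequences[of P] by blast
  have "T \<omega> \<in> factorable_operators E ?G F"
    using composition_in_factorable_operators[OF E.graded_seminormed_space_axioms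
        G.graded_seminormed_space_axioms F' Q.series_continuous R.series_continuous,
        of "bits (fst \<circ> \<omega>)" "bits (snd \<circ> \<omega>)"] norm_bits unfolding T_def by blast
  then have cont: "T \<omega> \<in> continuous_operators E F"
    and "\<exists>k0. \<forall>k\<ge>k0. continuity_characteristic E F (T \<omega>) k \<le> enat (S k)"
    using tame by (auto simp: factorable_operators_def)
  then obtain k0 where "continuity_characteristic E F (T \<omega>) (bad k0) \<le> enat (S (bad k0))"
    using bad(1) by blast
  then obtain C where C: "\<And>x. x \<in> gcarrier E \<Longrightarrow>
      gseminorm F (bad k0) (T \<omega> x) \<le> C * gseminorm E (S (bad k0)) x"
    unfolding continuity_characteristic_le_iff[OF E.graded_seminormed_space_axioms F' cont] by blast
  \<comment> \<open>The pair of the level index \<open>k0\<close> and a size above the alleged bound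
    |C|.\<close>
  have "P (prod_encode (k0, nat \<lceil>\<bar>C\<bar>\<rceil>)) \<omega>" by (rule \<omega>)
  then obtain x where x: "x \<in> gcarrier E" "gseminorm E (S (bad k0)) x \<le> 1"
      "real (nat \<lceil>\<bar>C\<bar>\<rceil>) < gseminorm F (bad k0) (T \<omega> x)"
    by (auto simp: P_def \<kappa>_def)
  have "gseminorm F (bad k0) (T \<omega> x) \<le> C * gseminorm E (S (bad k0)) x" by (rule C[OF x(1)])
  also have "\<dots> \<le> \<bar>C\<bar> * 1"
    using x E.gseminorm_nonneg[OF x(1), of "S (bad k0)"] by (intro mult_mono) auto
  also have "\<dots> \<le> real (nat \<lceil>\<bar>C\<bar>\<rceil>)" by simp
  finally show False using x(3) by simp
qed

theorem proposition4p3: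
  fixes F :: "('k::{real_normed_field,banach}, 'f::ab_group_add) graded_space"
    and a b :: "nat \<Rightarrow> nat \<Rightarrow> real"
  assumes "graded_frechet_space F"
    and "koethe_matrix a"
    and "koethe_matrix b"
  shows
    "(tame_factorization (koethe_l1 a :: ('k, nat \<Rightarrow> 'k) graded_space)
                         (koethe_l1 b :: ('k, nat \<Rightarrow> 'k) graded_space) F
      \<longleftrightarrow>
      tame_factorization (koethe_c0 a :: ('k, nat \<Rightarrow> 'k) graded_space)
                         (koethe_l1 b :: ('k, nat \<Rightarrow> 'k) graded_space) F)
     \<and>
     (tame_factorization (koethe_l1 a :: ('k, nat \<Rightarrow> 'k) graded_space)
                         (koethe_l1 b :: ('k, nat \<Rightarrow> 'k) graded_space) F
      \<longleftrightarrow>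
      (\<exists>S::nat \<Rightarrow> nat. mono S \<and>
        (\<forall>\<phi>::nat \<Rightarrow> nat. mono \<phi> \<longrightarrow>
          (\<exists>k0. \<forall>k\<ge>k0. \<exists>qk::nat. \<exists>Ck::real. Ck > 0 \<and>
            (\<forall>z\<in>gcarrier F. \<forall>i j.
              ennreal (gseminorm F k z) / ennreal (a i (S k))
              \<le> ennreal Ck *
                 max_product
                   (MAX q\<in>{..qk}. ennreal (b j q) / ennreal (a i (\<phi> q)))
                   (MAX q\<in>{..qk}. ennreal (gseminorm F q z) / ennreal (b j (\<phi> q))))))))"
proof -
  let ?l1 = "tame_factorization (koethe_l1 a :: ('k, nat \<Rightarrow> 'k) graded_space)
    (koethe_l1 b :: ('k, nat \<Rightarrow> 'k) graded_space) F"
  let ?c0 = "tame_factorization (koethe_c0 a :: ('k, nat \<Rightarrow> 'k) graded_space)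
    (koethe_l1 b :: ('k, nat \<Rightarrow> 'k) graded_space) F"
  let ?est = "\<exists>S::nat \<Rightarrow> nat. mono S \<and>
    (\<forall>\<phi>::nat \<Rightarrow> nat. mono \<phi> \<longrightarrow> (\<exists>k0. \<forall>k\<ge>k0. uniform_estimate F a b S \<phi> k))"
  \<comment> \<open>Stated for a general sequence space, so that it applies to both domains.\<close>
  have est: ?est if "tame_factorization E (koethe_l1 b) F" "koethe_sequence_space E a"
    for E :: "('k, nat \<Rightarrow> 'k) graded_space"
    using that(1) tame_imp_estimate[OF that(2) assms(3,1)] unfolding tame_factorization_def by meson
  have "?l1 \<and> ?c0" if ?est
    using that estimate_imp_tame[OF graded_frechet_imp_seminormed[OF assms(1)] assms(2,3)] by blast
  then have "(?l1 \<longleftrightarrow> ?c0) \<and> (?l1 \<longleftrightarrow> ?est)"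
    using est koethe_sequence_space_l1[OF assms(2)] koethe_sequence_space_c0[OF assms(2)] by blast
  then show ?thesis unfolding uniform_estimate_def .
qed

end
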